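(* Let $(Y_i,X_i)_{1\le i\le n}$ be independent copies of $(Y,X)\in\{0,1\}\times\mathbb{R}^p$, let $\pi(z)=\mathbb{P}(Y=1\mid X=z)$ and $\ell=\operatorname{logit}\pi=\log(\pi/(1-\pi))$. Fix $x\in\mathbb{R}^p$ and suppose that: (A1) the distribution of $X$ has a continuous density $f_X$ with respect to Lebesgue measure on $\mathbb{R}^p$, and $f_X(x)>0$; (A2) the function $\pi:\mathbb{R}^p\to[0,1]$ is twice differentiable with continuous second order derivatives at $x$, and $\pi(x)\in(0,1)$. If $k:=k_n\to\infty$ and $\lambda:=\lambda_n$ are such that $k^{1+p/2}/n\to\infty$, $k^{1+p/4}/n$ is bounded and $n\lambda^p/k^{1+p/2}\to c\in[0,\infty)$, then $$\begin{pmatrix}\sqrt{k}\,(\widehat{a}_n(x)-\ell(x))\\ \tau_{n,k}(x)\sqrt{k}\,(\widehat{b}_n(x)-\nabla\ell(x))\end{pmatrix}\stackrel{\mathrm{d}}{=}\operatorname*{arg\,max}_{u=(u_0,u_1,\ldots,u_p)^T\in\mathbb{R}^{p+1}}\Big\{u^T(W_n(x)+T_n(x))-\tfrac12u^T\Gamma(x)u-(c f_X(x)V_p)^{1/p}\sum_{j=1}^p\Big(\mathrm{sgn}(\nabla\ell_j(x))\,u_j\,\mathbf{1}_{\{\nabla\ell_j(x)\ne0\}}+|u_j|\,\mathbf{1}_{\{\nabla\ell_j(x)=0\}}\Big)\Big\}+o_{\mathbb{P}}(1),$$ where $W_n(x)$ and $T_n(x)$ are random vectors in $\mathbb{R}^{p+1}$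 with $W_n(x)\stackrel{\mathrm{d}}{\longrightarrow}\mathcal{N}(0,\Gamma(x))$ and $$T_n(x)=\tau_{n,k}^2(x)\sqrt{k}\left(\frac{1}{2(p+2)}\Big(\Delta\pi(x)-\frac{1-2\pi(x)}{\pi(x)(1-\pi(x))}\|\nabla\pi(x)\|_2^2\Big)\begin{pmatrix}1\\0_p\end{pmatrix}+o_{\mathbb{P}}(1)\right).$$
   Context: $\|\cdot\|_1$ and $\|\cdot\|_2$ are the $\ell_1$ and Euclidean norms; $\operatorname{expit}(t)=e^t/(1+e^t)$; $\Delta\pi(x)$ is the Laplacian of $\pi$ at $x$; $\nabla\ell_j(x)$ is the $j$th component of $\nabla\ell(x)$; $\mathrm{sgn}(t)=1$ if $t\ge0$ and $-1$ if $t<0$; $V_p$ is the volume of the Euclidean unit ball of $\mathbb{R}^p$; $0_p$ is the zero vector and $I_p$ the identity matrix. Further $k_n\in\{1,\dots,n\}$, $\lambda_n\ge0$, $$\tau_{n,k}(x)=\left(\frac{k}{n}\frac{1}{f_X(x)V_p}\right)^{1/p},\qquad \Gamma(x)=\pi(x)(1-\pi(x))\begin{pmatrix}1&0_p^T\\0_p&\frac{1}{p+2}I_p\end{pmatrix}.$$ $N_k(x)\subset\{1,\dots,n\}$ is the set of indices of the $k$ nearest neighbors $X_i$ of $x$ in Euclidean distance (almost surely there are no ties). The estimator is $$(\widehat{a}_n(x),\widehat{b}_n(x))=\operatorname*{arg\,max}_{(a,b)\in\mathbb{R}\times\mathbb{R}^p}\{L_n(a,b)-\lambda\|b\|_1\},$$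 $$L_n(a,b)=\sum_{i\in N_k(x)}\Big\{Y_i\log(\operatorname{expit}(a+b^T(X_i-x)))+(1-Y_i)\log(1-\operatorname{expit}(a+b^T(X_i-x)))\Big\},$$ understood as a measurable choice of maximizer, with an arbitrary value on the event where no maximizer exists. The symbol $\stackrel{\mathrm{d}}{=}$ denotes equality in distribution, and $o_{\mathbb{P}}(1)$ refers to $n\to\infty$. *)

theory Defs
  imports "HOL-Probability.Probability"
begin

definition expit :: "real \<Rightarrow> real" where
  "expit t = exp t / (1 + exp t)"

definition logit :: "real \<Rightarrow> real" where
  "logit s = ln (s / (1 - s))"

definition sgn_nonneg :: "real \<Rightarrow> real" where
  "sgn_nonneg t = (if t \<ge> 0 then 1 else - 1)"

definition norm1 :: "real ^ 'p \<Rightarrow> real" where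
  "norm1 b = (\<Sum>j\<in>UNIV. \<bar>b $ j\<bar>)"

definition gradient :: "(real ^ 'p \<Rightarrow> real) \<Rightarrow> real ^ 'p \<Rightarrow> real ^ 'p" where
  "gradient f z = (\<chi> j. frechet_derivative f (at z) (axis j 1))"

definition hessian :: "(real ^ 'p \<Rightarrow> real) \<Rightarrow> real ^ 'p \<Rightarrow> real ^ 'p ^ 'p" where
  "hessian f z = matrix (frechet_derivative (gradient f) (at z))"

definition laplacian :: "(real ^ 'p \<Rightarrow> real) \<Rightarrow> real ^ 'p \<Rightarrow> real" where
  "laplacian f z = trace (hessian f z)"

text \<open>Second order derivatives can only be continuous at \<open>x\<close> if they exist near \<open>x\<close>;
  no differentiability is required away from \<open>x\<close>.\<close>

definition C2_at :: "(real ^ 'p \<Rightarrow> real) \<Rightarrow> real ^ 'p \<Rightarrow> bool" where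
  "C2_at f x \<longleftrightarrow>
     (\<forall>\<^sub>F z in nhds x. f differentiable (at z) \<and> gradient f differentiable (at z)) \<and>
     isCont (hessian f) x"

text \<open>\<open>weak_conv\<close> and \<open>weak_conv_m\<close> of the library only treat measures on the real line.\<close>

definition weak_conv_vec ::
    "(nat \<Rightarrow> 'a::euclidean_space measure) \<Rightarrow> 'a measure \<Rightarrow> bool" where
  "weak_conv_vec \<mu>s \<mu> \<longleftrightarrow>
     (\<forall>g::'a \<Rightarrow> real. continuous_on UNIV g \<and> bounded (range g) \<longrightarrow>
        (\<lambda>n. integral\<^sup>L (\<mu>s n) g) \<longlonglongrightarrow> integral\<^sup>L \<mu> g)"

text \<open>\<open>\<mu>\<close> is the normal distribution with mean \<open>m\<close> and covariance operator \<open>S\<close>, given by its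
  characteristic function (so that singular covariances are allowed).\<close>

definition is_normal_vec ::
    "'a::euclidean_space \<Rightarrow> ('a \<Rightarrow> 'a) \<Rightarrow> 'a measure \<Rightarrow> bool" where
  "is_normal_vec m S \<mu> \<longleftrightarrow> prob_space \<mu> \<and> sets \<mu> = sets borel \<and>
     (\<forall>t. (CLINT u|\<mu>. iexp (t \<bullet> u)) =
          exp (\<i> * complex_of_real (t \<bullet> m) - complex_of_real (t \<bullet> S t) / 2))"

definition small_o_P :: "'w measure \<Rightarrow> (nat \<Rightarrow> 'w \<Rightarrow> 'a::euclidean_space) \<Rightarrow> bool" where
  "small_o_P M R \<longleftrightarrow>
     (\<forall>\<epsilon>>0. (\<lambda>n. measure M {\<omega> \<in> space M. norm (R n \<omega>) > \<epsilon>}) \<longlonglongrightarrow> 0)"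

text \<open>Points with indices in \<open>{1..n}\<close>; ties in the distance are broken by the index, so that
  exactly \<open>k\<close> indices are selected whenever \<open>k \<le> n\<close>.\<close>

definition nearest :: "nat \<Rightarrow> nat \<Rightarrow> (nat \<Rightarrow> real ^ 'p) \<Rightarrow> real ^ 'p \<Rightarrow> nat set" where
  "nearest n k xs x = {i \<in> {1..n}.
     card {j \<in> {1..n}. dist (xs j) x < dist (xs i) x \<or>
                       dist (xs j) x = dist (xs i) x \<and> j < i} < k}"

definition local_loglik :: "nat \<Rightarrow> nat \<Rightarrow> (nat \<Rightarrow> real) \<Rightarrow> (nat \<Rightarrow> real ^ 'p) \<Rightarrow> real ^ 'p \<Rightarrow>
    real \<times> (real ^ 'p) \<Rightarrow> real" where
  "local_loglik n k ys xs x = (\<lambda>(a, b). \<Sum>i\<in>nearest n k xs x.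
      ys i * ln (expit (a + b \<bullet> (xs i - x))) +
      (1 - ys i) * ln (1 - expit (a + b \<bullet> (xs i - x))))"

definition penalized_loglik :: "nat \<Rightarrow> nat \<Rightarrow> real \<Rightarrow> (nat \<Rightarrow> real) \<Rightarrow> (nat \<Rightarrow> real ^ 'p) \<Rightarrow>
    real ^ 'p \<Rightarrow> real \<times> (real ^ 'p) \<Rightarrow> real" where
  "penalized_loglik n k l ys xs x =
     (\<lambda>(a, b). local_loglik n k ys xs x (a, b) - l * norm1 b)"

definition vol_ball :: "'p::finite itself \<Rightarrow> real" where
  "vol_ball _ = measure lborel (cball (0 :: real ^ 'p) 1)"

definition tau :: "(real ^ 'p \<Rightarrow> real) \<Rightarrow> nat \<Rightarrow> nat \<Rightarrow> real ^ 'p \<Rightarrow> real" where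
  "tau f n k x =
     (real k / real n * (1 / (f x * vol_ball TYPE('p)))) powr (1 / real CARD('p))"

text \<open>From here on \<open>(p + 1)\<close>-dimensional Euclidean space is \<open>real \<times> (real ^ 'p)\<close>, and the
  block diagonal matrix \<open>\<Gamma>\<close> is given as a linear operator on it.\<close>

definition Gamma_op ::
    "(real ^ 'p \<Rightarrow> real) \<Rightarrow> real ^ 'p \<Rightarrow> real \<times> (real ^ 'p) \<Rightarrow> real \<times> (real ^ 'p)" where
  "Gamma_op \<pi> x = (\<lambda>(u0, u).
     (\<pi> x * (1 - \<pi> x)) *\<^sub>R (u0, (1 / (real CARD('p) + 2)) *\<^sub>R u))"

definition bias_coeff :: "(real ^ 'p \<Rightarrow> real) \<Rightarrow> real ^ 'p \<Rightarrow> real" where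
  "bias_coeff \<pi> x = 1 / (2 * (real CARD('p) + 2)) *
     (laplacian \<pi> x -
      (1 - 2 * \<pi> x) / (\<pi> x * (1 - \<pi> x)) * (norm (gradient \<pi> x))\<^sup>2)"

definition limit_objective :: "(real ^ 'p \<Rightarrow> real) \<Rightarrow> (real ^ 'p \<Rightarrow> real) \<Rightarrow> real \<Rightarrow> real ^ 'p \<Rightarrow>
    real \<times> (real ^ 'p) \<Rightarrow> real \<times> (real ^ 'p) \<Rightarrow> real" where
  "limit_objective \<pi> f c x v u =
     u \<bullet> v - 1 / 2 * (u \<bullet> Gamma_op \<pi> x u) -
     (c * f x * vol_ball TYPE('p)) powr (1 / real CARD('p)) *
     (let g = gradient (logit \<circ> \<pi>) x in
      \<Sum>j\<in>UNIV. sgn_nonneg (g $ j) * (snd u $ j) * of_bool (g $ j \<noteq> 0) +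
                 \<bar>snd u $ j\<bar> * of_bool (g $ j = 0))"

end

theory Submission
  imports Defs
begin

text \<open>
  Rescale the parameters around the truth by \<open>sqrt k\<close> and \<open>\<tau> * sqrt k\<close>. On bounded sets of the
  rescaled parameter the increment of the penalized log likelihood is, uniformly and up to
  \<open>o\<^sub>P(1)\<close>, the strongly concave limit objective at the score: the Hessian converges by a law of large
  numbers for nearest neighbours, the penalty by an exact computation. Concavity of the log likelihood and
  strong concavity of the limit then force the two maximizers together.

  The \<open>k\<close> nearest neighbours and the sample points in the ball of radius \<open>\<tau>\<close> are nested sets
  whose cardinalities differ by \<open>o\<^sub>P(k)\<close>. The residuals being uncorrelated given the design, replacing
  one set by the other changes the score by \<open>o\<^sub>P(1)\<close>. What remains is a sum of
  independent terms, handled by characteristic functions, and a deterministic bias coming from a second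
  order Taylor expansion. All errors perturb the objective negligibly on bounded sets, hence go into the
  remainder \<open>R\<close>: \<open>T\<close> can be taken deterministic and \<open>S = 0\<close>.
\<close>

section \<open>Nearest neighbours\<close>

text \<open>The radius solves \<open>n * f x * vol_ball * \<tau>^p = k\<close>. This turns the
  conditions on \<open>k\<close> into \<open>rate = \<tau> * sqrt k\<close> tending to infinity and
  \<open>\<tau>^2 * sqrt k\<close> staying bounded, and the condition on \<open>l\<close> into
  convergence of \<open>l / rate\<close>. A diverging rate makes slope perturbations too small to
  change the sign of a nonzero gradient component, so the penalty is linear there. The obstacle is
  that the neighbour set depends on the whole design: sums over it do not have independent terms,
  and exchanging o(k) terms is not negligible by itself after division by \<open>sqrt k\<close>.
  Orthogonality of the residuals leaves only second moments, which are proportional to the number of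
  exchanged terms. Conditioning on the design is realized by integrating out one pair with all
  others frozen. The limit objective separates over coordinates. Its maximizer is therefore explicit
  (soft thresholding), hence measurable, and comes with an explicit quadratic gap. Since
  \<open>R\<close> is the difference between the rescaled estimator and this maximizer, the equality
  in law is an equality of random vectors.\<close>

definition nn_rank :: "nat \<Rightarrow> (nat \<Rightarrow> 'a::metric_space) \<Rightarrow> 'a \<Rightarrow> nat \<Rightarrow> nat" where
  "nn_rank n xs x i = card {j \<in> {1..n}. dist (xs j) x < dist (xs i) x \<or>
                       dist (xs j) x = dist (xs i) x \<and> j < i}"

lemma nearest_eq_rank: "nearest n k xs x = {i \<in> {1..n}. nn_rank n xs x i < k}"
  by (simp add: nearest_def nn_rank_def)

lemma nn_rank_less:
  assumes "i \<in> {1..n}"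
    and "dist (xs i) x < dist (xs j) x \<or> dist (xs i) x = dist (xs j) x \<and> i < j"
  shows "nn_rank n xs x i < nn_rank n xs x j"
  unfolding nn_rank_def using assms
  by (intro psubset_card_mono) auto

text \<open>The lexicographic order on (distance, index) is strict and total, so ranks are distinct;
  n distinct values below n exhaust \<open>{..<n}\<close>. This is why exactly k indices have rank
  below k.\<close>

lemma bij_betw_nn_rank: "bij_betw (nn_rank n xs x) {1..n} {..<n}"
proof (rule bij_betw_imageI)
  show inj: "inj_on (nn_rank n xs x) {1..n}"
    by (rule linorder_inj_onI') (metis less_irrefl linorder_less_linear nn_rank_less)
  have "nn_rank n xs x i < n" if "i \<in> {1..n}" for i
  proof -
    have "nn_rank n xs x i \<le> card ({1..n} - {i})"
      unfolding nn_rank_def by (intro card_mono) auto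
    also have "\<dots> < n" using that by (auto simp: card_Diff_singleton)
    finally show ?thesis .
  qed
  then show "nn_rank n xs x ` {1..n} = {..<n}"
    using card_image[OF inj] by (intro card_subset_eq) auto
qed

lemma finite_nearest [simp]: "finite (nearest n k xs x)"
  by (simp add: nearest_def)

lemma nearest_subset: "nearest n k xs x \<subseteq> {1..n}"
  by (auto simp: nearest_def)

lemma card_nearest:
  assumes "k \<le> n" shows "card (nearest n k xs x) = k"
proof -
  have surj: "nn_rank n xs x ` {1..n} = {..<n}" and inj: "inj_on (nn_rank n xs x) {1..n}"
    using bij_betw_nn_rank[of n xs x] by (auto simp: bij_betw_def)
  have "nn_rank n xs x ` nearest n k xs x = {..<k}"
  proof (intro set_eqI iffI)
    fix r assume "r \<in> {..<k}"
    then have "r \<in> nn_rank n xs x ` {1..n}" using assms unfolding surj by simp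
    then show "r \<in> nn_rank n xs x ` nearest n k xs x"
      using \<open>r \<in> {..<k}\<close> unfolding nearest_eq_rank by blast
  qed (auto simp: nearest_eq_rank)
  then show ?thesis
    using card_image[OF inj_on_subset[OF inj nearest_subset[of n k xs x]]] by simp
qed

text \<open>If a selected index lies outside the ball, every point of the ball is strictly closer,
  has smaller rank, and is selected too.\<close>

lemma nearest_nested:
  "nearest n k xs x \<subseteq> {i \<in> {1..n}. dist (xs i) x \<le> r} \<or> {i \<in> {1..n}. dist (xs i) x \<le> r} \<subseteq> nearest n k xs x"
proof -
  { fix i j assume "i \<in> nearest n k xs x" "\<not> dist (xs i) x \<le> r" "j \<in> {1..n}" "dist (xs j) x \<le> r"
    then have "j \<in> nearest n k xs x"
      using nn_rank_less[of j n xs x i] by (auto simp: nearest_eq_rank) }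
  then show ?thesis using nearest_subset[of n k xs x] by blast
qed

text \<open>In the other nesting case a set of k indices contains a set of at least k indices, so
  both coincide.\<close>

lemma nearest_subset_cball:
  assumes "k \<le> n" and "k \<le> card {i \<in> {1..n}. dist (xs i) x \<le> r}"
  shows "nearest n k xs x \<subseteq> {i \<in> {1..n}. dist (xs i) x \<le> r}"
proof -
  have "nearest n k xs x = {i \<in> {1..n}. dist (xs i) x \<le> r}"
    if "{i \<in> {1..n}. dist (xs i) x \<le> r} \<subseteq> nearest n k xs x"
    using that assms card_mono[OF finite_nearest that]
    by (intro card_subset_eq[symmetric]) (auto simp: card_nearest)
  then show ?thesis using nearest_nested[of n k xs x r] by blast
qed

text \<open>By nesting, all indicator differences have the same sign, so the absolute value moves
  outside the sum. The size of the symmetric difference becomes the error of a ball count, which a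
  law of large numbers controls.\<close>

lemma sum_abs_nearest_diff:
  assumes "k \<le> n"
  shows "(\<Sum>i\<in>{1..n}. \<bar>of_bool (i \<in> nearest n k xs x) - of_bool (dist (xs i) x \<le> r)\<bar>) =
    \<bar>(\<Sum>i\<in>{1..n}. of_bool (dist (xs i) x \<le> r)) - real k\<bar>"
proof -
  have k: "real k = (\<Sum>i\<in>{1..n}. of_bool (i \<in> nearest n k xs x))"
    using card_nearest[OF assms, of xs x] nearest_subset[of n k xs x]
    by (simp add: Int_absorb1 Int_commute Int_def[symmetric])
  consider "nearest n k xs x \<subseteq> {i \<in> {1..n}. dist (xs i) x \<le> r}"
    | "{i \<in> {1..n}. dist (xs i) x \<le> r} \<subseteq> nearest n k xs x"
    using nearest_nested by blast
  then show ?thesis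
  proof cases
    case 1
    have "(\<Sum>i\<in>{1..n}. \<bar>of_bool (i \<in> nearest n k xs x) - of_bool (dist (xs i) x \<le> r)\<bar> :: real) =
      (\<Sum>i\<in>{1..n}. of_bool (dist (xs i) x \<le> r) - of_bool (i \<in> nearest n k xs x))"
      using 1 by (intro sum.cong) auto
    moreover have "\<dots> \<ge> 0" using 1 by (intro sum_nonneg) auto
    ultimately show ?thesis unfolding k by (simp add: sum_subtractf)
  next
    case 2
    have "(\<Sum>i\<in>{1..n}. \<bar>of_bool (i \<in> nearest n k xs x) - of_bool (dist (xs i) x \<le> r)\<bar> :: real) =
      (\<Sum>i\<in>{1..n}. of_bool (i \<in> nearest n k xs x) - of_bool (dist (xs i) x \<le> r))"
      using 2 by (intro sum.cong) auto
    moreover have "\<dots> \<ge> 0" using 2 by (intro sum_nonneg) auto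
    ultimately show ?thesis unfolding k by (simp add: sum_subtractf)
  qed
qed

lemma measurable_nearest [measurable]:
  assumes [measurable]: "\<And>i. i \<in> {1..n} \<Longrightarrow> Xs i \<in> borel_measurable M"
  shows "Measurable.pred M (\<lambda>\<omega>. i \<in> nearest n k (\<lambda>i. Xs i \<omega>) x)"
proof (cases "i \<in> {1..n}")
  case True
  define Q where "Q \<omega> j \<longleftrightarrow> dist (Xs j \<omega>) x < dist (Xs i \<omega>) x \<or>
      dist (Xs j \<omega>) x = dist (Xs i \<omega>) x \<and> j < i" for \<omega> j
  have [measurable]: "Xs i \<in> borel_measurable M" using True assms by auto
  have [measurable]: "Measurable.pred M (\<lambda>\<omega>. Q \<omega> j)" if "j \<in> {1..n}" for j
    using assms[OF that] unfolding Q_def by measurable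
  \<comment> \<open>Writing the rank as a finite sum of indicators reduces measurability of the
    selection to that of distance comparisons.\<close>
  have "real (nn_rank n (\<lambda>i. Xs i \<omega>) x i) = (\<Sum>j\<in>{1..n}. if Q \<omega> j then 1 else 0)" for \<omega>
    unfolding nn_rank_def Q_def[symmetric] by (simp add: sum.If_cases Int_def)
  then have "i \<in> nearest n k (\<lambda>i. Xs i \<omega>) x \<longleftrightarrow> (\<Sum>j\<in>{1..n}. if Q \<omega> j then 1 else 0) < real k" for \<omega>
    using True by (metis (no_types, lifting) mem_Collect_eq nearest_eq_rank of_nat_less_iff)
  then show ?thesis by simp
next
  case False
  then have "(\<lambda>\<omega>. i \<in> nearest n k (\<lambda>i. Xs i \<omega>) x) = (\<lambda>_. False)"
    using nearest_subset by blast
  then show ?thesis by simp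
qed

section \<open>Characteristic functions and weak convergence in Euclidean space\<close>

text \<open>The real trigonometric polynomials: the functions whose integrals are determined by the
  characteristic function. Being generated inductively, they allow each property to be checked on
  sine, cosine, sums and multiples only.\<close>

inductive trig_fun :: "('a::euclidean_space \<Rightarrow> real) \<Rightarrow> bool" where
    trig_cos: "trig_fun (\<lambda>x. cos (t \<bullet> x))"
  | trig_sin: "trig_fun (\<lambda>x. sin (t \<bullet> x))"
  | trig_add: "trig_fun f \<Longrightarrow> trig_fun g \<Longrightarrow> trig_fun (\<lambda>x. f x + g x)"
  | trig_scale: "trig_fun f \<Longrightarrow> trig_fun (\<lambda>x. c * f x)"

lemma trig_const: "trig_fun (\<lambda>x. c)"
  using trig_scale[OF trig_cos[of 0], of c] by simp

lemma trig_sum: "finite A \<Longrightarrow> (\<And>i. i \<in> A \<Longrightarrow> trig_fun (f i)) \<Longrightarrow> trig_fun (\<lambda>x. \<Sum>i\<in>A. f i x)"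
  by (induction A rule: finite_induct) (auto intro: trig_const trig_add)

text \<open>Product-to-sum formulas; they make the trigonometric polynomials an algebra.\<close>

lemma trig_times_cos_sin:
  assumes "trig_fun f"
  shows "trig_fun (\<lambda>x. f x * cos (t \<bullet> x)) \<and> trig_fun (\<lambda>x. f x * sin (t \<bullet> x))"
  using assms
proof induction
  case (trig_cos s)
  have "cos (s \<bullet> x) * cos (t \<bullet> x) = (1/2) * cos ((s - t) \<bullet> x) + (1/2) * cos ((s + t) \<bullet> x)"
    "cos (s \<bullet> x) * sin (t \<bullet> x) = (1/2) * sin ((s + t) \<bullet> x) + (-1/2) * sin ((s - t) \<bullet> x)" for x
    by (simp_all add: inner_diff_left inner_add_left cos_diff cos_add sin_add sin_diff field_simps)
  then show ?case
    by (simp only:) (intro conjI trig_fun.intros)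
next
  case (trig_sin s)
  have "sin (s \<bullet> x) * cos (t \<bullet> x) = (1/2) * sin ((s + t) \<bullet> x) + (1/2) * sin ((s - t) \<bullet> x)"
    "sin (s \<bullet> x) * sin (t \<bullet> x) = (1/2) * cos ((s - t) \<bullet> x) + (-1/2) * cos ((s + t) \<bullet> x)" for x
    by (simp_all add: inner_diff_left inner_add_left cos_diff cos_add sin_add sin_diff field_simps)
  then show ?case
    by (simp only:) (intro conjI trig_fun.intros)
next
  case (trig_add f g)
  then show ?case by (simp add: distrib_right trig_fun.trig_add)
next
  case (trig_scale f c)
  then show ?case by (simp add: mult.assoc trig_fun.trig_scale)
qed

lemma trig_mult:
  assumes f: "trig_fun f" and "trig_fun g"
  shows "trig_fun (\<lambda>x. f x * g x)"
  using assms(2)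
proof induction
  case (trig_add g h)
  then show ?case by (simp add: distrib_left trig_fun.trig_add)
next
  case (trig_scale g c)
  then show ?case using trig_fun.trig_scale[of "\<lambda>x. f x * g x" c] by (simp add: mult_ac)
qed (use trig_times_cos_sin[OF f] in auto)

text \<open>Maps the whole space into the cube of side 2 and is invertible by \<open>arcsin\<close>
  where all \<open>s * (x \<bullet> b)\<close> are at most 1 in absolute value. A polynomial
  composed with it is a trigonometric polynomial that sees only points of the cube; this is the
  source of the global bound.\<close>

definition sin_chart :: "real \<Rightarrow> 'a::euclidean_space \<Rightarrow> 'a" where
  "sin_chart s x = (\<Sum>b\<in>Basis. sin (s * (x \<bullet> b)) *\<^sub>R b)"

lemma trig_polynomial_sin_chart:
  assumes "real_polynomial_function q"
  shows "trig_fun (\<lambda>x. q (sin_chart s x))"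
  using assms
proof induction
  case (linear q)
  then interpret bounded_linear q .
  have "q (sin_chart s x) = (\<Sum>b\<in>Basis. q b * sin ((s *\<^sub>R b) \<bullet> x))" for x
    by (simp add: sin_chart_def sum scaleR inner_commute mult.commute)
  then show ?case by (simp only:) (intro trig_sum trig_scale trig_sin finite_Basis)
qed (auto intro: trig_const trig_add trig_mult)

text \<open>A trigonometric polynomial close to \<open>f\<close> on a large ball which, unlike an arbitrary
  uniform approximation there, is bounded everywhere by a constant independent of the ball.\<close>

lemma trig_approximation:
  fixes f :: "'a::euclidean_space \<Rightarrow> real"
  assumes cont: "continuous_on UNIV f" and bnd: "\<And>x. \<bar>f x\<bar> \<le> B" and "e > 0" "K > 0"
  obtains h where "trig_fun h" "\<And>x. norm x \<le> K \<Longrightarrow> \<bar>f x - h x\<bar> < e" "\<And>x. \<bar>h x\<bar> \<le> B + e"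
proof -
  \<comment> \<open>This is \<open>f\<close> read in the chart with \<open>s = 1 / K\<close>. A
    polynomial close to \<open>F\<close> on the cube is close to \<open>f\<close> on the ball of
    radius \<open>K\<close>, and everywhere else it is still close to some value of
    \<open>f\<close>.\<close>
  define F where "F y = f (\<Sum>b\<in>Basis. (K * arcsin (y \<bullet> b)) *\<^sub>R b)" for y :: 'a
  have box: "y \<in> cbox (- One) One \<longleftrightarrow> (\<forall>b\<in>Basis. \<bar>y \<bullet> b\<bar> \<le> 1)" for y :: 'a
    by (simp add: mem_box abs_le_iff) (metis minus_le_iff)
  have "continuous_on (cbox (- One) One) F"
    unfolding F_def
    by (rule continuous_on_compose2[OF cont], intro continuous_intros)
      (auto simp: box abs_le_iff)
  then obtain q where q: "real_polynomial_function q" "\<And>y. y \<in> cbox (- One) One \<Longrightarrow> \<bar>F y - q y\<bar> < e"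
    using Stone_Weierstrass_real_polynomial_function[OF compact_cbox _ \<open>e > 0\<close>] by metis
  have comp: "sin_chart s x \<bullet> b = sin (s * (x \<bullet> b))" if "b \<in> Basis" for s and x b :: 'a
    using that unfolding sin_chart_def by (simp add: inner_sum_left inner_Basis if_distrib cong: if_cong)
  have in_box: "sin_chart s x \<in> cbox (- One) One" for s and x :: 'a
    by (subst box) (simp add: comp)
  show ?thesis
  proof (rule that)
    show "trig_fun (\<lambda>x. q (sin_chart (1 / K) x))" by (rule trig_polynomial_sin_chart[OF q(1)])
    show "\<bar>f x - q (sin_chart (1 / K) x)\<bar> < e" if "norm x \<le> K" for x
    proof -
      have "K * arcsin (sin_chart (1 / K) x \<bullet> b) = x \<bullet> b" if b: "b \<in> Basis" for b
      proof -
        have "\<bar>x \<bullet> b / K\<bar> \<le> 1"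
          using Basis_le_norm[OF b, of x] \<open>norm x \<le> K\<close> \<open>K > 0\<close> by simp
        \<comment> \<open>The bound 1 is below \<open>pi / 2\<close>, so the arcsine inverts the
          sine.\<close>
        then have "arcsin (sin (x \<bullet> b / K)) = x \<bullet> b / K"
          using pi_ge_two unfolding abs_le_iff by (intro arcsin_sin) linarith+
        then show ?thesis using b \<open>K > 0\<close> by (simp add: comp)
      qed
      then have "F (sin_chart (1 / K) x) = f x"
        by (simp add: F_def euclidean_representation)
      then show ?thesis using q(2)[OF in_box, of "1 / K" x] by simp
    qed
    show "\<bar>q (sin_chart (1 / K) x)\<bar> \<le> B + e" for x
      using q(2)[OF in_box, of "1 / K" x] bnd[of "\<Sum>b\<in>Basis. (K * arcsin (sin_chart (1 / K) x \<bullet> b)) *\<^sub>R b"]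
      unfolding F_def by linarith
  qed
qed

lemma trig_fun_measurable: "trig_fun h \<Longrightarrow> h \<in> borel_measurable borel"
  by (induction rule: trig_fun.induct) auto

lemma trig_fun_bounded: "trig_fun h \<Longrightarrow> \<exists>B. \<forall>x. \<bar>h x\<bar> \<le> B"
proof (induction rule: trig_fun.induct)
  case (trig_add f g)
  then obtain B C where "\<And>x. \<bar>f x\<bar> \<le> B" "\<And>x. \<bar>g x\<bar> \<le> C" by blast
  then have "\<bar>f x + g x\<bar> \<le> B + C" for x by (meson abs_triangle_ineq add_mono order_trans)
  then show ?case by blast
next
  case (trig_scale f c)
  then obtain B where "\<And>x. \<bar>f x\<bar> \<le> B" by blast
  then have "\<bar>c * f x\<bar> \<le> \<bar>c\<bar> * B" for x by (simp add: abs_mult mult_left_mono)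
  then show ?case by blast
qed (auto intro!: exI[of _ 1])

lemma integrable_bounded_borel:
  fixes h :: "'a::euclidean_space \<Rightarrow> 'b::{banach, second_countable_topology}"
  assumes "prob_space \<mu>" "sets \<mu> = sets borel" "h \<in> borel_measurable borel" "\<And>x. norm (h x) \<le> B"
  shows "integrable \<mu> h"
proof -
  interpret prob_space \<mu> by fact
  have [measurable]: "h \<in> borel_measurable \<mu>"
    using assms(3) measurable_cong_sets[OF assms(2) refl, of borel] by blast
  show ?thesis using assms(4) by (intro integrable_const_bound[of _ B]) auto
qed

lemma trig_fun_integral_tendsto:
  assumes \<mu>s: "\<And>n. prob_space (\<mu>s n)" "\<And>n. sets (\<mu>s n) = sets borel"
    and \<mu>: "prob_space \<mu>" "sets \<mu> = sets borel"
    and ch: "\<And>t. (\<lambda>n. CLINT u|\<mu>s n. iexp (t \<bullet> u)) \<longlonglongrightarrow> (CLINT u|\<mu>. iexp (t \<bullet> u))"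
    and "trig_fun h"
  shows "(\<lambda>n. integral\<^sup>L (\<mu>s n) h) \<longlonglongrightarrow> integral\<^sup>L \<mu> h"
proof -
  have int: "integrable \<nu> g" if "prob_space \<nu>" "sets \<nu> = sets borel" "trig_fun g" for \<nu> and g :: "'a \<Rightarrow> real"
    using trig_fun_bounded[OF that(3)] trig_fun_measurable[OF that(3)] integrable_bounded_borel[OF that(1,2)]
    by (metis real_norm_def)
  have cint: "integrable \<nu> (\<lambda>u. iexp (t \<bullet> u))" if "prob_space \<nu>" "sets \<nu> = sets borel" for \<nu> and t :: 'a
    by (rule integrable_bounded_borel[OF that, of _ 1]) auto
  have re: "(LINT u|\<nu>. cos (t \<bullet> u)) = Re (CLINT u|\<nu>. iexp (t \<bullet> u))"
    and im: "(LINT u|\<nu>. sin (t \<bullet> u)) = Im (CLINT u|\<nu>. iexp (t \<bullet> u))"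
    if "prob_space \<nu>" "sets \<nu> = sets borel" for \<nu> and t :: 'a
    using integral_Re[OF cint[OF that, of t]] integral_Im[OF cint[OF that, of t]]
    by (simp_all add: Re_exp Im_exp)
  show ?thesis
    using \<open>trig_fun h\<close>
  proof induction
    case (trig_cos t)
    show ?case unfolding re[OF \<mu>s] re[OF \<mu>] by (intro tendsto_Re ch)
  next
    case (trig_sin t)
    show ?case unfolding im[OF \<mu>s] im[OF \<mu>] by (intro tendsto_Im ch)
  next
    case (trig_add f g)
    then show ?case by (simp add: int[OF \<mu>s] int[OF \<mu>] tendsto_add)
  next
    case (trig_scale f c)
    then show ?case by (simp add: tendsto_mult_left)
  qed
qed

lemma measure_norm_tail:
  fixes \<mu> :: "'a::euclidean_space measure"
  assumes "prob_space \<mu>" "sets \<mu> = sets borel" "e > 0"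
  obtains K :: real where "\<And>L. L \<ge> K \<Longrightarrow> measure \<mu> {u. norm u > L} < e"
proof -
  interpret prob_space \<mu> by fact
  have sp: "space \<mu> = UNIV" using sets_eq_imp_space_eq[OF assms(2)] by simp
  have S: "{u::'a. norm u > L} \<in> sets \<mu>" for L by (simp add: assms(2))
  have "(\<lambda>n::nat. measure \<mu> {u. norm u > real n}) \<longlonglongrightarrow> measure \<mu> (\<Inter>n::nat. {u. norm u > real n})"
    using S by (intro finite_Lim_measure_decseq) (auto simp: decseq_def)
  also have "(\<Inter>n::nat. {u::'a. norm u > real n}) = {}"
  proof (rule equals0I)
    fix u :: 'a assume u: "u \<in> (\<Inter>n::nat. {u. norm u > real n})"
    obtain n :: nat where "norm u \<le> real n" using real_arch_simple by blast
    moreover have "norm u > real n" using u by blast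
    ultimately show False by simp
  qed
  finally have "\<forall>\<^sub>F n in sequentially. measure \<mu> {u::'a. norm u > real n} < e"
    using \<open>e > 0\<close> by (intro order_tendstoD(2)[of _ 0]) auto
  then obtain n :: nat where n: "measure \<mu> {u::'a. norm u > real n} < e"
    by (auto simp: eventually_sequentially)
  have "measure \<mu> {u. norm u > L} < e" if "L \<ge> real n" for L
    using that S by (intro le_less_trans[OF finite_measure_mono n]) auto
  then show ?thesis by (rule that)
qed

lemma integral_diff_le_tail:
  fixes f h :: "'a::euclidean_space \<Rightarrow> real"
  assumes "prob_space \<mu>" "sets \<mu> = sets borel"
    and [measurable]: "f \<in> borel_measurable borel" "h \<in> borel_measurable borel"
    and "\<And>u. \<bar>f u\<bar> \<le> B" "\<And>u. \<bar>h u\<bar> \<le> C"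
    and near: "\<And>u. norm u \<le> K \<Longrightarrow> \<bar>f u - h u\<bar> \<le> e" and "e \<ge> 0"
  shows "\<bar>integral\<^sup>L \<mu> f - integral\<^sup>L \<mu> h\<bar> \<le> e + (B + C) * measure \<mu> {u. norm u > K}"
proof -
  interpret prob_space \<mu> by fact
  have sp: "space \<mu> = UNIV" using sets_eq_imp_space_eq[OF assms(2)] by simp
  have S [measurable]: "{u::'a. norm u > K} \<in> sets \<mu>" by (simp add: assms(2))
  have i: "integrable \<mu> f" "integrable \<mu> h"
    using assms by (auto intro!: integrable_bounded_borel[of \<mu>])
  have BC: "B \<ge> 0" "C \<ge> 0" using assms(5,6)[of 0] by auto
  have "\<bar>integral\<^sup>L \<mu> f - integral\<^sup>L \<mu> h\<bar> = \<bar>LINT u|\<mu>. f u - h u\<bar>" using i by simp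
  also have "\<dots> \<le> (LINT u|\<mu>. \<bar>f u - h u\<bar>)" by (rule integral_abs_bound)
  also have "\<dots> \<le> (LINT u|\<mu>. e + (B + C) * indicator {u. norm u > K} u)"
  proof (rule integral_mono)
    fix u
    show "\<bar>f u - h u\<bar> \<le> e + (B + C) * indicator {u. norm u > K} u"
      using near[of u] assms(5)[of u] assms(6)[of u] \<open>e \<ge> 0\<close> by (cases "norm u \<le> K") (auto simp: indicator_def)
  qed (use i S in \<open>auto intro!: integrable_add integrable_mult_right simp: finite_measure.integrable_const emeasure_eq_measure\<close>)
  also have "\<dots> = e + (B + C) * measure \<mu> {u. norm u > K}"
    using S by (subst Bochner_Integration.integral_add) (auto simp: prob_space[unfolded sp] sp emeasure_eq_measure)
  finally show ?thesis .
qed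

text \<open>Levy's continuity theorem with tightness as a hypothesis; in the application tightness
  comes from second moments. A test function is exchanged for a trigonometric polynomial on a ball
  that carries almost all the mass of every measure involved.\<close>

theorem weak_conv_vec_char:
  fixes \<mu>s :: "nat \<Rightarrow> 'a::euclidean_space measure"
  assumes \<mu>s: "\<And>n. prob_space (\<mu>s n)" "\<And>n. sets (\<mu>s n) = sets borel"
    and \<mu>: "prob_space \<mu>" "sets \<mu> = sets borel"
    and ch: "\<And>t. (\<lambda>n. CLINT u|\<mu>s n. iexp (t \<bullet> u)) \<longlonglongrightarrow> (CLINT u|\<mu>. iexp (t \<bullet> u))"
    and tight: "\<And>e. e > 0 \<Longrightarrow> \<exists>K. \<forall>L\<ge>K. \<forall>n. measure (\<mu>s n) {u. norm u > L} \<le> e"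
  shows "weak_conv_vec \<mu>s \<mu>"
  unfolding weak_conv_vec_def
proof (intro allI impI, elim conjE)
  fix f :: "'a \<Rightarrow> real"
  assume cont: "continuous_on UNIV f" and "bounded (range f)"
  then obtain B where B: "\<And>u. \<bar>f u\<bar> \<le> B" by (auto simp: bounded_iff)
  have fm: "f \<in> borel_measurable borel" using cont by (rule borel_measurable_continuous_onI)
  have B0: "B \<ge> 0" using B[of 0] by linarith
  show "(\<lambda>n. integral\<^sup>L (\<mu>s n) f) \<longlonglongrightarrow> integral\<^sup>L \<mu> f"
  proof (rule metric_LIMSEQ_I)
    fix r :: real assume "r > 0"
    \<comment> \<open>The distance is split as 2e + e + 2e: two exchanges of \<open>f\<close> for
      \<open>h\<close>, and the convergence for \<open>h\<close>. The bound \<open>e \<le> 1\<close>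
      lets \<open>B + 1\<close> bound \<open>h\<close>, so that \<open>d\<close> compensates the sum
      \<open>2 * B + 1\<close> of both sup bounds on the tail.\<close>
    define e where "e = min 1 (r / 5)"
    define d where "d = e / (2 * B + 1)"
    have e: "e > 0" "e \<le> 1" "5 * e \<le> r" using \<open>r > 0\<close> by (auto simp: e_def)
    have d: "d > 0" "(2 * B + 1) * d = e" using e B0 by (auto simp: d_def)
    obtain K1 where K1: "\<And>L n. L \<ge> K1 \<Longrightarrow> measure (\<mu>s n) {u. norm u > L} \<le> d" using tight[OF d(1)] by blast
    obtain K2 where K2: "\<And>L. L \<ge> K2 \<Longrightarrow> measure \<mu> {u. norm u > L} < d" using measure_norm_tail[OF \<mu> d(1)] by blast
    define K where "K = max 1 (max K1 K2)"
    obtain h where h: "trig_fun h" "\<And>u. norm u \<le> K \<Longrightarrow> \<bar>f u - h u\<bar> < e" "\<And>u. \<bar>h u\<bar> \<le> B + e"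
      using trig_approximation[OF cont B e(1), of K] unfolding K_def by (metis less_max_iff_disj zero_less_one)
    have hB: "\<bar>h u\<bar> \<le> B + 1" for u using h(3)[of u] e by linarith
    have close: "\<bar>integral\<^sup>L \<nu> f - integral\<^sup>L \<nu> h\<bar> \<le> 2 * e"
      if "prob_space \<nu>" "sets \<nu> = sets borel" "measure \<nu> {u. norm u > K} \<le> d" for \<nu>
    proof -
      have "\<bar>integral\<^sup>L \<nu> f - integral\<^sup>L \<nu> h\<bar> \<le> e + (B + (B + 1)) * measure \<nu> {u. norm u > K}"
        using h(2) e by (intro integral_diff_le_tail that fm trig_fun_measurable[OF h(1)] B hB) (auto intro: less_imp_le)
      also have "\<dots> \<le> e + (2 * B + 1) * d" using that(3) B0 by (auto intro!: mult_mono)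
      finally show ?thesis using d by simp
    qed
    have "(\<lambda>n. integral\<^sup>L (\<mu>s n) h) \<longlonglongrightarrow> integral\<^sup>L \<mu> h"
      by (rule trig_fun_integral_tendsto[OF \<mu>s \<mu> ch h(1)])
    then obtain N where N: "\<And>n. n \<ge> N \<Longrightarrow> \<bar>integral\<^sup>L (\<mu>s n) h - integral\<^sup>L \<mu> h\<bar> < e"
      using metric_LIMSEQ_D[OF _ e(1)] by (metis dist_real_def)
    have "dist (integral\<^sup>L (\<mu>s n) f) (integral\<^sup>L \<mu> f) < r" if "n \<ge> N" for n
    proof -
      have "\<bar>integral\<^sup>L (\<mu>s n) f - integral\<^sup>L (\<mu>s n) h\<bar> \<le> 2 * e"
        by (rule close[OF \<mu>s]) (rule K1, simp add: K_def)
      moreover have "\<bar>integral\<^sup>L \<mu> f - integral\<^sup>L \<mu> h\<bar> \<le> 2 * e"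
        by (rule close[OF \<mu>], rule less_imp_le) (rule K2, simp add: K_def)
      ultimately show ?thesis using N[OF that] e unfolding dist_real_def by linarith
    qed
    then show "\<exists>N. \<forall>n\<ge>N. dist (integral\<^sup>L (\<mu>s n) f) (integral\<^sup>L \<mu> f) < r" by blast
  qed
qed

text \<open>The law of a vector with independent coordinates, the one along \<open>b\<close> being
  \<open>\<sigma> b\<close> times a standard normal variable; its characteristic function
  factors.\<close>

lemma exists_normal_diagonal:
  fixes S :: "'a::euclidean_space \<Rightarrow> 'a"
  assumes S: "\<And>t. t \<bullet> S t = (\<Sum>b\<in>Basis. (\<sigma> b * (t \<bullet> b))\<^sup>2)"
  shows "\<exists>\<mu>. is_normal_vec 0 S \<mu>"
proof -
  interpret N: prob_space std_normal_distribution
    using real_dist_normal_dist by (simp add: real_distribution_def)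
  interpret P: product_prob_space "\<lambda>_. std_normal_distribution" "Basis :: 'a set" ..
  define \<Phi> where "\<Phi> \<omega> = (\<Sum>b\<in>Basis. (\<sigma> b * \<omega> b) *\<^sub>R b)" for \<omega> :: "'a \<Rightarrow> real"
  define P where "P = PiM (Basis :: 'a set) (\<lambda>_. std_normal_distribution)"
  have [measurable]: "(\<lambda>\<omega>. \<omega> b) \<in> borel_measurable P" if "b \<in> Basis" for b
    using that measurable_component_singleton[of b Basis "\<lambda>_. std_normal_distribution"]
    by (simp add: P_def)
  have [measurable]: "\<Phi> \<in> borel_measurable P" unfolding \<Phi>_def by measurable
  have "(CLINT u|distr P borel \<Phi>. iexp (t \<bullet> u)) = exp (- complex_of_real (t \<bullet> S t) / 2)" for t
  proof -
    have "(CLINT u|distr P borel \<Phi>. iexp (t \<bullet> u)) = (CLINT \<omega>|P. iexp (t \<bullet> \<Phi> \<omega>))"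
      by (rule integral_distr) auto
    also have "\<dots> = (CLINT \<omega>|P. (\<Prod>b\<in>Basis. iexp (\<sigma> b * (t \<bullet> b) * \<omega> b)))"
      by (simp add: \<Phi>_def inner_sum_right sum_distrib_left mult_ac flip: exp_sum)
    also have "\<dots> = (\<Prod>b\<in>Basis. CLINT y|std_normal_distribution. iexp (\<sigma> b * (t \<bullet> b) * y))"
      unfolding P_def
      by (rule P.product_integral_prod) (auto intro!: N.integrable_const_bound[of _ 1])
    also have "\<dots> = (\<Prod>b\<in>Basis. char std_normal_distribution (\<sigma> b * (t \<bullet> b)))"
      by (simp add: char_def)
    also have "\<dots> = exp (- complex_of_real (t \<bullet> S t) / 2)"
      by (simp add: char_std_normal_distribution S sum_divide_distrib flip: exp_sum of_real_exp sum_negf)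
        (simp add: of_real_exp flip: exp_of_real exp_sum of_real_prod)
    finally show ?thesis .
  qed
  moreover have "prob_space (distr P borel \<Phi>)"
    unfolding P_def by (rule P.prob_space_distr) (simp flip: P_def)
  ultimately show ?thesis
    by (intro exI[of _ "distr P borel \<Phi>"]) (simp add: is_normal_vec_def)
qed

section \<open>Logistic calculus\<close>

lemma one_plus_exp_pos: "1 + exp (t::real) > 0" "1 + exp (t::real) \<noteq> 0"
  using exp_gt_zero[of t] by linarith+

lemma expit_range: "0 < expit t" "expit t < 1"
  using one_plus_exp_pos[of t] by (auto simp: expit_def divide_simps)

lemma one_minus_expit: "1 - expit t = 1 / (1 + exp t)"
  using one_plus_exp_pos(2)[of t] by (simp add: expit_def divide_simps)

lemma DERIV_expit: "(expit has_real_derivative expit t * (1 - expit t)) (at t)"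
  unfolding expit_def[abs_def] using one_plus_exp_pos(2)[of t]
  by (auto intro!: derivative_eq_intros simp: divide_simps) (simp add: algebra_simps power2_eq_square)

lemma DERIV_expit' [derivative_intros]:
  "(f has_real_derivative f') (at t within A) \<Longrightarrow>
    ((\<lambda>t. expit (f t)) has_real_derivative (expit (f t) * (1 - expit (f t)) * f')) (at t within A)"
  using DERIV_chain2[OF DERIV_expit] by blast

lemma expit_logit: "s \<in> {0<..<1} \<Longrightarrow> expit (logit s) = s"
  by (simp add: expit_def logit_def exp_ln divide_simps)

definition softplus :: "real \<Rightarrow> real" where "softplus t = ln (1 + exp t)"

text \<open>Each summand of the log likelihood is linear minus convex in the linear predictor.
  Concavity and the Taylor expansion of the objective both rest on this form.\<close>

lemma loglik_term: "y * ln (expit t) + (1 - y) * ln (1 - expit t) = y * t - softplus t"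
proof -
  have "ln (expit t) = t - softplus t" "ln (1 - expit t) = - softplus t"
    using one_plus_exp_pos(1)[of t]
    by (simp_all add: one_minus_expit) (simp_all add: expit_def softplus_def ln_div)
  then show ?thesis by (simp only:) (simp add: algebra_simps)
qed

lemma DERIV_softplus: "(softplus has_real_derivative expit t) (at t)"
  unfolding softplus_def[abs_def] expit_def using one_plus_exp_pos[of t]
  by (auto intro!: derivative_eq_intros simp: divide_simps)

lemma expit_lipschitz_deriv:
  "\<bar>expit s * (1 - expit s) - expit t * (1 - expit t)\<bar> \<le> \<bar>s - t\<bar>"
proof -
  have "norm (expit s * (1 - expit s) - expit t * (1 - expit t)) \<le> 1 * norm (s - t)"
  proof (rule field_differentiable_bound[of UNIV])
    fix z :: real
    show "((\<lambda>s. expit s * (1 - expit s)) has_real_derivative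
       expit z * (1 - expit z) * (1 - 2 * expit z)) (at z within UNIV)"
      by (auto intro!: derivative_eq_intros simp: algebra_simps)
    have e: "0 < expit z" "expit z < 1" by (rule expit_range)+
    have "\<bar>expit z * (1 - expit z)\<bar> \<le> 1 * 1"
      unfolding abs_mult using e by (intro mult_mono) auto
    moreover have "\<bar>1 - 2 * expit z\<bar> \<le> 1" using e by linarith
    ultimately show "norm (expit z * (1 - expit z) * (1 - 2 * expit z)) \<le> 1"
      unfolding real_norm_def abs_mult[of "expit z * (1 - expit z)"]
      by (intro mult_le_one) auto
  qed auto
  then show ?thesis by simp
qed

text \<open>The mean value inequality is applied twice: the second derivative is Lipschitz with
  constant 1, so \<open>R'\<close> is at most \<open>d\<^sup>2\<close> and then \<open>R\<close> at
  most the cube. The constant 1 is crude but sufficient.\<close>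

lemma softplus_taylor:
  "\<bar>softplus (t + d) - softplus t - expit t * d - expit t * (1 - expit t) * d\<^sup>2 / 2\<bar> \<le> \<bar>d\<bar> ^ 3"
proof -
  define R where "R v = softplus (t + v) - softplus t - expit t * v - expit t * (1 - expit t) * v\<^sup>2 / 2" for v
  define R' where "R' v = expit (t + v) - expit t - expit t * (1 - expit t) * v" for v
  have dR: "(R has_real_derivative R' v) (at v)" for v
    unfolding R_def R'_def
    by (auto intro!: derivative_eq_intros DERIV_chain2[OF DERIV_softplus])
  have dR': "(R' has_real_derivative expit (t + v) * (1 - expit (t + v)) - expit t * (1 - expit t)) (at v)" for v
    unfolding R'_def by (auto intro!: derivative_eq_intros)
  have R'_le: "\<bar>R' v\<bar> \<le> \<bar>d\<bar> * \<bar>d\<bar>" if "\<bar>v\<bar> \<le> \<bar>d\<bar>" for v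
  proof -
    have "norm (R' v - R' 0) \<le> \<bar>d\<bar> * norm (v - 0)"
    proof (rule field_differentiable_bound[of "cball 0 \<bar>d\<bar>"])
      fix z assume "z \<in> cball (0::real) \<bar>d\<bar>"
      then show "norm (expit (t + z) * (1 - expit (t + z)) - expit t * (1 - expit t)) \<le> \<bar>d\<bar>"
        using expit_lipschitz_deriv[of "t + z" t] by simp
    qed (use that in \<open>auto intro: has_field_derivative_at_within[OF dR']\<close>)
    then show ?thesis using mult_left_mono[OF that, of "\<bar>d\<bar>"] by (simp add: R'_def)
  qed
  have "norm (R d - R 0) \<le> (\<bar>d\<bar> * \<bar>d\<bar>) * norm (d - 0)"
    by (rule field_differentiable_bound[of "cball 0 \<bar>d\<bar>"])
      (use R'_le in \<open>auto intro: has_field_derivative_at_within[OF dR]\<close>)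
  then show ?thesis by (simp add: R_def power3_eq_cube)
qed

lemma convex_softplus: "convex_on UNIV softplus"
proof (rule f''_ge0_imp_convex[of _ _ expit "\<lambda>t. expit t * (1 - expit t)"])
  show "expit t * (1 - expit t) \<ge> 0" for t using expit_range[of t] by simp
qed (auto intro: DERIV_softplus DERIV_expit)

section \<open>Second order expansion of the regression function and of the logistic model\<close>

lemma has_derivative_gradient:
  fixes f :: "real ^ 'p \<Rightarrow> real"
  assumes "f differentiable (at z)"
  shows "(f has_derivative (\<lambda>h. gradient f z \<bullet> h)) (at z)"
proof -
  let ?D = "frechet_derivative f (at z)"
  have D: "(f has_derivative ?D) (at z)" using assms frechet_derivative_works by blast
  then interpret bounded_linear ?D by (rule has_derivative_bounded_linear)
  have "?D h = gradient f z \<bullet> h" for h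
  proof -
    have "?D h = ?D (\<Sum>j\<in>UNIV. (h $ j) *\<^sub>R axis j 1)" by (simp add: basis_expansion scalar_mult_eq_scaleR[symmetric])
    also have "\<dots> = gradient f z \<bullet> h" by (simp add: sum scaleR gradient_def inner_vec_def mult.commute)
    finally show ?thesis .
  qed
  then have "?D = (\<lambda>h. gradient f z \<bullet> h)" by (rule ext)
  then show ?thesis using D by simp
qed

text \<open>Taylor's formula with Peano remainder. The error of the first order expansion of the
  gradient at \<open>x\<close>, paired with \<open>h\<close>, is the derivative
  \<open>\<phi>'\<close> of the remainder along the segment; the mean value inequality integrates
  it.\<close>

lemma C2_at_taylor:
  fixes f :: "real ^ 'p \<Rightarrow> real"
  assumes "C2_at f x" "e > 0"
  obtains d where "d > 0" "\<And>h. norm h \<le> d \<Longrightarrow>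
    \<bar>f (x + h) - f x - gradient f x \<bullet> h - h \<bullet> (hessian f x *v h) / 2\<bar> \<le> e * (norm h)\<^sup>2"
proof -
  obtain d0 where d0: "d0 > 0" "\<And>z. dist z x < d0 \<Longrightarrow> f differentiable (at z) \<and> gradient f differentiable (at z)"
    using assms(1) by (auto simp: C2_at_def eventually_nhds_metric)
  have gd: "gradient f differentiable (at x)" using d0(2)[of x] d0(1) by simp
  have G: "(gradient f has_derivative (\<lambda>h. hessian f x *v h)) (at x)"
  proof -
    let ?D = "frechet_derivative (gradient f) (at x)"
    have D: "(gradient f has_derivative ?D) (at x)" using gd frechet_derivative_works by blast
    then have "linear ?D" by (intro bounded_linear.linear has_derivative_bounded_linear)
    then have "?D = (\<lambda>h. hessian f x *v h)" by (auto simp: hessian_def matrix_works)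
    then show ?thesis using D by simp
  qed
  then obtain d1 where d1: "d1 > 0" "\<And>z. norm (z - x) < d1 \<Longrightarrow>
      norm (gradient f z - gradient f x - hessian f x *v (z - x)) \<le> e * norm (z - x)"
    using has_derivative_at_alt[of "gradient f" _ x] \<open>e > 0\<close> by metis
  define d where "d = min d0 d1 / 2"
  show ?thesis
  proof (rule that)
    show "d > 0" using d0(1) d1(1) by (simp add: d_def)
    fix h :: "real ^ 'p" assume h: "norm h \<le> d"
    have hd: "norm h < d0" "norm h < d1" using h d0(1) d1(1) by (auto simp: d_def)
    define \<phi> where "\<phi> t = f (x + t *\<^sub>R h) - t * (gradient f x \<bullet> h) - t\<^sup>2 / 2 * (h \<bullet> (hessian f x *v h))" for t :: real
    define \<phi>' where "\<phi>' t = (gradient f (x + t *\<^sub>R h) - gradient f x - hessian f x *v (t *\<^sub>R h)) \<bullet> h" for t :: real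
    have small: "norm (t *\<^sub>R h) \<le> norm h" if "t \<in> {0..1}" for t
      using that mult_right_mono[of t 1 "norm h"] by simp
    have d\<phi>: "(\<phi> has_real_derivative \<phi>' t) (at t within {0..1})" if t: "t \<in> {0..1}" for t
    proof -
      have "f differentiable (at (x + t *\<^sub>R h))"
        using d0(2)[of "x + t *\<^sub>R h"] small[OF t] hd by (simp add: dist_norm)
      moreover have aff: "((\<lambda>t. x + t *\<^sub>R h) has_derivative (\<lambda>s. s *\<^sub>R h)) (at t within {0..1})"
        by (auto intro!: derivative_eq_intros)
      ultimately have diff: "f differentiable (at (x + t *\<^sub>R h))" by simp
      from has_derivative_compose[of "\<lambda>t. x + t *\<^sub>R h" "\<lambda>s. s *\<^sub>R h" t "{0..1}", OF _ has_derivative_gradient[OF diff]]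
      have "((\<lambda>t. f (x + t *\<^sub>R h)) has_derivative (\<lambda>s. gradient f (x + t *\<^sub>R h) \<bullet> (s *\<^sub>R h))) (at t within {0..1})"
        using aff by blast
      then have "((\<lambda>t. f (x + t *\<^sub>R h)) has_real_derivative (gradient f (x + t *\<^sub>R h) \<bullet> h)) (at t within {0..1})"
        by (simp add: has_field_derivative_def mult_commute_abs)
      then show ?thesis unfolding \<phi>_def
        by (auto intro!: derivative_eq_intros
          simp: \<phi>'_def inner_diff_left matrix_vector_mult_scaleR inner_commute algebra_simps)
    qed
    have "norm (\<phi> 1 - \<phi> 0) \<le> e * (norm h)\<^sup>2 * norm (1 - 0 :: real)"
    proof (rule field_differentiable_bound[of "{0..1}" \<phi> \<phi>'])
      fix t :: real assume t: "t \<in> {0..1}"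
      have "norm (\<phi>' t) \<le> norm (gradient f (x + t *\<^sub>R h) - gradient f x - hessian f x *v (t *\<^sub>R h)) * norm h"
        unfolding \<phi>'_def real_norm_def by (rule Cauchy_Schwarz_ineq2)
      also have "\<dots> \<le> (e * norm h) * norm h"
      proof (rule mult_right_mono)
        have "norm (gradient f (x + t *\<^sub>R h) - gradient f x - hessian f x *v (t *\<^sub>R h)) \<le> e * norm (t *\<^sub>R h)"
          using d1(2)[of "x + t *\<^sub>R h"] small[OF t] hd by simp
        also have "\<dots> \<le> e * norm h" using small[OF t] \<open>e > 0\<close> by (intro mult_left_mono) auto
        finally show "norm (gradient f (x + t *\<^sub>R h) - gradient f x - hessian f x *v (t *\<^sub>R h)) \<le> e * norm h" .
      qed simp
      finally show "norm (\<phi>' t) \<le> e * (norm h)\<^sup>2" by (simp add: power2_eq_square mult.assoc)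
    qed (auto intro: d\<phi>)
    then show "\<bar>f (x + h) - f x - gradient f x \<bullet> h - h \<bullet> (hessian f x *v h) / 2\<bar> \<le> e * (norm h)\<^sup>2"
      by (simp add: \<phi>_def)
  qed
qed

text \<open>Same double mean value argument as for \<open>softplus\<close>. The 3 bounds the
  derivative of the second derivative: its factor \<open>w\<close> is at most 1, and
  \<open>(1 - 2 * expit z)\<^sup>2 - 2 * w z\<close> is at most 1 + 2 in absolute value.\<close>

lemma expit_taylor:
  defines "w \<equiv> \<lambda>t. expit t * (1 - expit t)"
  shows "\<bar>expit (t + d) - expit t - w t * d - w t * (1 - 2 * expit t) * d\<^sup>2 / 2\<bar> \<le> 3 * \<bar>d\<bar> ^ 3"
proof -
  define w1 where "w1 t = w t * (1 - 2 * expit t)" for t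
  define R where "R v = expit (t + v) - expit t - w t * v - w1 t * v\<^sup>2 / 2" for v
  define R' where "R' v = w (t + v) - w t - w1 t * v" for v
  have e: "0 < expit z" "expit z < 1" for z by (rule expit_range)+
  have w_le: "\<bar>w z\<bar> \<le> 1" for z
    unfolding w_def abs_mult using e[of z] by (intro mult_le_one) auto
  have w1_lip: "\<bar>w1 a - w1 b\<bar> \<le> 3 * \<bar>a - b\<bar>" for a b
  proof -
    have "norm (w1 a - w1 b) \<le> 3 * norm (a - b)"
    proof (rule field_differentiable_bound[of UNIV])
      fix z :: real
      show "(w1 has_real_derivative w z * ((1 - 2 * expit z)\<^sup>2 - 2 * w z)) (at z within UNIV)"
        unfolding w1_def w_def
        by (auto intro!: derivative_eq_intros simp: algebra_simps power2_eq_square)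
      have "\<bar>1 - 2 * expit z\<bar> \<le> 1" using e[of z] by linarith
      then have "(1 - 2 * expit z)\<^sup>2 \<le> 1" by (simp add: abs_square_le_1)
      then have "\<bar>(1 - 2 * expit z)\<^sup>2 - 2 * w z\<bar> \<le> 3"
        using w_le[of z] zero_le_power2[of "1 - 2 * expit z"] by linarith
      then show "norm (w z * ((1 - 2 * expit z)\<^sup>2 - 2 * w z)) \<le> 3"
        using mult_mono[OF w_le[of z], of "\<bar>(1 - 2 * expit z)\<^sup>2 - 2 * w z\<bar>" 3] by (simp add: abs_mult)
    qed auto
    then show ?thesis by simp
  qed
  have dR: "(R has_real_derivative R' v) (at v)" for v
    unfolding R_def R'_def w_def by (auto intro!: derivative_eq_intros)
  have dR': "(R' has_real_derivative w1 (t + v) - w1 t) (at v)" for v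
    unfolding R'_def w1_def w_def by (auto intro!: derivative_eq_intros simp: algebra_simps)
  have R'_le: "\<bar>R' v\<bar> \<le> 3 * \<bar>d\<bar> * \<bar>d\<bar>" if "\<bar>v\<bar> \<le> \<bar>d\<bar>" for v
  proof -
    have "norm (R' v - R' 0) \<le> 3 * \<bar>d\<bar> * norm (v - 0)"
    proof (rule field_differentiable_bound[of "cball 0 \<bar>d\<bar>"])
      fix z assume "z \<in> cball (0::real) \<bar>d\<bar>"
      then show "norm (w1 (t + z) - w1 t) \<le> 3 * \<bar>d\<bar>"
        using w1_lip[of "t + z" t] by simp
    qed (use that in \<open>auto intro: has_field_derivative_at_within[OF dR']\<close>)
    then show ?thesis using mult_left_mono[OF that, of "3 * \<bar>d\<bar>"] by (simp add: R'_def)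
  qed
  have "norm (R d - R 0) \<le> (3 * \<bar>d\<bar> * \<bar>d\<bar>) * norm (d - 0)"
    by (rule field_differentiable_bound[of "cball 0 \<bar>d\<bar>"])
      (use R'_le in \<open>auto intro: has_field_derivative_at_within[OF dR]\<close>)
  then show ?thesis by (simp add: R_def w1_def power3_eq_cube mult.assoc)
qed

lemma gradient_eqI:
  fixes f :: "real ^ 'p \<Rightarrow> real"
  assumes "(f has_derivative (\<lambda>h. g \<bullet> h)) (at z)"
  shows "gradient f z = g"
  unfolding gradient_def frechet_derivative_at[OF assms, symmetric]
  by (simp add: vec_eq_iff inner_axis)

lemma gradient_logit:
  fixes f :: "real ^ 'p \<Rightarrow> real"
  assumes "f differentiable (at x)" "f x \<in> {0<..<1}"
  shows "gradient (logit \<circ> f) x = (1 / (f x * (1 - f x))) *\<^sub>R gradient f x"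
proof (rule gradient_eqI)
  have "(logit has_real_derivative 1 / (f x * (1 - f x))) (at (f x))"
    unfolding logit_def[abs_def] using assms(2)
    by (auto intro!: derivative_eq_intros simp: divide_simps)
  then have "(logit has_derivative (\<lambda>s. 1 / (f x * (1 - f x)) * s)) (at (f x))"
    by (simp only: has_field_derivative_def)
  from has_derivative_compose[OF has_derivative_gradient[OF assms(1)] this]
  show "(logit \<circ> f has_derivative (\<lambda>h. ((1 / (f x * (1 - f x))) *\<^sub>R gradient f x) \<bullet> h)) (at x)"
    by (simp add: o_def)
qed

text \<open>The second order part of \<open>f (x + h)\<close> minus the local logistic model at the true parameters.\<close>

definition misfit :: "(real ^ 'p \<Rightarrow> real) \<Rightarrow> real ^ 'p \<Rightarrow> real ^ 'p \<Rightarrow> real" where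
  "misfit f x h = (h \<bullet> (hessian f x *v h) -
     (1 - 2 * f x) / (f x * (1 - f x)) * (gradient f x \<bullet> h)\<^sup>2) / 2"

text \<open>By the chain rule for \<open>logit\<close>, \<open>f\<close> and the local logistic
  model have the same value and gradient at \<open>x\<close>, so only the difference of their
  quadratic terms remains. Each of the two Taylor remainders uses half of \<open>e\<close>.\<close>

lemma local_misfit:
  fixes f :: "real ^ 'p \<Rightarrow> real"
  assumes "C2_at f x" and fx: "f x \<in> {0<..<1}" and "e > 0"
  obtains d where "d > 0" "\<And>h. norm h \<le> d \<Longrightarrow>
    \<bar>f (x + h) - expit (logit (f x) + gradient (logit \<circ> f) x \<bullet> h) - misfit f x h\<bar> \<le> e * (norm h)\<^sup>2"
proof -
  define g where "g = gradient (logit \<circ> f) x"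
  define w where "w = f x * (1 - f x)"
  have w: "w > 0" using fx by (simp add: w_def)
  have "f differentiable (at x)"
    using eventually_nhds_x_imp_x assms(1) unfolding C2_at_def by blast
  then have g: "g = (1 / w) *\<^sub>R gradient f x"
    unfolding g_def w_def using fx by (rule gradient_logit)
  obtain d0 where d0: "d0 > 0" "\<And>h. norm h \<le> d0 \<Longrightarrow>
    \<bar>f (x + h) - f x - gradient f x \<bullet> h - h \<bullet> (hessian f x *v h) / 2\<bar> \<le> e / 2 * (norm h)\<^sup>2"
    using C2_at_taylor[OF assms(1), of "e / 2"] \<open>e > 0\<close> by (metis half_gt_zero)
  define G where "G = norm g ^ 3 + 1"
  have G: "G \<ge> 1" by (simp add: G_def)
  show ?thesis
  proof (rule that)
    \<comment> \<open>The second radius makes the cubic remainder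
      \<open>3 * norm g ^ 3 * norm h ^ 3\<close> at most \<open>e / 2 * (norm h)\<^sup>2\<close>.
      Adding 1 in \<open>G\<close> avoids a division by zero when the gradient vanishes.\<close>
    show "min d0 (e / (6 * G)) > 0" using d0 G \<open>e > 0\<close> by simp
    fix h :: "real ^ 'p" assume h: "norm h \<le> min d0 (e / (6 * G))"
    let ?s = "g \<bullet> h"
    have comb: "\<bar>P - E - (A - B)\<bar> \<le> c" if "\<bar>E - F - D - B\<bar> \<le> c / 2" "\<bar>P - F - D - A\<bar> \<le> c / 2"
      for P E A B F D c :: real using that by linarith
    have "\<bar>expit (logit (f x) + ?s) - f x - w * ?s - w * (1 - 2 * f x) * ?s\<^sup>2 / 2\<bar> \<le> 3 * \<bar>?s\<bar> ^ 3"
      using expit_taylor[of "logit (f x)" ?s] by (simp add: expit_logit[OF fx] w_def)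
    also have "w * ?s = gradient f x \<bullet> h" using w by (simp add: g)
    also have "w * (1 - 2 * f x) * ?s\<^sup>2 = (1 - 2 * f x) / w * (gradient f x \<bullet> h)\<^sup>2"
      using w by (simp add: g power2_eq_square field_simps)
    also have "3 * \<bar>?s\<bar> ^ 3 \<le> 3 * (norm g * norm h) ^ 3"
      using power_mono[OF Cauchy_Schwarz_ineq2[of g h], of 3] by simp
    also have "\<dots> = 3 * norm g ^ 3 * norm h * (norm h)\<^sup>2"
      by (simp add: power_mult_distrib power3_eq_cube power2_eq_square)
    also have "\<dots> \<le> e / 2 * (norm h)\<^sup>2"
    proof (rule mult_right_mono)
      have "3 * norm g ^ 3 * norm h \<le> 3 * G * norm h" by (intro mult_right_mono) (auto simp: G_def)
      also have "\<dots> \<le> 3 * G * (e / (6 * G))" using h G by (intro mult_left_mono) auto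
      also have "\<dots> = e / 2" using G by simp
      finally show "3 * norm g ^ 3 * norm h \<le> e / 2" .
    qed simp
    finally have "\<bar>expit (logit (f x) + ?s) - f x - gradient f x \<bullet> h - (1 - 2 * f x) / w * (gradient f x \<bullet> h)\<^sup>2 / 2\<bar>
      \<le> e / 2 * (norm h)\<^sup>2" .
    moreover have "\<bar>f (x + h) - f x - gradient f x \<bullet> h - h \<bullet> (hessian f x *v h) / 2\<bar> \<le> e / 2 * (norm h)\<^sup>2"
      using h by (intro d0) simp
    ultimately show "\<bar>f (x + h) - expit (logit (f x) + gradient (logit \<circ> f) x \<bullet> h) - misfit f x h\<bar> \<le> e * (norm h)\<^sup>2"
      unfolding misfit_def g_def[symmetric] w_def[symmetric] diff_divide_distrib[of "h \<bullet> (hessian f x *v h)"]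
      by (simp only: times_divide_eq_left) (rule comb)
  qed
qed

section \<open>The limiting optimization problem\<close>

text \<open>The maximizer of \<open>s * t - g * t\<^sup>2 / 2 - q * \<bar>t\<bar>\<close> over
  \<open>t\<close>. Written with \<open>max\<close> instead of a case distinction, it is visibly
  continuous in \<open>s\<close>.\<close>

definition soft_threshold :: "real \<Rightarrow> real \<Rightarrow> real \<Rightarrow> real" where
  "soft_threshold g q s = (max (s - q) 0 - max (- s - q) 0) / g"

text \<open>Expanding the quadratic around \<open>m\<close> leaves exactly the subgradient
  inequality of \<open>q * \<bar>t\<bar>\<close> at \<open>m\<close> with subgradient
  \<open>s - g * m\<close>. Thresholding makes this number \<open>q\<close>, \<open>- q\<close>, or,
  when \<open>m = 0\<close>, any value in between.\<close>

lemma soft_threshold_gap: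
  fixes s t :: real
  assumes "g > 0" "q \<ge> 0"
  defines "m \<equiv> soft_threshold g q s"
  shows "s * t - g * t\<^sup>2 / 2 - q * \<bar>t\<bar> \<le> s * m - g * m\<^sup>2 / 2 - q * \<bar>m\<bar> - g * (t - m)\<^sup>2 / 2"
proof -
  have *: "s * m - g * m\<^sup>2 / 2 - q * \<bar>m\<bar> - g * (t - m)\<^sup>2 / 2 - (s * t - g * t\<^sup>2 / 2 - q * \<bar>t\<bar>) =
     (s - g * m) * (m - t) + q * (\<bar>t\<bar> - \<bar>m\<bar>)"
    by (simp add: field_simps power2_eq_square)
  consider "s > q" | "s < - q" | "\<bar>s\<bar> \<le> q" by linarith
  then have "(s - g * m) * (m - t) + q * (\<bar>t\<bar> - \<bar>m\<bar>) \<ge> 0"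
  proof cases
    case 1
    then have "s - g * m = q" "m > 0" using assms by (auto simp: m_def soft_threshold_def)
    then show ?thesis using \<open>q \<ge> 0\<close> mult_left_mono[of t "\<bar>t\<bar>" q] by (simp add: right_diff_distrib)
  next
    case 2
    then have "s - g * m = - q" "m < 0" using assms by (auto simp: m_def soft_threshold_def field_simps)
    then show ?thesis using mult_left_mono[OF abs_ge_minus_self \<open>q \<ge> 0\<close>, of t]
      by (simp add: right_diff_distrib distrib_left)
  next
    case 3
    then have "m = 0" using assms by (auto simp: m_def soft_threshold_def)
    moreover have "s * t \<le> q * \<bar>t\<bar>"
      using 3 mult_right_mono[of "\<bar>s\<bar>" q "\<bar>t\<bar>"] abs_ge_self[of "s * t"] by (simp add: abs_mult)
    ultimately show ?thesis by simp
  qed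
  then show ?thesis using * by linarith
qed

lemma quadratic_gap:
  fixes g s t :: real
  assumes "g > 0"
  defines "m \<equiv> s / g"
  shows "s * t - g * t\<^sup>2 / 2 = s * m - g * m\<^sup>2 / 2 - g * (t - m)\<^sup>2 / 2"
  using assms by (simp add: field_simps power2_eq_square)

text \<open>The limit objective separates: a pure quadratic for the intercept, a lasso problem for
  slopes with vanishing gradient component, and a quadratic with linear term shifted by
  \<open>q\<close> times the sign for the other slopes.\<close>

definition limit_argmax :: "(real ^ 'p \<Rightarrow> real) \<Rightarrow> (real ^ 'p \<Rightarrow> real) \<Rightarrow> real \<Rightarrow> real ^ 'p \<Rightarrow>
    real \<times> (real ^ 'p) \<Rightarrow> real \<times> (real ^ 'p)" where
  "limit_argmax \<pi> f c x v =
    (let w = \<pi> x * (1 - \<pi> x); w' = w / (real CARD('p) + 2);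
         q = (c * f x * vol_ball TYPE('p)) powr (1 / real CARD('p)); g = gradient (logit \<circ> \<pi>) x in
     (fst v / w, \<chi> j. if g $ j = 0 then soft_threshold w' q (snd v $ j)
                      else (snd v $ j - q * sgn_nonneg (g $ j)) / w'))"

text \<open>The gaps of the one-dimensional problems add up. The intercept has curvature
  \<open>w\<close>, the slopes \<open>w / (p + 2)\<close>; the smaller one serves for all
  coordinates. This is the quantitative strong concavity that localizes the estimator.\<close>

lemma limit_argmax_gap:
  fixes x :: "real ^ 'p" and \<pi> f c v
  assumes "\<pi> x \<in> {0<..<1}"
  defines "m \<equiv> limit_argmax \<pi> f c x v" and "w \<equiv> \<pi> x * (1 - \<pi> x)"
  shows "limit_objective \<pi> f c x v u \<le> limit_objective \<pi> f c x v m - w / (2 * (real CARD('p) + 2)) * (norm (u - m))\<^sup>2"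
proof -
  define w' where "w' = w / (real CARD('p) + 2)"
  define q where "q = (c * f x * vol_ball TYPE('p)) powr (1 / real CARD('p))"
  define g where "g = gradient (logit \<circ> \<pi>) x"
  have w: "w > 0" "w' > 0" "w' \<le> w"
  proof -
    show "w > 0" using assms(1) by (simp add: w_def)
    then show "w' > 0" "w' \<le> w" using divide_left_mono[of 1 "real CARD('p) + 2" w] by (simp_all add: w'_def add_pos_pos)
  qed
  have q: "q \<ge> 0" by (simp add: q_def)
  define F where "F j s = snd v $ j * s - w' * s\<^sup>2 / 2 - q * (if g $ j = 0 then \<bar>s\<bar> else sgn_nonneg (g $ j) * s)" for j s
  have obj: "limit_objective \<pi> f c x v u = fst v * fst u - w * (fst u)\<^sup>2 / 2 + (\<Sum>j\<in>UNIV. F j (snd u $ j))" for u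
  proof -
    have 1: "u \<bullet> v = fst v * fst u + (\<Sum>j\<in>UNIV. snd v $ j * snd u $ j)"
      by (simp add: inner_prod_def inner_vec_def mult.commute)
    have 2: "u \<bullet> Gamma_op \<pi> x u = w * (fst u)\<^sup>2 + (\<Sum>j\<in>UNIV. w' * (snd u $ j)\<^sup>2)"
      by (simp add: Gamma_op_def inner_prod_def inner_vec_def w'_def w_def case_prod_beta
          power2_eq_square sum_distrib_left mult_ac sum_divide_distrib)
    have 3: "(\<Sum>j\<in>UNIV. sgn_nonneg (g $ j) * (snd u $ j) * of_bool (g $ j \<noteq> 0) + \<bar>snd u $ j\<bar> * of_bool (g $ j = 0)) =
        (\<Sum>j\<in>UNIV. if g $ j = 0 then \<bar>snd u $ j\<bar> else sgn_nonneg (g $ j) * snd u $ j)"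
      by (intro sum.cong) auto
    show ?thesis
      unfolding limit_objective_def Let_def 1 2 g_def[symmetric] q_def[symmetric] 3 F_def
      by (simp add: sum_subtractf sum.distrib sum_distrib_left sum_divide_distrib algebra_simps add_divide_distrib)
  qed
  have m: "fst m = fst v / w" "\<And>j. snd m $ j = (if g $ j = 0 then soft_threshold w' q (snd v $ j)
                      else (snd v $ j - q * sgn_nonneg (g $ j)) / w')"
    by (simp_all add: m_def limit_argmax_def Let_def w_def w'_def q_def g_def)
  have gap: "F j t \<le> F j (snd m $ j) - w' * (t - snd m $ j)\<^sup>2 / 2" for j t
  proof (cases "g $ j = 0")
    case True
    then show ?thesis using soft_threshold_gap[OF w(2) q, of "snd v $ j" t] by (simp add: F_def m)
  next
    case False
    then show ?thesis using quadratic_gap[OF w(2), of "snd v $ j - q * sgn_nonneg (g $ j)" t]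
      unfolding F_def m if_not_P[OF False] by (simp only: left_diff_distrib mult.assoc diff_diff_eq)
  qed
  have gap0: "fst v * fst u - w * (fst u)\<^sup>2 / 2 \<le> fst v * fst m - w * (fst m)\<^sup>2 / 2 - w' * (fst u - fst m)\<^sup>2 / 2"
    using quadratic_gap[OF w(1), of "fst v" "fst u"] mult_right_mono[OF w(3), of "(fst u - fst m)\<^sup>2"]
    by (simp add: m)
  have nrm: "(norm (u - m))\<^sup>2 = (fst u - fst m)\<^sup>2 + (\<Sum>j\<in>UNIV. (snd u $ j - snd m $ j)\<^sup>2)"
    by (simp only: power2_norm_eq_inner inner_prod_def inner_vec_def) (simp add: power2_eq_square)
  have c: "w / (2 * (real CARD('p) + 2)) = w' / 2" by (simp add: w'_def)
  have "(\<Sum>j\<in>UNIV. F j (snd u $ j)) \<le> (\<Sum>j\<in>UNIV. F j (snd m $ j)) - (\<Sum>j\<in>UNIV. w' * (snd u $ j - snd m $ j)\<^sup>2 / 2)"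
    by (subst sum_subtractf[symmetric]) (intro sum_mono gap)
  then show ?thesis unfolding obj c nrm using gap0
    by (simp add: algebra_simps sum_distrib_left sum_divide_distrib)
qed

lemma is_arg_max_limit_argmax:
  fixes x :: "real ^ 'p"
  assumes "\<pi> x \<in> {0<..<1}"
  shows "is_arg_max (limit_objective \<pi> f c x v) (\<lambda>_. True) (limit_argmax \<pi> f c x v)"
proof -
  have "0 \<le> \<pi> x * (1 - \<pi> x) / (2 * (real CARD('p) + 2)) * (norm (u - limit_argmax \<pi> f c x v))\<^sup>2" for u
    using assms by auto
  then show ?thesis
    using limit_argmax_gap[of \<pi> x f c v, OF assms]
    by (simp add: is_arg_max_linorder) (meson diff_le_eq le_add_same_cancel1 order_trans)
qed

text \<open>Continuity in the score makes the chosen maximizer a random vector.\<close>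

lemma continuous_limit_argmax:
  fixes x :: "real ^ 'p"
  shows "continuous_on UNIV (limit_argmax \<pi> f c x)"
  unfolding limit_argmax_def Let_def soft_threshold_def divide_inverse if_distrib
  apply (intro continuous_intros continuous_on_vec_lambda)
  subgoal for j by (cases "gradient (logit \<circ> \<pi>) x $ j = 0") (simp_all, (intro continuous_intros)+)
  done

text \<open>A point outside the ball with value at least \<open>H m\<close> would, by concavity
  along the segment to \<open>m\<close>, force such a value on the sphere as well. Existence of a
  maximizer is part of the conclusion because the estimator is only required to maximize when a
  maximizer exists; it comes from compactness of the ball.\<close>

lemma concave_on_argmax_near:
  fixes H :: "'a::euclidean_space \<Rightarrow> real"
  assumes conc: "concave_on UNIV H" and "e > 0"
    and sphere: "\<And>u. norm (u - m) = e \<Longrightarrow> H u < H m"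
  shows "(\<exists>u. is_arg_max H (\<lambda>_. True) u) \<and> (\<forall>u. is_arg_max H (\<lambda>_. True) u \<longrightarrow> norm (u - m) < e)"
proof -
  have out: "H u < H m" if u: "norm (u - m) \<ge> e" for u
  proof -
    define s where "s = e / norm (u - m)"
    have s: "0 < s" "s \<le> 1" using u \<open>e > 0\<close> by (auto simp: s_def divide_le_eq intro!: divide_pos_pos)
    define z where "z = (1 - s) *\<^sub>R m + s *\<^sub>R u"
    have "z - m = s *\<^sub>R (u - m)" by (simp add: z_def algebra_simps)
    then have "norm (z - m) = e" using s u \<open>e > 0\<close> by (auto simp: s_def)
    then have "H z < H m" by (rule sphere)
    moreover have "H z \<ge> (1 - s) * H m + s * H u"
      using concave_onD[OF conc, of s m u] s by (simp add: z_def)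
    ultimately have "s * H u < s * H m" by (simp add: algebra_simps)
    then show ?thesis using s by simp
  qed
  have "continuous_on UNIV H"
    using convex_on_continuous[of UNIV "\<lambda>u. - H u"] conc continuous_on_minus[of UNIV "\<lambda>u. - H u"]
    by (simp add: concave_on_def)
  then have "\<exists>u\<in>cball m e. \<forall>y\<in>cball m e. H y \<le> H u"
    using \<open>e > 0\<close> by (intro continuous_attains_sup) (auto intro: continuous_on_subset)
  then obtain u where u: "u \<in> cball m e" "\<And>y. y \<in> cball m e \<Longrightarrow> H y \<le> H u" by blast
  have "H y \<le> H u" for y
  proof (cases "y \<in> cball m e")
    case False
    then have "H y < H m" by (intro out) (auto simp: dist_norm norm_minus_commute)
    also have "H m \<le> H u" using u(2)[of m] \<open>e > 0\<close> by auto
    finally show ?thesis by simp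
  qed (use u in auto)
  then have "is_arg_max H (\<lambda>_. True) u" by (auto simp: is_arg_max_linorder)
  moreover have "norm (u - m) < e" if "is_arg_max H (\<lambda>_. True) u" for u
    using that out[of u] by (force simp: is_arg_max_linorder not_less[symmetric])
  ultimately show ?thesis by blast
qed

section \<open>Moments of the unit ball\<close>

lemma norm_power2_Basis: "(norm u)\<^sup>2 = (\<Sum>b\<in>Basis. (u \<bullet> b)\<^sup>2)" for u :: "'a::euclidean_space"
  by (subst power2_norm_eq_inner, subst euclidean_inner) (simp add: power2_eq_square)

lemma lborel_distr_eq_integral:
  fixes g :: "'a::euclidean_space \<Rightarrow> real"
  assumes "distr lborel borel T = lborel" "T \<in> borel_measurable borel" "g \<in> borel_measurable borel"
  shows "(LINT u|lborel. g (T u)) = integral\<^sup>L lborel g"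
proof -
  have "integral\<^sup>L lborel g = integral\<^sup>L (distr lborel borel T) g" using assms(1) by simp
  also have "\<dots> = (LINT u|lborel. g (T u))" using assms by (intro integral_distr) auto
  finally show ?thesis by simp
qed

text \<open>Sign changes of coordinates preserve Lebesgue measure; together with the exchange of two
  coordinates they give all moments of the ball up to one integral.\<close>

lemma lborel_distr_flip:
  fixes T :: "'a::euclidean_space \<Rightarrow> 'a"
  assumes c: "\<And>j. j \<in> Basis \<Longrightarrow> \<bar>c j\<bar> = 1" and T: "\<And>x. T x = (\<Sum>j\<in>Basis. (c j * (x \<bullet> j)) *\<^sub>R j)"
  shows "distr lborel borel T = lborel"
proof -
  have "c j \<noteq> 0" if "j \<in> Basis" for j using c[OF that] by auto
  from lborel_affine_euclidean[of c 0, OF this]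
  have "lborel = density (distr lborel borel T) (\<lambda>_. ennreal (\<Prod>j\<in>Basis. \<bar>c j\<bar>))"
    by (simp add: T[abs_def, symmetric])
  also have "(\<Prod>j\<in>Basis. \<bar>c j\<bar>) = 1" using c by simp
  finally show ?thesis by (simp add: density_1)
qed

lemma lborel_distr_swap:
  fixes i j :: "'a::euclidean_space"
  assumes ij: "i \<in> Basis" "j \<in> Basis"
  defines "T \<equiv> \<lambda>x. \<Sum>b\<in>Basis. (x \<bullet> Transposition.transpose i j b) *\<^sub>R b"
  shows "distr lborel borel T = lborel"
proof (rule sym, rule lborel_eqI)
  have bij: "bij_betw (Transposition.transpose i j) Basis Basis"
    using ij by (intro bij_betwI[of _ _ _ "Transposition.transpose i j"]) (auto simp: Transposition.transpose_def)
  then have perm: "Transposition.transpose i j b \<in> Basis" if "b \<in> Basis" for b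
    using that by (auto simp: bij_betw_def)
  have comp: "T x \<bullet> b = x \<bullet> Transposition.transpose i j b" if "b \<in> Basis" for x b
    using that by (simp add: T_def inner_sum_left inner_Basis if_distrib cong: if_cong)
  have TT: "T (T x) = x" for x
    by (rule euclidean_eqI) (simp add: comp perm)
  fix l u :: 'a assume le: "\<And>b. b \<in> Basis \<Longrightarrow> l \<bullet> b \<le> u \<bullet> b"
  have [measurable]: "T \<in> borel_measurable borel" unfolding T_def by measurable
  have *: "(\<forall>b\<in>Basis. P (Transposition.transpose i j b)) \<longleftrightarrow> (\<forall>b\<in>Basis. P b)" for P
    using perm by (metis transpose_involutory)
  have "T x \<in> box l u \<longleftrightarrow> x \<in> box (T l) (T u)" for x
    using *[of "\<lambda>b. T l \<bullet> b < x \<bullet> b \<and> x \<bullet> b < T u \<bullet> b"] by (simp add: mem_box comp perm)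
  then have "T -` box l u = box (T l) (T u)" by auto
  then have "emeasure (distr lborel borel T) (box l u) = emeasure lborel (box (T l) (T u))"
    by (simp add: emeasure_distr)
  also have "\<dots> = ennreal (\<Prod>b\<in>Basis. (T u - T l) \<bullet> b)"
    using le perm by (intro emeasure_lborel_box) (simp add: comp)
  also have "(\<Prod>b\<in>Basis. (T u - T l) \<bullet> b) = (\<Prod>b\<in>Basis. (u - l) \<bullet> Transposition.transpose i j b)"
    by (simp add: comp inner_diff_left)
  also have "\<dots> = (\<Prod>b\<in>Basis. (u - l) \<bullet> b)"
    by (rule prod.reindex_bij_betw[OF bij])
  finally show "emeasure (distr lborel borel T) (box l u) = ennreal (\<Prod>b\<in>Basis. (u - l) \<bullet> b)" .
qed simp

lemma integrable_cball_bounded: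
  fixes g :: "'a::euclidean_space \<Rightarrow> real"
  assumes "g \<in> borel_measurable borel" "\<And>u. norm u \<le> r \<Longrightarrow> \<bar>g u\<bar> \<le> C"
  shows "integrable lborel (\<lambda>u. indicator (cball 0 r) u * g u)"
proof (rule Bochner_Integration.integrable_bound)
  show "integrable lborel (\<lambda>u::'a. C * indicator (cball 0 r) u)"
    by (intro integrable_mult_right integrable_real_indicator emeasure_lborel_cball_finite) simp
qed (use assms in \<open>auto simp: indicator_def abs_le_iff intro!: AE_I2\<close>, (use assms in force)+)

text \<open>Layer cake: \<open>1 - (norm u)\<^sup>2\<close> is the integral of \<open>2 * r\<close>
  over r from \<open>norm u\<close> to 1. After Fubini the inner integral is the volume of the ball
  of radius r, which is \<open>V * r ^ d\<close>.\<close>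

lemma integral_cball_norm_power2:
  "(LINT u|lborel. indicator (cball 0 1) u * (1 - (norm (u::'a::euclidean_space))\<^sup>2)) =
    2 * measure lborel (cball (0::'a) 1) / (real DIM('a) + 2)"
proof -
  define V where "V = measure lborel (cball (0::'a) 1)"
  let ?d = "DIM('a)"
  have V0: "V \<ge> 0" by (simp add: V_def)
  have em: "emeasure lborel (cball (0::'a) r) = ennreal (V * r ^ ?d)" if "r \<ge> 0" for r
    using that emeasure_cball[of r "0::'a"] content_cball[of 1 "0::'a"] unfolding V_def by simp
  have inner: "(\<integral>\<^sup>+r. ennreal (2 * r) * indicator {0..1} r * indicator {norm u..} r \<partial>lborel) =
      ennreal (1 - (norm u)\<^sup>2) * indicator (cball 0 1) u" for u :: 'a
  proof (cases "norm u \<le> 1")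
    case True
    have "(\<integral>\<^sup>+r. ennreal (2 * r) * indicator {0..1} r * indicator {norm u..} r \<partial>lborel) =
      (\<integral>\<^sup>+r. ennreal (2 * r) * indicator {norm u..1} r \<partial>lborel)"
      by (intro nn_integral_cong) (auto simp: indicator_def intro: order_trans[OF norm_ge_zero])
    also have "\<dots> = ennreal (1\<^sup>2 - (norm u)\<^sup>2)"
      using True by (intro nn_integral_FTC_Icc) (auto intro!: derivative_eq_intros order_trans[OF norm_ge_zero])
    finally show ?thesis using True by simp
  next
    case False
    then have "ennreal (2 * r) * indicator {0..1} r * indicator {norm u..} r = 0" for r
      by (auto simp: indicator_def)
    then show ?thesis using False by (simp only:) simp
  qed
  have "(\<integral>\<^sup>+(u::'a). ennreal (1 - (norm u)\<^sup>2) * indicator (cball 0 1) u \<partial>lborel) =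
      (\<integral>\<^sup>+(u::'a). (\<integral>\<^sup>+r. ennreal (2 * r) * indicator {0..1} r * indicator {norm u..} r \<partial>lborel) \<partial>lborel)"
    by (simp add: inner)
  also have "\<dots> = (\<integral>\<^sup>+r. (\<integral>\<^sup>+(u::'a). ennreal (2 * r) * indicator {0..1} r * indicator (cball 0 r) u \<partial>lborel) \<partial>lborel)"
  proof -
    define G where "G r u = ennreal (2 * r) * indicator {0..1} r * (if norm u \<le> r then 1 else 0)" for r :: real and u :: 'a
    have 1: "ennreal (2 * r) * indicator {0..1} r * indicator {norm u..} r = G r u"
      and 2: "ennreal (2 * r) * indicator {0..1} r * indicator (cball 0 r) u = G r u" for r and u :: 'a
      by (simp_all add: G_def indicator_def)
    show ?thesis
      unfolding 1 2 by (rule lborel_pair.Fubini') (simp add: G_def)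
  qed
  also have "\<dots> = (\<integral>\<^sup>+r. ennreal (2 * V * r ^ (?d + 1)) * indicator {0..1} r \<partial>lborel)"
  proof (intro nn_integral_cong)
    fix r :: real
    show "(\<integral>\<^sup>+(u::'a). ennreal (2 * r) * indicator {0..1} r * indicator (cball 0 r) u \<partial>lborel) =
       ennreal (2 * V * r ^ (?d + 1)) * indicator {0..1} r"
      using V0 by (subst nn_integral_cmult_indicator) (auto simp: indicator_def em ennreal_mult[symmetric] mult_ac)
  qed
  also have "\<dots> = ennreal (2 * V / (?d + 2) * 1 ^ (?d + 2) - 2 * V / (?d + 2) * 0 ^ (?d + 2))"
    using V0 by (intro nn_integral_FTC_Icc)
      (auto intro!: derivative_eq_intros simp del: power_Suc simp: divide_simps)
  moreover have e: "ennreal (indicator (cball 0 1) u * (1 - (norm u)\<^sup>2)) = ennreal (1 - (norm u)\<^sup>2) * indicator (cball 0 1) u" for u :: 'a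
    by (simp add: indicator_def)
  ultimately have "(\<integral>\<^sup>+u. ennreal (indicator (cball 0 1) u * (1 - (norm (u::'a))\<^sup>2)) \<partial>lborel) = ennreal (2 * V / (?d + 2))"
    by (simp only: e) simp
  then show ?thesis unfolding V_def
    by (subst integral_eq_nn_integral) (auto simp: indicator_def abs_square_le_1)
qed

text \<open>Exchanging coordinates shows that all d second moments agree, and their sum is the
  volume minus the preceding integral, \<open>V - 2 * V / (d + 2) = d * V / (d + 2)\<close>.\<close>

lemma ball_second_moment:
  assumes b: "b \<in> (Basis :: 'a::euclidean_space set)"
  shows "(LINT u|lborel. indicator (cball 0 1) u * (u \<bullet> b)\<^sup>2) = measure lborel (cball (0::'a) 1) / (real DIM('a) + 2)"
proof -
  define V where "V = measure lborel (cball (0::'a) 1)"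
  define J where "J b = (LINT u|lborel. indicator (cball 0 1) u * (u \<bullet> (b::'a))\<^sup>2)" for b
  have le1: "\<bar>u \<bullet> b\<bar> \<le> 1" if "norm u \<le> 1" "b \<in> Basis" for u b :: 'a
    using Basis_le_norm[OF that(2), of u] that(1) by linarith
  have int: "integrable lborel (\<lambda>u::'a. indicator (cball 0 1) u * (u \<bullet> b)\<^sup>2)" if "b \<in> Basis" for b
    using le1[OF _ that] by (intro integrable_cball_bounded[of _ _ 1]) (auto simp: abs_square_le_1)
  have eq: "J b = J i" if i: "i \<in> Basis" for i
  proof -
    let ?T = "\<lambda>x::'a. \<Sum>a\<in>Basis. (x \<bullet> Transposition.transpose i b a) *\<^sub>R a"
    have comp: "?T x \<bullet> a = x \<bullet> Transposition.transpose i b a" if "a \<in> Basis" for x a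
      using that by (simp add: inner_sum_left inner_Basis if_distrib cong: if_cong)
    have bij: "bij_betw (Transposition.transpose i b) Basis Basis"
      using i b by (intro bij_betwI[of _ _ _ "Transposition.transpose i b"]) (auto simp: Transposition.transpose_def)
    have "(norm (?T x))\<^sup>2 = (\<Sum>a\<in>Basis. (x \<bullet> Transposition.transpose i b a)\<^sup>2)" for x
      by (subst power2_norm_eq_inner, subst euclidean_inner) (simp add: comp power2_eq_square)
    also have "(\<Sum>a\<in>Basis. (x \<bullet> Transposition.transpose i b a)\<^sup>2) = (\<Sum>a\<in>Basis. (x \<bullet> a)\<^sup>2)" for x
      by (rule sum.reindex_bij_betw[OF bij])
    also have "(\<Sum>a\<in>Basis. (x \<bullet> a)\<^sup>2) = (norm x)\<^sup>2" for x :: 'a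
      by (subst power2_norm_eq_inner, subst euclidean_inner) (simp add: power2_eq_square)
    finally have nT: "norm (?T x) = norm x" for x by simp
    have "J b = (LINT u|lborel. indicator (cball 0 1) (?T u) * (?T u \<bullet> b)\<^sup>2)"
      unfolding J_def by (rule lborel_distr_eq_integral[symmetric, OF lborel_distr_swap[OF i b]]) (measurable, auto)
    also have "\<dots> = J i" unfolding J_def comp[OF b] by (simp add: indicator_def nT)
    finally show ?thesis .
  qed
  have "(LINT u|lborel. indicator (cball 0 1) u * (1 - (norm (u::'a))\<^sup>2)) =
    (LINT (u::'a)|lborel. indicator (cball 0 1) u * 1 - (\<Sum>b\<in>Basis. indicator (cball 0 1) u * (u \<bullet> b)\<^sup>2))"
    by (simp only: norm_power2_Basis right_diff_distrib sum_distrib_left)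
  also have "\<dots> = V - (\<Sum>b\<in>Basis. J b)"
    unfolding J_def V_def
  proof (subst Bochner_Integration.integral_diff)
    show "integrable lborel (\<lambda>u::'a. (indicator (cball 0 1) u * 1 :: real))"
      by (rule integrable_cball_bounded[of _ _ 1]) auto
    show "(LINT (u::'a)|lborel. indicator (cball 0 1) u * 1) - (LINT (u::'a)|lborel. (\<Sum>b\<in>Basis. indicator (cball 0 1) u * (u \<bullet> b)\<^sup>2)) =
      measure lborel (cball (0::'a) 1) - (\<Sum>b\<in>Basis. (LINT (u::'a)|lborel. indicator (cball 0 1) u * (u \<bullet> b)\<^sup>2))"
      by (subst Bochner_Integration.integral_sum) (simp_all add: int)
  qed (intro Bochner_Integration.integrable_sum int)
  also have "(\<Sum>b\<in>Basis. J b) = real DIM('a) * J b"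
    using sum.cong[OF refl eq[symmetric]] by simp
  finally have "real DIM('a) * J b = V - 2 * V / (real DIM('a) + 2)"
    unfolding integral_cball_norm_power2 V_def by simp
  also have "\<dots> = real DIM('a) * (V / (real DIM('a) + 2))" by (simp add: field_simps)
  finally have "J b = V / (real DIM('a) + 2)"
    using DIM_positive[where 'a='a] by (subst (asm) mult_left_cancel) auto
  then show ?thesis by (simp add: J_def V_def)
qed

lemma ball_odd_moment:
  fixes g :: "'a::euclidean_space \<Rightarrow> real"
  assumes [measurable]: "g \<in> borel_measurable borel" and odd: "\<And>u. g (- u) = - g u"
  shows "(LINT u|lborel. indicator (cball 0 1) u * g u) = 0"
proof -
  have "distr lborel borel (uminus :: 'a \<Rightarrow> 'a) = lborel"
    by (rule lborel_distr_flip[of "\<lambda>_. -1"]) (auto simp: sum_negf euclidean_representation)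
  from lborel_distr_eq_integral[OF this, of "\<lambda>u. indicator (cball 0 1) u * g u"]
  show ?thesis by (simp add: odd indicator_def)
qed

text \<open>Reversing the sign of coordinate \<open>i\<close> alone preserves the ball and reverses
  the sign of the integrand.\<close>

lemma ball_mixed_moment:
  assumes ij: "i \<in> (Basis :: 'a::euclidean_space set)" "j \<in> Basis" "i \<noteq> j"
  shows "(LINT u|lborel. indicator (cball 0 1) u * ((u \<bullet> i) * (u \<bullet> (j::'a)))) = 0"
proof -
  define c where "c = (\<lambda>b. if b = i then -1 else 1 :: real)"
  define T where "T = (\<lambda>x::'a. \<Sum>b\<in>Basis. (c b * (x \<bullet> b)) *\<^sub>R b)"
  have comp: "T x \<bullet> b = c b * (x \<bullet> b)" if "b \<in> Basis" for x b
    using that by (simp add: T_def inner_sum_left inner_Basis if_distrib cong: if_cong)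
  have "(norm (T x))\<^sup>2 = (norm x)\<^sup>2" for x
    unfolding norm_power2_Basis by (intro sum.cong refl) (simp add: comp c_def power_mult_distrib)
  then have nT: "norm (T x) = norm x" for x by simp
  have "distr lborel borel T = lborel"
    by (rule lborel_distr_flip[of c]) (auto simp: T_def c_def)
  moreover have "T \<in> borel_measurable borel" "(\<lambda>u. indicator (cball 0 1) u * ((u \<bullet> i) * (u \<bullet> j))) \<in> borel_measurable borel"
    unfolding T_def by (simp, intro borel_measurable_times borel_measurable_indicator borel_measurable_inner) auto
  ultimately have "(LINT u|lborel. indicator (cball 0 1) (T u) * ((T u \<bullet> i) * (T u \<bullet> j))) =
     (LINT u|lborel. indicator (cball 0 1) u * ((u \<bullet> i) * (u \<bullet> j)))"
    by (rule lborel_distr_eq_integral)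
  moreover have "indicator (cball 0 1) (T u) * ((T u \<bullet> i) * (T u \<bullet> j)) = - (indicator (cball 0 1) u * ((u \<bullet> i) * (u \<bullet> j)))" for u :: 'a
    unfolding comp[OF ij(1)] comp[OF ij(2)] using ij(3) by (simp add: indicator_def nT c_def)
  ultimately show ?thesis by (simp only:) simp
qed

section \<open>Triangular sums over nearest neighbours\<close>

text \<open>\<open>P n\<close> need not be a measurable event, hence the exceptional sets \<open>E\<close>.\<close>

definition whp :: "'w measure \<Rightarrow> (nat \<Rightarrow> 'w \<Rightarrow> bool) \<Rightarrow> bool" where
  "whp M P \<longleftrightarrow> (\<forall>d>0. \<forall>\<^sub>F n in sequentially. \<exists>E\<in>sets M. measure M E \<le> d \<and> {\<omega> \<in> space M. \<not> P n \<omega>} \<subseteq> E)"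

section \<open>Calculus of events of high probability\<close>

lemma whp_mono:
  assumes "whp M P" "\<forall>\<^sub>F n in sequentially. \<forall>\<omega>\<in>space M. P n \<omega> \<longrightarrow> Q n \<omega>"
  shows "whp M Q"
  unfolding whp_def
proof (intro allI impI)
  fix d :: real assume "d > 0"
  then have "\<forall>\<^sub>F n in sequentially. \<exists>E\<in>sets M. measure M E \<le> d \<and> {\<omega> \<in> space M. \<not> P n \<omega>} \<subseteq> E"
    using assms(1) by (simp add: whp_def)
  from this assms(2) show "\<forall>\<^sub>F n in sequentially. \<exists>E\<in>sets M. measure M E \<le> d \<and> {\<omega> \<in> space M. \<not> Q n \<omega>} \<subseteq> E"
    by eventually_elim blast
qed

lemma (in prob_space) whp_conj:
  assumes "whp M P" "whp M Q"
  shows "whp M (\<lambda>n \<omega>. P n \<omega> \<and> Q n \<omega>)"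
  unfolding whp_def
proof (intro allI impI)
  fix d :: real assume "d > 0"
  then have d: "d / 2 > 0" by simp
  have "\<forall>\<^sub>F n in sequentially. \<exists>E\<in>events. prob E \<le> d / 2 \<and> {\<omega> \<in> space M. \<not> P n \<omega>} \<subseteq> E"
    "\<forall>\<^sub>F n in sequentially. \<exists>E\<in>events. prob E \<le> d / 2 \<and> {\<omega> \<in> space M. \<not> Q n \<omega>} \<subseteq> E"
    using assms d unfolding whp_def by blast+
  then show "\<forall>\<^sub>F n in sequentially. \<exists>E\<in>events. prob E \<le> d \<and> {\<omega> \<in> space M. \<not> (P n \<omega> \<and> Q n \<omega>)} \<subseteq> E"
  proof eventually_elim
    case (elim n)
    then obtain E F where E: "E \<in> events" "prob E \<le> d / 2" "{\<omega> \<in> space M. \<not> P n \<omega>} \<subseteq> E"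
      and F: "F \<in> events" "prob F \<le> d / 2" "{\<omega> \<in> space M. \<not> Q n \<omega>} \<subseteq> F" by blast
    have "prob (E \<union> F) \<le> d"
      using measure_Un_le[OF E(1) F(1)] E(2) F(2) by simp
    then show ?case using E F by (intro bexI[of _ "E \<union> F"]) auto
  qed
qed

lemma (in prob_space) whp_ball:
  assumes "finite I" "\<And>i. i \<in> I \<Longrightarrow> whp M (P i)"
  shows "whp M (\<lambda>n \<omega>. \<forall>i\<in>I. P i n \<omega>)"
  using assms
proof (induction I rule: finite_induct)
  case empty
  have "\<exists>E\<in>events. prob E \<le> d \<and> {\<omega> \<in> space M. \<not> (\<forall>i\<in>{}. P i n \<omega>)} \<subseteq> E" if "d > 0" for d :: real and n
    using that by (intro bexI[of _ "{}"]) auto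
  then show ?case unfolding whp_def by (intro allI impI always_eventually) blast
next
  case (insert i I)
  then show ?case by (simp add: whp_conj)
qed

lemma (in prob_space) whp_AE:
  assumes "\<forall>\<^sub>F n in sequentially. AE \<omega> in M. P n \<omega>"
  shows "whp M P"
  unfolding whp_def
proof (intro allI impI)
  fix d :: real assume "d > 0"
  show "\<forall>\<^sub>F n in sequentially. \<exists>E\<in>events. prob E \<le> d \<and> {\<omega> \<in> space M. \<not> P n \<omega>} \<subseteq> E"
    using assms
  proof eventually_elim
    case (elim n)
    then obtain N where "N \<in> null_sets M" "{\<omega> \<in> space M. \<not> P n \<omega>} \<subseteq> N"
      by (auto simp: eventually_ae_filter)
    then show ?case using \<open>d > 0\<close> by (intro bexI[of _ N]) (auto simp: measure_eq_0_null_sets)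
  qed
qed

lemma (in prob_space) whp_small_o_P:
  fixes R :: "nat \<Rightarrow> 'a \<Rightarrow> 'b::euclidean_space"
  assumes "\<And>e. e > 0 \<Longrightarrow> whp M (\<lambda>n \<omega>. norm (R n \<omega>) \<le> e)"
  shows "small_o_P M R"
  unfolding small_o_P_def
proof (intro allI impI, rule tendstoI)
  fix e d :: real assume "e > 0" "d > 0"
  then have "\<forall>\<^sub>F n in sequentially. \<exists>E\<in>events. prob E \<le> d / 2 \<and> {\<omega> \<in> space M. \<not> norm (R n \<omega>) \<le> e} \<subseteq> E"
    using assms[of e] unfolding whp_def by (meson half_gt_zero)
  then show "\<forall>\<^sub>F n in sequentially. dist (prob {\<omega> \<in> space M. norm (R n \<omega>) > e}) 0 < d"
  proof eventually_elim
    case (elim n)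
    then obtain E where E: "E \<in> events" "prob E \<le> d / 2" "{\<omega> \<in> space M. norm (R n \<omega>) > e} \<subseteq> E"
      unfolding not_le by blast
    then have "prob {\<omega> \<in> space M. norm (R n \<omega>) > e} \<le> d / 2"
      using finite_measure_mono[OF E(3,1)] by linarith
    then show ?case using \<open>d > 0\<close> by (simp add: dist_real_def measure_nonneg)
  qed
qed

lemma (in prob_space) prob_gt_le_second_moment:
  fixes e :: real
  assumes [measurable]: "Z \<in> borel_measurable M" and "integrable M (\<lambda>\<omega>. (Z \<omega>)\<^sup>2)" "e > 0"
  shows "prob {\<omega> \<in> space M. \<bar>Z \<omega>\<bar> > e} \<le> expectation (\<lambda>\<omega>. (Z \<omega>)\<^sup>2) / e\<^sup>2"
proof -
  have "prob {\<omega> \<in> space M. \<bar>Z \<omega>\<bar> > e} \<le> prob {\<omega> \<in> space M. \<bar>Z \<omega>\<bar> \<ge> e}"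
    by (intro finite_measure_mono) auto
  also have "\<dots> \<le> expectation (\<lambda>\<omega>. (Z \<omega>)\<^sup>2) / e\<^sup>2"
    using assms by (intro second_moment_method) auto
  finally show ?thesis .
qed

lemma (in prob_space) whp_second_moment:
  fixes e :: real
  assumes Z: "\<And>n. Z n \<in> borel_measurable M" "\<And>n. integrable M (\<lambda>\<omega>. (Z n \<omega>)\<^sup>2)"
    and lim: "(\<lambda>n. expectation (\<lambda>\<omega>. (Z n \<omega>)\<^sup>2)) \<longlonglongrightarrow> 0" and "e > 0"
  shows "whp M (\<lambda>n \<omega>. \<bar>Z n \<omega>\<bar> \<le> e)"
  unfolding whp_def
proof (intro allI impI)
  fix d :: real assume "d > 0"
  then have "\<forall>\<^sub>F n in sequentially. expectation (\<lambda>\<omega>. (Z n \<omega>)\<^sup>2) < d * e\<^sup>2"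
    using \<open>e > 0\<close> by (intro order_tendstoD(2)[OF lim]) auto
  then show "\<forall>\<^sub>F n in sequentially. \<exists>E\<in>events. prob E \<le> d \<and> {\<omega> \<in> space M. \<not> \<bar>Z n \<omega>\<bar> \<le> e} \<subseteq> E"
  proof eventually_elim
    case (elim n)
    have [measurable]: "Z n \<in> borel_measurable M" by (rule Z)
    have "prob {\<omega> \<in> space M. \<bar>Z n \<omega>\<bar> > e} \<le> d"
      using elim \<open>e > 0\<close>
      by (intro order_trans[OF prob_gt_le_second_moment[OF Z(1)[of n] Z(2)[of n] \<open>e > 0\<close>]]) (simp add: divide_le_eq)
    then show ?case by (intro bexI[of _ "{\<omega> \<in> space M. \<bar>Z n \<omega>\<bar> > e}"]) auto
  qed
qed

lemma (in prob_space) expectation_square_sum_orthogonal: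
  fixes Z :: "'i \<Rightarrow> 'a \<Rightarrow> real"
  assumes "finite I" "\<And>i j. i \<in> I \<Longrightarrow> j \<in> I \<Longrightarrow> integrable M (\<lambda>\<omega>. Z i \<omega> * Z j \<omega>)"
    and "\<And>i j. i \<in> I \<Longrightarrow> j \<in> I \<Longrightarrow> i \<noteq> j \<Longrightarrow> expectation (\<lambda>\<omega>. Z i \<omega> * Z j \<omega>) = 0"
  shows "integrable M (\<lambda>\<omega>. (\<Sum>i\<in>I. Z i \<omega>)\<^sup>2)"
    and "expectation (\<lambda>\<omega>. (\<Sum>i\<in>I. Z i \<omega>)\<^sup>2) = (\<Sum>i\<in>I. expectation (\<lambda>\<omega>. (Z i \<omega>)\<^sup>2))"
proof -
  have eq: "(\<Sum>i\<in>I. Z i \<omega>)\<^sup>2 = (\<Sum>i\<in>I. \<Sum>j\<in>I. Z i \<omega> * Z j \<omega>)" for \<omega>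
    by (simp add: power2_eq_square sum_product)
  show "integrable M (\<lambda>\<omega>. (\<Sum>i\<in>I. Z i \<omega>)\<^sup>2)"
    unfolding eq using assms by (intro Bochner_Integration.integrable_sum) auto
  have "expectation (\<lambda>\<omega>. (\<Sum>i\<in>I. Z i \<omega>)\<^sup>2) = (\<Sum>i\<in>I. \<Sum>j\<in>I. expectation (\<lambda>\<omega>. Z i \<omega> * Z j \<omega>))"
    unfolding eq using assms by (simp add: Bochner_Integration.integral_sum)
  also have "\<dots> = (\<Sum>i\<in>I. \<Sum>j\<in>I. if j = i then expectation (\<lambda>\<omega>. (Z i \<omega>)\<^sup>2) else 0)"
    using assms(3) by (intro sum.cong refl) (auto simp: power2_eq_square)
  also have "\<dots> = (\<Sum>i\<in>I. expectation (\<lambda>\<omega>. (Z i \<omega>)\<^sup>2))"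
    using assms(1) by simp
  finally show "expectation (\<lambda>\<omega>. (\<Sum>i\<in>I. Z i \<omega>)\<^sup>2) = (\<Sum>i\<in>I. expectation (\<lambda>\<omega>. (Z i \<omega>)\<^sup>2))" .
qed

text \<open>\<open>regression\<close> states the conditional mean of the response through bounded
  test functions of the design, which is the form that Fubini arguments consume.
  \<open>binary\<close> holds at every point and not only almost surely; the main proof arranges
  this by changing the sample on null sets.\<close>

locale nn_sample = prob_space M for M :: "'w measure" +
  fixes Ys :: "nat \<Rightarrow> 'w \<Rightarrow> real" and Xs :: "nat \<Rightarrow> 'w \<Rightarrow> real ^ 'p"
    and \<nu> :: "(real \<times> (real ^ 'p)) measure" and \<pi> f :: "real ^ 'p \<Rightarrow> real" and x :: "real ^ 'p"
    and k :: "nat \<Rightarrow> nat"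
  assumes Ys_meas [measurable]: "\<And>i. Ys i \<in> borel_measurable M"
    and Xs_meas [measurable]: "\<And>i. Xs i \<in> borel_measurable M"
    and binary: "\<And>i \<omega>. Ys i \<omega> \<in> {0, 1}"
    and indep: "indep_vars (\<lambda>_. borel) (\<lambda>i \<omega>. (Ys i \<omega>, Xs i \<omega>)) {1..}"
    and law: "\<And>i. i \<ge> 1 \<Longrightarrow> distr M borel (\<lambda>\<omega>. (Ys i \<omega>, Xs i \<omega>)) = \<nu>"
    and density: "\<And>i. i \<ge> 1 \<Longrightarrow> distributed M lborel (Xs i) (\<lambda>z. ennreal (f z))"
    and regression: "\<And>i \<psi> C. i \<ge> 1 \<Longrightarrow> \<psi> \<in> borel_measurable borel \<Longrightarrow> (\<And>z. \<bar>\<psi> z\<bar> \<le> C) \<Longrightarrow>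
        expectation (\<lambda>\<omega>. (Ys i \<omega> - \<pi> (Xs i \<omega>)) * \<psi> (Xs i \<omega>)) = 0"
    and \<pi>_meas [measurable]: "\<pi> \<in> borel_measurable borel" and \<pi>_range: "\<And>z. \<pi> z \<in> {0..1}"
    and \<pi>_cont: "isCont \<pi> x"
    and f_nonneg: "\<And>z. f z \<ge> 0" and f_cont: "continuous_on UNIV f" and f_pos: "f x > 0"
    and k_range: "\<And>n. n \<ge> 1 \<Longrightarrow> k n \<in> {1..n}"
    and k_lim: "filterlim k at_top sequentially"
    and k_div_n: "(\<lambda>n. real (k n) / real n) \<longlonglongrightarrow> 0"
begin

definition \<tau> :: "nat \<Rightarrow> real" where "\<tau> n = tau f n (k n) x"
definition U :: "nat \<Rightarrow> nat \<Rightarrow> 'w \<Rightarrow> real ^ 'p" where "U n i \<omega> = (1 / \<tau> n) *\<^sub>R (Xs i \<omega> - x)"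

lemma f_meas [measurable]: "f \<in> borel_measurable borel"
  using f_cont by (rule borel_measurable_continuous_onI)

lemma U_meas [measurable]: "U n i \<in> borel_measurable M"
  unfolding U_def[abs_def] by measurable

lemma V_pos: "vol_ball TYPE('p) > 0"
  unfolding vol_ball_def using content_cball[of 1 "0::real^'p"] by simp

lemma k_pos: "n \<ge> 1 \<Longrightarrow> real (k n) > 0"
  using k_range[of n] by auto

lemma \<tau>_pos: "n \<ge> 1 \<Longrightarrow> \<tau> n > 0"
  using k_pos f_pos V_pos by (simp add: \<tau>_def tau_def)

text \<open>The defining equation of the scale: \<open>n\<close> times the approximate probability
  \<open>f x * vol_ball * \<tau> ^ p\<close> of the ball equals \<open>k\<close>, so this ball
  should contain about \<open>k\<close> sample points.\<close>

lemma \<tau>_power: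
  assumes "n \<ge> 1"
  shows "\<tau> n ^ CARD('p) = real (k n) / real n * (1 / (f x * vol_ball TYPE('p)))"
proof -
  define a where "a = real (k n) / real n * (1 / (f x * vol_ball TYPE('p)))"
  have a: "a > 0" using assms k_pos f_pos V_pos by (simp add: a_def)
  have t: "\<tau> n = a powr (1 / real CARD('p))" by (simp add: \<tau>_def tau_def a_def)
  have "\<tau> n ^ CARD('p) = (a powr (1 / real CARD('p))) powr real CARD('p)"
    unfolding t using a by (subst powr_realpow) auto
  also have "\<dots> = a" using a by (simp add: powr_powr)
  finally show ?thesis by (simp only: a_def)
qed

lemma \<tau>_lim: "\<tau> \<longlonglongrightarrow> 0"
proof -
  have "(\<lambda>n. real (k n) / real n * (1 / (f x * vol_ball TYPE('p)))) \<longlonglongrightarrow> 0 * (1 / (f x * vol_ball TYPE('p)))"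
    by (intro tendsto_intros k_div_n)
  then have "(\<lambda>n. (real (k n) / real n * (1 / (f x * vol_ball TYPE('p)))) powr (1 / real CARD('p))) \<longlonglongrightarrow> 0 powr (1 / real CARD('p))"
    using f_pos V_pos by (intro tendsto_powr') (auto intro!: always_eventually)
  then show ?thesis by (simp add: \<tau>_def[abs_def] tau_def)
qed

section \<open>Kernel means at the scale of the neighbourhood\<close>

lemma expectation_Xs:
  assumes "i \<ge> 1" and [measurable]: "g \<in> borel_measurable borel"
  shows "expectation (\<lambda>\<omega>. g (Xs i \<omega>)) = (LINT z|lborel. f z * g z)"
  using distributed_integral[OF density[OF assms(1)], of g] f_nonneg by simp

text \<open>The support has radius 2 to leave room: the neighbours are only known to lie within
  \<open>2 * \<tau> n\<close> with high probability, whereas the limits live on the unit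
  ball.\<close>

definition kernel :: "(real ^ 'p \<Rightarrow> real) \<Rightarrow> bool" where
  "kernel g \<longleftrightarrow> g \<in> borel_measurable borel \<and> (\<exists>C. \<forall>u. \<bar>g u\<bar> \<le> C * indicator (cball 0 2) u)"

lemma kernel_meas: "kernel g \<Longrightarrow> g \<in> borel_measurable borel"
  by (simp add: kernel_def)

lemma kernelE:
  assumes "kernel g"
  obtains C where "C \<ge> 0" "\<And>u. \<bar>g u\<bar> \<le> C * indicator (cball 0 2) u" "\<And>u. \<bar>g u\<bar> \<le> C"
proof -
  obtain C where C: "\<And>u. \<bar>g u\<bar> \<le> C * indicator (cball 0 2) u" using assms by (auto simp: kernel_def)
  have "\<bar>g u\<bar> \<le> \<bar>C\<bar> * indicator (cball 0 2) u" "\<bar>g u\<bar> \<le> \<bar>C\<bar>" for u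
    using C[of u] by (cases "u \<in> cball 0 2"; simp)+
  then show ?thesis by (intro that[of "\<bar>C\<bar>"]) auto
qed

text \<open>Substituting \<open>z = x + \<tau> u\<close> produces the Jacobian
  \<open>\<tau> ^ p\<close>, and the factor \<open>n / k\<close> cancels it up to
  \<open>f x * vol_ball\<close>.\<close>

lemma expectation_kernel:
  assumes "n \<ge> 1" "i \<ge> 1" and [measurable]: "\<psi> \<in> borel_measurable borel" "g \<in> borel_measurable borel"
  shows "real n / real (k n) * expectation (\<lambda>\<omega>. \<psi> (Xs i \<omega>) * g (U n i \<omega>)) =
    (LINT u|lborel. f (x + \<tau> n *\<^sub>R u) * \<psi> (x + \<tau> n *\<^sub>R u) * g u) / (f x * vol_ball TYPE('p))"
proof -
  let ?G = "\<lambda>z. f z * (\<psi> z * g ((1 / \<tau> n) *\<^sub>R (z - x)))"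
  have t: "\<tau> n > 0" using \<tau>_pos assms by simp
  have "expectation (\<lambda>\<omega>. \<psi> (Xs i \<omega>) * g (U n i \<omega>)) = integral\<^sup>L lborel ?G"
    unfolding U_def using expectation_Xs[OF assms(2), of "\<lambda>z. \<psi> z * g ((1 / \<tau> n) *\<^sub>R (z - x))"] by simp
  also have "lborel = density (distr lborel borel (\<lambda>u. x + \<tau> n *\<^sub>R u)) (\<lambda>_. ennreal (\<tau> n ^ CARD('p)))"
    using lborel_affine[of "\<tau> n" x] t by (simp add: ennreal_power)
  also have "integral\<^sup>L \<dots> ?G = \<tau> n ^ CARD('p) * (LINT u|lborel. ?G (x + \<tau> n *\<^sub>R u))"
    using t by (subst integral_density) (auto simp: integral_distr)
  also have "(LINT u|lborel. ?G (x + \<tau> n *\<^sub>R u)) = (LINT u|lborel. f (x + \<tau> n *\<^sub>R u) * \<psi> (x + \<tau> n *\<^sub>R u) * g u)"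
    using t by (simp add: mult.assoc)
  finally show ?thesis using assms(1) k_pos[OF assms(1)] by (simp add: \<tau>_power)
qed

lemma kernel_mean_tendsto:
  assumes \<psi>: "\<psi> \<in> borel_measurable borel" "\<And>z. \<bar>\<psi> z\<bar> \<le> D" "isCont \<psi> x" and g: "kernel g"
  shows "(\<lambda>n. real n / real (k n) * expectation (\<lambda>\<omega>. \<psi> (Xs 1 \<omega>) * g (U n 1 \<omega>)))
    \<longlonglongrightarrow> \<psi> x * ((LINT u|lborel. g u) / vol_ball TYPE('p))"
proof -
  obtain C where C: "C \<ge> 0" "\<And>u. \<bar>g u\<bar> \<le> C * indicator (cball 0 2) u" using kernelE[OF g] by metis
  have [measurable]: "g \<in> borel_measurable borel" by (rule kernel_meas[OF g])
  note \<psi>(1)[measurable]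
  \<comment> \<open>A common bound on all scales keeps \<open>x + \<tau> n *\<^sub>R u\<close> with
    \<open>norm u \<le> 2\<close> in one compact ball, where \<open>f\<close> is bounded. A single
    function then dominates the integrands for every \<open>n\<close>.\<close>
  have "bounded (range \<tau>)" using \<tau>_lim convergent_imp_bounded by blast
  then obtain B where B: "\<And>n. \<bar>\<tau> n\<bar> \<le> B" by (auto simp: bounded_iff)
  have B0: "B \<ge> 0" using B[of 0] by linarith
  have "compact (f ` cball x (2 * B))" using f_cont by (intro compact_continuous_image continuous_on_subset[OF f_cont]) auto
  then obtain F where F: "\<And>z. z \<in> cball x (2 * B) \<Longrightarrow> \<bar>f z\<bar> \<le> F"
    using compact_imp_bounded[of "f ` cball x (2 * B)"] unfolding bounded_iff by (metis imageI real_norm_def)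
  have F0: "F \<ge> 0" using F[of x] B0 by (simp) 
  have D0: "D \<ge> 0" using \<psi>(2)[of x] by linarith
  have lim: "(\<lambda>n. x + \<tau> n *\<^sub>R u) \<longlonglongrightarrow> x" for u
    using tendsto_add[OF tendsto_const tendsto_scaleR[OF \<tau>_lim tendsto_const], of x u] by simp
  have "isCont f x" using f_cont by (simp add: continuous_on_eq_continuous_at)
  then have "(\<lambda>n. LINT u|lborel. f (x + \<tau> n *\<^sub>R u) * \<psi> (x + \<tau> n *\<^sub>R u) * g u)
     \<longlonglongrightarrow> (LINT u|lborel. f x * \<psi> x * g u)"
  proof (intro integral_dominated_convergence[where w="\<lambda>u. F * D * C * indicator (cball 0 2) u"])
    show "integrable lborel (\<lambda>u::real^'p. F * D * C * indicator (cball 0 2) u)"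
      by (intro integrable_mult_right integrable_real_indicator emeasure_lborel_cball_finite) simp
    show "AE u in lborel. (\<lambda>n. f (x + \<tau> n *\<^sub>R u) * \<psi> (x + \<tau> n *\<^sub>R u) * g u) \<longlonglongrightarrow> f x * \<psi> x * g u"
      using \<open>isCont f x\<close> \<psi>(3) lim by (intro AE_I2 tendsto_intros) (auto intro: isCont_tendsto_compose)
    fix n
    show "AE u in lborel. norm (f (x + \<tau> n *\<^sub>R u) * \<psi> (x + \<tau> n *\<^sub>R u) * g u) \<le> F * D * C * indicator (cball 0 2) u"
    proof (rule AE_I2)
      fix u
      show "norm (f (x + \<tau> n *\<^sub>R u) * \<psi> (x + \<tau> n *\<^sub>R u) * g u) \<le> F * D * C * indicator (cball 0 2) u"
      proof (cases "u \<in> cball 0 2")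
        case True
        have "\<bar>\<tau> n\<bar> * norm u \<le> B * 2" using B[of n] True B0 by (intro mult_mono) auto
        then have "x + \<tau> n *\<^sub>R u \<in> cball x (2 * B)" by (simp add: dist_norm)
        then have "\<bar>f (x + \<tau> n *\<^sub>R u)\<bar> * \<bar>\<psi> (x + \<tau> n *\<^sub>R u)\<bar> * \<bar>g u\<bar> \<le> F * D * C"
          using F \<psi>(2) C(2)[of u] True F0 D0 by (intro mult_mono) auto
        then show ?thesis using True by (simp add: abs_mult)
      next
        case False
        then show ?thesis using C(2)[of u] by simp
      qed
    qed
  qed auto
  then have "(\<lambda>n. (LINT u|lborel. f (x + \<tau> n *\<^sub>R u) * \<psi> (x + \<tau> n *\<^sub>R u) * g u) / (f x * vol_ball TYPE('p)))
     \<longlonglongrightarrow> (f x * \<psi> x * (LINT u|lborel. g u)) / (f x * vol_ball TYPE('p))"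
    using f_pos V_pos by (intro tendsto_divide) auto
  moreover have "(f x * \<psi> x * (LINT u|lborel. g u)) / (f x * vol_ball TYPE('p)) = \<psi> x * ((LINT u|lborel. g u) / vol_ball TYPE('p))"
    using f_pos by simp
  moreover have "\<forall>\<^sub>F n in sequentially. (LINT u|lborel. f (x + \<tau> n *\<^sub>R u) * \<psi> (x + \<tau> n *\<^sub>R u) * g u) / (f x * vol_ball TYPE('p)) =
     real n / real (k n) * expectation (\<lambda>\<omega>. \<psi> (Xs 1 \<omega>) * g (U n 1 \<omega>))"
    using eventually_ge_at_top[of 1] by eventually_elim (rule expectation_kernel[symmetric], use \<psi>(1) in auto)
  ultimately show ?thesis by (simp add: tendsto_cong)
qed

lemma integrable_bounded:
  fixes Z :: "'w \<Rightarrow> real"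
  assumes "Z \<in> borel_measurable M" "\<And>\<omega>. \<bar>Z \<omega>\<bar> \<le> C"
  shows "integrable M Z"
  using assms by (intro integrable_const_bound[of _ C]) auto

text \<open>Fubini in the coordinate \<open>i\<close> of the sample.\<close>

lemma expectation_sample_zero:
  fixes G :: "(nat \<Rightarrow> real \<times> (real ^ 'p)) \<Rightarrow> real"
  assumes i: "i \<in> {1..n}" and G [measurable]: "G \<in> borel_measurable (PiM {1..n} (\<lambda>_. borel))"
    and bnd: "AE \<omega> in M. \<bar>G (\<lambda>j\<in>{1..n}. (Ys j \<omega>, Xs j \<omega>))\<bar> \<le> C"
    and zero: "\<And>w. (LINT z|\<nu>. G (w(i := z))) = 0"
  shows "expectation (\<lambda>\<omega>. G (\<lambda>j\<in>{1..n}. (Ys j \<omega>, Xs j \<omega>))) = 0"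
proof -
  define I where "I = {1..n}"
  have I: "finite I" "\<And>j. j \<in> I \<Longrightarrow> j \<ge> 1" "i \<in> I" using i by (auto simp: I_def)
  have [measurable]: "G \<in> borel_measurable (PiM I (\<lambda>_. borel))" using G by (simp add: I_def)
  let ?S = "\<lambda>\<omega>. \<lambda>j\<in>I. (Ys j \<omega>, Xs j \<omega>)"
  have \<nu>: "prob_space \<nu>" "sets \<nu> = sets borel"
    using law[of 1] prob_space_distr[of "\<lambda>\<omega>. (Ys 1 \<omega>, Xs 1 \<omega>)" borel] by (auto simp flip: law[of 1])
  interpret P: product_prob_space "\<lambda>_. \<nu>" "I"
    by (intro product_prob_spaceI \<nu>(1))
  have "indep_vars (\<lambda>_. borel) (\<lambda>j \<omega>. (Ys j \<omega>, Xs j \<omega>)) I"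
    by (rule indep_vars_subset[OF indep]) (auto simp: I_def)
  moreover have "I \<noteq> {}" using I by auto
  ultimately have "distr M (PiM I (\<lambda>_. borel)) ?S =
      PiM I (\<lambda>j. distr M borel (\<lambda>\<omega>. (Ys j \<omega>, Xs j \<omega>)))"
    by (intro iffD1[OF indep_vars_iff_distr_eq_PiM']) measurable
  also have "\<dots> = PiM I (\<lambda>_. \<nu>)" using I by (intro PiM_cong) (auto simp: law)
  finally have D: "distr M (PiM I (\<lambda>_. borel)) ?S = PiM I (\<lambda>_. \<nu>)" .
  have S [measurable]: "?S \<in> M \<rightarrow>\<^sub>M PiM I (\<lambda>_. borel)" by measurable
  have int: "integrable (PiM I (\<lambda>_. \<nu>)) G"
    unfolding D[symmetric] using bnd[folded I_def]
    by (subst integrable_distr_eq) (auto intro!: integrable_const_bound[of _ C])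
  have ins: "insert i (I - {i}) = I" using I by auto
  have "expectation (\<lambda>\<omega>. G (?S \<omega>)) = integral\<^sup>L (PiM I (\<lambda>_. \<nu>)) G"
    unfolding D[symmetric] by (rule integral_distr[symmetric, OF S]) simp
  also have "\<dots> = (LINT w|PiM (I - {i}) (\<lambda>_. \<nu>). LINT z|\<nu>. G (w(i := z)))"
    using P.product_integral_insert[of "I - {i}" i G] int I unfolding ins by simp
  also have "\<dots> = 0" by (simp add: zero)
  finally show ?thesis by (simp only: I_def)
qed

end

lemma measurable_component_compose:
  assumes "l \<in> I" "h \<in> N \<rightarrow>\<^sub>M L"
  shows "(\<lambda>w. h (w l)) \<in> PiM I (\<lambda>_. N) \<rightarrow>\<^sub>M L"
proof (rule measurable_compose[OF _ assms(2)])
  show "(\<lambda>w. w l) \<in> PiM I (\<lambda>_. N) \<rightarrow>\<^sub>M N"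
    using assms(1) by (rule measurable_component_singleton)
qed

context nn_sample
begin

section \<open>Orthogonality of the residuals given the design\<close>

lemma sets_\<nu> [simp, measurable_cong]: "sets \<nu> = sets borel"
  by (simp flip: law[of 1])

lemma integral_\<nu>:
  fixes h :: "real \<times> (real ^ 'p) \<Rightarrow> real"
  assumes "i \<ge> 1" "h \<in> borel_measurable borel"
  shows "integral\<^sup>L \<nu> h = expectation (\<lambda>\<omega>. h (Ys i \<omega>, Xs i \<omega>))"
  unfolding law[OF assms(1), symmetric] using assms(2) by (intro integral_distr) auto

lemma expectation_pair_eq:
  fixes h :: "real \<times> (real ^ 'p) \<Rightarrow> real"
  assumes "i \<ge> 1" "h \<in> borel_measurable borel"
  shows "expectation (\<lambda>\<omega>. h (Ys i \<omega>, Xs i \<omega>)) = expectation (\<lambda>\<omega>. h (Ys 1 \<omega>, Xs 1 \<omega>))"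
  using integral_\<nu>[OF assms] integral_\<nu>[of 1 h] assms(2) by simp

lemma residual_bound: "\<bar>Ys i \<omega> - \<pi> z\<bar> \<le> 1"
  using binary[of i \<omega>] \<pi>_range[of z] by auto

lemma residual_meas: "(\<lambda>z. fst z - \<pi> (snd z)) \<in> borel_measurable (borel :: (real \<times> (real ^ 'p)) measure)"
  by (simp add: borel_prod[symmetric])

definition proj :: "nat \<Rightarrow> real ^ 'p \<Rightarrow> real ^ 'p" where
  "proj n z = (1 / \<tau> n) *\<^sub>R (z - x)"

lemma U_proj: "U n i \<omega> = proj n (Xs i \<omega>)"
  by (simp add: U_def proj_def)

lemma proj_meas [measurable]: "proj n \<in> borel_measurable borel"
  unfolding proj_def[abs_def] by measurable

lemma norm_proj_le: "n \<ge> 1 \<Longrightarrow> norm (proj n z) \<le> r \<longleftrightarrow> dist z x \<le> r * \<tau> n"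
  using \<tau>_pos[of n] by (simp add: proj_def dist_norm divide_simps mult.commute)

text \<open>The weights \<open>H i\<close> may depend on the entire design, as membership among the
  nearest neighbours does. With every pair but the \<open>i\<close>th frozen, a mixed product is a
  constant times the residual of \<open>i\<close> times a bounded function of the \<open>i\<close>th
  covariate, and \<open>regression\<close> annihilates it.\<close>

lemma residual_orthogonal:
  fixes H :: "nat \<Rightarrow> (nat \<Rightarrow> real ^ 'p) \<Rightarrow> real"
  assumes H1: "\<And>i. i \<in> {1..n} \<Longrightarrow> (\<lambda>w. H i (\<lambda>j. snd (w j))) \<in> borel_measurable (PiM {1..n} (\<lambda>_. borel :: (real \<times> (real ^ 'p)) measure))"
    and H2: "\<And>i zs j. i \<in> {1..n} \<Longrightarrow> (\<lambda>z. H i (zs(j := z))) \<in> borel_measurable borel"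
    and H3: "\<And>i. i \<in> {1..n} \<Longrightarrow> (\<lambda>\<omega>. H i (\<lambda>j. Xs j \<omega>)) \<in> borel_measurable M"
    and H4: "\<And>i zs. \<bar>H i zs\<bar> \<le> C"
    and H5: "\<And>i zs zs'. i \<in> {1..n} \<Longrightarrow> (\<And>j. j \<in> {1..n} \<Longrightarrow> zs j = zs' j) \<Longrightarrow> H i zs = H i zs'"
  defines "Z \<equiv> \<lambda>i \<omega>. (Ys i \<omega> - \<pi> (Xs i \<omega>)) * H i (\<lambda>j. Xs j \<omega>)"
  shows "integrable M (\<lambda>\<omega>. (\<Sum>i\<in>{1..n}. Z i \<omega>)\<^sup>2)"
    and "expectation (\<lambda>\<omega>. (\<Sum>i\<in>{1..n}. Z i \<omega>)\<^sup>2) = (\<Sum>i\<in>{1..n}. expectation (\<lambda>\<omega>. (Z i \<omega>)\<^sup>2))"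
proof -
  have C0: "C \<ge> 0" using H4[of 0 undefined] by linarith
  have Zm [measurable]: "Z i \<in> borel_measurable M" if "i \<in> {1..n}" for i
    unfolding Z_def using H3[OF that] by measurable
  have Zb: "\<bar>Z i \<omega>\<bar> \<le> C" for i \<omega>
    using mult_mono[OF residual_bound[of i \<omega> "Xs i \<omega>"] H4[of i "\<lambda>j. Xs j \<omega>"]] by (simp add: Z_def abs_mult)
  have int: "integrable M (\<lambda>\<omega>. Z i \<omega> * Z j \<omega>)" if "i \<in> {1..n}" "j \<in> {1..n}" for i j
    using that Zb C0 by (intro integrable_bounded[of _ "C * C"]) (auto simp: abs_mult intro!: mult_mono)
  have zero: "expectation (\<lambda>\<omega>. Z i \<omega> * Z j \<omega>) = 0" if ij: "i \<in> {1..n}" "j \<in> {1..n}" "i \<noteq> j" for i j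
  proof -
    define G where "G w = (fst (w i) - \<pi> (snd (w i))) * H i (\<lambda>j. snd (w j)) *
       ((fst (w j) - \<pi> (snd (w j))) * H j (\<lambda>j. snd (w j)))" for w :: "nat \<Rightarrow> real \<times> (real ^ 'p)"
    have G_sample: "G (\<lambda>j\<in>{1..n}. (Ys j \<omega>, Xs j \<omega>)) = Z i \<omega> * Z j \<omega>" for \<omega>
    proof -
      \<comment> \<open>The restricted sample is \<open>undefined\<close> outside
        \<open>{1..n}\<close>; by \<open>H5\<close> the weights ignore those coordinates.\<close>
      have "H l (\<lambda>j. snd ((\<lambda>j\<in>{1..n}. (Ys j \<omega>, Xs j \<omega>)) j)) = H l (\<lambda>j. Xs j \<omega>)" if "l \<in> {1..n}" for l
        using that by (rule H5) auto
      from this[OF ij(1)] this[OF ij(2)] show ?thesis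
        unfolding G_def Z_def using ij by (simp only: restrict_apply' fst_conv snd_conv)
    qed
    have "expectation (\<lambda>\<omega>. G (\<lambda>j\<in>{1..n}. (Ys j \<omega>, Xs j \<omega>))) = 0"
    proof (rule expectation_sample_zero[OF ij(1)])
      show "G \<in> borel_measurable (PiM {1..n} (\<lambda>_. borel))"
        unfolding G_def[abs_def] using ij
        by (intro borel_measurable_times H1 measurable_component_compose[OF _ residual_meas])
      show "AE \<omega> in M. \<bar>G (\<lambda>j\<in>{1..n}. (Ys j \<omega>, Xs j \<omega>))\<bar> \<le> C * C"
        unfolding G_sample abs_mult using Zb C0 by (intro AE_I2 mult_mono) auto
      fix w :: "nat \<Rightarrow> real \<times> (real ^ 'p)"
      \<comment> \<open>The weight of \<open>j\<close> also depends on covariate \<open>i\<close>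
        through the design, so it must be part of the test function. Only the residual of
        \<open>j\<close> is constant when pair \<open>i\<close> varies.\<close>
      define \<psi> where "\<psi> z = H i ((\<lambda>j. snd (w j))(i := z)) * H j ((\<lambda>j. snd (w j))(i := z))" for z
      have [measurable]: "\<psi> \<in> borel_measurable borel"
        unfolding \<psi>_def[abs_def] using H2 ij by (intro borel_measurable_times) auto
      have upd: "(\<lambda>j. snd ((w(i := z)) j)) = (\<lambda>j. snd (w j))(i := snd z)" for z by auto
      have Gw: "G (w(i := z)) = (fst (w j) - \<pi> (snd (w j))) * ((fst z - \<pi> (snd z)) * \<psi> (snd z))" for z
        unfolding G_def upd \<psi>_def using ij by simp
      have "(LINT z|\<nu>. (fst z - \<pi> (snd z)) * \<psi> (snd z)) = expectation (\<lambda>\<omega>. (Ys 1 \<omega> - \<pi> (Xs 1 \<omega>)) * \<psi> (Xs 1 \<omega>))"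
        by (subst integral_\<nu>[of 1]) (auto simp: borel_prod[symmetric])
      also have "\<dots> = 0"
      proof (rule regression)
        show "\<bar>\<psi> z\<bar> \<le> C * C" for z
          unfolding \<psi>_def abs_mult using H4 C0 by (intro mult_mono) auto
      qed auto
      finally show "(LINT z|\<nu>. G (w(i := z))) = 0"
        unfolding Gw by simp
    qed
    then show ?thesis by (simp only: G_sample)
  qed
  show "integrable M (\<lambda>\<omega>. (\<Sum>i\<in>{1..n}. Z i \<omega>)\<^sup>2)"
    by (rule expectation_square_sum_orthogonal(1)[OF _ int zero]) auto
  show "expectation (\<lambda>\<omega>. (\<Sum>i\<in>{1..n}. Z i \<omega>)\<^sup>2) = (\<Sum>i\<in>{1..n}. expectation (\<lambda>\<omega>. (Z i \<omega>)\<^sup>2))"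
    by (rule expectation_square_sum_orthogonal(2)[OF _ int zero]) auto
qed

lemma kernelI:
  assumes "g \<in> borel_measurable borel" "\<And>u. norm u \<le> 2 \<Longrightarrow> \<bar>g u\<bar> \<le> C" "\<And>u. norm u > 2 \<Longrightarrow> g u = 0"
  shows "kernel g"
  unfolding kernel_def
proof (intro conjI exI allI)
  show "\<bar>g u\<bar> \<le> C * indicator (cball 0 2) u" for u
    using assms(2,3)[of u] by (cases "norm u \<le> 2") auto
qed (rule assms(1))

lemma kernel_truncate:
  assumes [measurable]: "g \<in> borel_measurable borel" and "\<And>u. norm u \<le> 2 \<Longrightarrow> \<bar>g u\<bar> \<le> C" "r \<le> 2"
  shows "kernel (\<lambda>u. indicator (cball 0 r) u * g u)"
proof (rule kernelI)
  show "\<bar>indicator (cball 0 r) u * g u\<bar> \<le> C" if "norm u \<le> 2" for u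
    using assms(2)[OF that] by (auto simp: indicator_def)
qed (use assms(3) in \<open>auto simp: indicator_def\<close>)

section \<open>Law of large numbers for kernel averages\<close>

definition kernel_avg :: "(real ^ 'p \<Rightarrow> real) \<Rightarrow> nat \<Rightarrow> 'w \<Rightarrow> real" where
  "kernel_avg g n \<omega> = (\<Sum>i\<in>{1..n}. g (U n i \<omega>)) / real (k n)"

lemma kernel_avg_meas [measurable (raw)]:
  assumes [measurable]: "g \<in> borel_measurable borel"
  shows "kernel_avg g n \<in> borel_measurable M"
  unfolding kernel_avg_def[abs_def] by measurable

lemma integrable_kernel_avg:
  assumes "kernel g" shows "integrable M (\<lambda>\<omega>. (kernel_avg g n \<omega> - m)\<^sup>2)"
proof -
  obtain C where C: "C \<ge> 0" "\<And>u. \<bar>g u\<bar> \<le> C" using kernelE[OF assms] by metis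
  have [measurable]: "g \<in> borel_measurable borel" by (rule kernel_meas[OF assms])
  have "\<bar>kernel_avg g n \<omega>\<bar> \<le> (\<Sum>i\<in>{1..n}. C) / real (k n)" for \<omega>
    unfolding kernel_avg_def abs_divide abs_of_nat
    by (intro divide_right_mono order_trans[OF sum_abs] sum_mono C) simp
  then have "\<bar>kernel_avg g n \<omega> - m\<bar> \<le> (\<Sum>i\<in>{1..n}. C) / real (k n) + \<bar>m\<bar>" for \<omega>
    by (meson abs_triangle_ineq4 add_right_mono order_trans)
  then have "\<bar>kernel_avg g n \<omega> - m\<bar> \<le> \<bar>(\<Sum>i\<in>{1..n}. C) / real (k n) + \<bar>m\<bar>\<bar>" for \<omega>
    by (meson abs_ge_self order_trans)
  then show ?thesis
    by (intro integrable_bounded[of _ "((\<Sum>i\<in>{1..n}. C) / real (k n) + \<bar>m\<bar>)\<^sup>2"]) (auto simp: abs_le_square_iff)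
qed

lemma inverse_k_lim: "(\<lambda>n. 1 / real (k n)) \<longlonglongrightarrow> 0"
  by (intro tendsto_divide_0[OF tendsto_const] filterlim_at_top_imp_at_infinity
      filterlim_compose[OF filterlim_real_sequentially k_lim])

text \<open>Bias and variance: \<open>b\<close> is the error of the mean, which vanishes by
  \<open>kernel_mean_tendsto\<close>. The variance is at most \<open>v\<close>, which is
  \<open>1 / k\<close> times the normalized second moment of the kernel, and that moment
  converges.\<close>

lemma kernel_avg_tendsto_L2:
  assumes g: "kernel g"
  shows "(\<lambda>n. expectation (\<lambda>\<omega>. (kernel_avg g n \<omega> - (LINT u|lborel. g u) / vol_ball TYPE('p))\<^sup>2)) \<longlonglongrightarrow> 0"
proof -
  define m where "m = (LINT u|lborel. g u) / vol_ball TYPE('p)"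
  obtain C where C: "C \<ge> 0" "\<And>u. \<bar>g u\<bar> \<le> C * indicator (cball 0 2) u" "\<And>u. \<bar>g u\<bar> \<le> C"
    using kernelE[OF g] by metis
  have gm [measurable]: "g \<in> borel_measurable borel" by (rule kernel_meas[OF g])
  define \<mu> where "\<mu> n = expectation (\<lambda>\<omega>. g (U n 1 \<omega>))" for n
  define c where "c n i \<omega> = g (U n i \<omega>) - \<mu> n" for n i \<omega>
  have \<mu>_eq: "expectation (\<lambda>\<omega>. g (U n i \<omega>)) = \<mu> n" if "i \<ge> 1" for n i
    unfolding \<mu>_def U_proj using expectation_pair_eq[OF that, of "\<lambda>z. g (proj n (snd z))"]
    by (simp add: borel_prod[symmetric])
  have sq_eq: "expectation (\<lambda>\<omega>. (g (U n i \<omega>))\<^sup>2) = expectation (\<lambda>\<omega>. (g (U n 1 \<omega>))\<^sup>2)" if "i \<ge> 1" for n i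
    unfolding U_proj using expectation_pair_eq[OF that, of "\<lambda>z. (g (proj n (snd z)))\<^sup>2"]
    by (simp add: borel_prod[symmetric])
  have int_g: "integrable M (\<lambda>\<omega>. g (U n i \<omega>))" for n i
    using C(3) by (intro integrable_bounded[of _ C]) auto
  have int_g2: "integrable M (\<lambda>\<omega>. (g (U n i \<omega>))\<^sup>2)" for n i
    using C(1) C(3)[of "U n i _"] by (intro integrable_bounded[of _ "C\<^sup>2"]) (auto simp flip: abs_le_square_iff)
  have \<mu>_le: "\<bar>\<mu> n\<bar> \<le> C" for n
    unfolding \<mu>_def using C(3) int_g
    by (intro order_trans[OF integral_abs_bound] integral_le_const) auto
  have c_le: "\<bar>c n i \<omega>\<bar> \<le> 2 * C" for n i \<omega>
    using C(3)[of "U n i \<omega>"] \<mu>_le[of n] unfolding c_def by linarith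
  have cm [measurable]: "c n i \<in> borel_measurable M" for n i unfolding c_def[abs_def] by measurable
  have int_c: "integrable M (\<lambda>\<omega>. c n i \<omega> * c n j \<omega>)" for n i j
  proof (rule integrable_bounded[of _ "2 * C * (2 * C)"])
    show "\<bar>c n i \<omega> * c n j \<omega>\<bar> \<le> 2 * C * (2 * C)" for \<omega>
      unfolding abs_mult using c_le C(1) by (intro mult_mono) auto
  qed measurable
  have orth: "expectation (\<lambda>\<omega>. c n i \<omega> * c n j \<omega>) = 0" if ij: "i \<in> {1..n}" "j \<in> {1..n}" "i \<noteq> j" for n i j
  proof -
    define c' where "c' z = g (proj n (snd z)) - \<mu> n" for z :: "real \<times> (real ^ 'p)"
    have c'm [measurable]: "c' \<in> borel_measurable borel" unfolding c'_def[abs_def] by (simp add: borel_prod[symmetric])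
    have G: "c' ((\<lambda>j\<in>{1..n}. (Ys j \<omega>, Xs j \<omega>)) l) = c n l \<omega>" if "l \<in> {1..n}" for l \<omega>
      using that by (simp add: c'_def c_def U_proj)
    have "expectation (\<lambda>\<omega>. (\<lambda>w. c' (w i) * c' (w j)) (\<lambda>j\<in>{1..n}. (Ys j \<omega>, Xs j \<omega>))) = 0"
    proof (rule expectation_sample_zero[OF ij(1)])
      show "(\<lambda>w. c' (w i) * c' (w j)) \<in> borel_measurable (PiM {1..n} (\<lambda>_. borel))"
        using ij by (intro borel_measurable_times measurable_component_compose[OF _ c'm])
      show "AE \<omega> in M. \<bar>c' ((\<lambda>j\<in>{1..n}. (Ys j \<omega>, Xs j \<omega>)) i) * c' ((\<lambda>j\<in>{1..n}. (Ys j \<omega>, Xs j \<omega>)) j)\<bar> \<le> 2 * C * (2 * C)"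
        unfolding G[OF ij(1)] G[OF ij(2)] abs_mult using c_le C(1) by (intro AE_I2 mult_mono) auto
      fix w :: "nat \<Rightarrow> real \<times> (real ^ 'p)"
      have "integral\<^sup>L \<nu> c' = expectation (c n 1)"
        by (subst integral_\<nu>[of 1]) (auto simp: c'_def c_def[abs_def] U_proj)
      also have "\<dots> = 0"
        unfolding c_def using int_g[of n 1] by (simp add: \<mu>_def prob_space)
      finally show "(LINT z|\<nu>. c' ((w(i := z)) i) * c' ((w(i := z)) j)) = 0"
        using ij by simp
    qed
    then show ?thesis by (simp only: G[OF ij(1)] G[OF ij(2)])
  qed
  have c2: "expectation (\<lambda>\<omega>. (c n i \<omega>)\<^sup>2) \<le> expectation (\<lambda>\<omega>. (g (U n 1 \<omega>))\<^sup>2)" if "i \<ge> 1" for n i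
  proof -
    have "expectation (\<lambda>\<omega>. (c n i \<omega>)\<^sup>2) = expectation (\<lambda>\<omega>. (g (U n i \<omega>))\<^sup>2 - 2 * \<mu> n * g (U n i \<omega>) + (\<mu> n)\<^sup>2)"
      by (simp add: c_def power2_eq_square algebra_simps)
    also have "\<dots> = expectation (\<lambda>\<omega>. (g (U n i \<omega>))\<^sup>2) - 2 * \<mu> n * \<mu> n + (\<mu> n)\<^sup>2"
      using int_g[of n i] int_g2[of n i] by (simp add: \<mu>_eq[OF that] prob_space)
    also have "\<dots> \<le> expectation (\<lambda>\<omega>. (g (U n i \<omega>))\<^sup>2)" by (simp add: power2_eq_square)
    finally show ?thesis using sq_eq[OF that] by simp
  qed
  define b where "b n = real n / real (k n) * \<mu> n - m" for n
  define v where "v n = 1 / real (k n) * (real n / real (k n) * expectation (\<lambda>\<omega>. (g (U n 1 \<omega>))\<^sup>2))" for n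
  have upper: "expectation (\<lambda>\<omega>. (kernel_avg g n \<omega> - m)\<^sup>2) \<le> 2 * v n + 2 * (b n)\<^sup>2" for n
  proof -
    define S where "S \<omega> = (\<Sum>i\<in>{1..n}. c n i \<omega>)" for \<omega>
    have "kernel_avg g n \<omega> - m = S \<omega> / real (k n) + b n" for \<omega>
      by (simp add: kernel_avg_def S_def c_def sum_subtractf b_def diff_divide_distrib)
    then have le: "(kernel_avg g n \<omega> - m)\<^sup>2 \<le> 2 * ((S \<omega>)\<^sup>2 / (real (k n))\<^sup>2) + 2 * (b n)\<^sup>2" for \<omega>
      using sum_squares_bound[of "S \<omega> / real (k n)" "b n"] by (simp add: power2_sum power_divide)
    have int_S: "integrable M (\<lambda>\<omega>. (S \<omega>)\<^sup>2)"
      unfolding S_def by (rule expectation_square_sum_orthogonal(1)[OF _ int_c orth]) auto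
    have "expectation (\<lambda>\<omega>. (S \<omega>)\<^sup>2) = (\<Sum>i\<in>{1..n}. expectation (\<lambda>\<omega>. (c n i \<omega>)\<^sup>2))"
      unfolding S_def by (rule expectation_square_sum_orthogonal(2)[OF _ int_c orth]) auto
    also have "\<dots> \<le> (\<Sum>i\<in>{1..n}. expectation (\<lambda>\<omega>. (g (U n 1 \<omega>))\<^sup>2))"
      by (intro sum_mono c2) auto
    finally have ES: "expectation (\<lambda>\<omega>. (S \<omega>)\<^sup>2) \<le> real n * expectation (\<lambda>\<omega>. (g (U n 1 \<omega>))\<^sup>2)" by simp
    have "expectation (\<lambda>\<omega>. (kernel_avg g n \<omega> - m)\<^sup>2) \<le> expectation (\<lambda>\<omega>. 2 * ((S \<omega>)\<^sup>2 / (real (k n))\<^sup>2) + 2 * (b n)\<^sup>2)"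
      using int_S by (intro integral_mono integrable_kernel_avg[OF g] le) auto
    also have "\<dots> = 2 * (expectation (\<lambda>\<omega>. (S \<omega>)\<^sup>2) / (real (k n))\<^sup>2) + 2 * (b n)\<^sup>2"
      using int_S by (simp add: prob_space)
    also have "\<dots> \<le> 2 * v n + 2 * (b n)\<^sup>2"
      using divide_right_mono[OF ES, of "(real (k n))\<^sup>2"] by (simp add: v_def power2_eq_square)
    finally show ?thesis .
  qed
  have "(\<lambda>n. real n / real (k n) * \<mu> n) \<longlonglongrightarrow> 1 * m"
    unfolding \<mu>_def m_def using kernel_mean_tendsto[of "\<lambda>_. 1" 1 g] g by simp
  then have b: "b \<longlonglongrightarrow> 0" unfolding b_def[abs_def] by (auto intro: tendsto_eq_intros)
  have g2: "kernel (\<lambda>u. (g u)\<^sup>2)"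
  proof (rule kernelI)
    show "\<bar>(g u)\<^sup>2\<bar> \<le> C\<^sup>2" for u using power_mono[OF C(3)[of u], of 2] by simp
    show "(g u)\<^sup>2 = 0" if "norm u > 2" for u using C(2)[of u] that by simp
  qed measurable
  have "(\<lambda>n. real n / real (k n) * expectation (\<lambda>\<omega>. (g (U n 1 \<omega>))\<^sup>2)) \<longlonglongrightarrow> (LINT u|lborel. (g u)\<^sup>2) / vol_ball TYPE('p)"
    using kernel_mean_tendsto[of "\<lambda>_. 1" 1 "\<lambda>u. (g u)\<^sup>2"] g2 by simp
  from tendsto_mult[OF inverse_k_lim this] have "v \<longlonglongrightarrow> 0"
    unfolding v_def[abs_def] by simp
  then have "(\<lambda>n. 2 * v n + 2 * (b n)\<^sup>2) \<longlonglongrightarrow> 0"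
    using b by (auto intro!: tendsto_eq_intros)
  then show ?thesis unfolding m_def[symmetric]
    by (rule tendsto_sandwich[OF always_eventually always_eventually tendsto_const, rotated 2])
      (simp, intro allI upper)
qed

end

lemma pred_mem_cball [measurable (raw)]:
  fixes h :: "'b \<Rightarrow> 'a::euclidean_space"
  assumes [measurable]: "h \<in> borel_measurable N"
  shows "Measurable.pred N (\<lambda>z. h z \<in> cball c r)"
  unfolding mem_cball by measurable

lemma indicator_cball_0: "indicator (cball (0::'a::real_normed_vector) r) u = (of_bool (norm u \<le> r) :: real)"
  by (simp add: indicator_def)

lemma nearest_cong:
  assumes "\<And>j. j \<in> {1..n} \<Longrightarrow> xs j = xs' j"
  shows "nearest n m xs y = nearest n m xs' y"
proof -
  have "{j \<in> {1..n}. dist (xs j) y < dist (xs i) y \<or> dist (xs j) y = dist (xs i) y \<and> j < i} =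
    {j \<in> {1..n}. dist (xs' j) y < dist (xs' i) y \<or> dist (xs' j) y = dist (xs' i) y \<and> j < i}"
    if "i \<in> {1..n}" for i
    using assms that by auto
  then show ?thesis unfolding nearest_def by (intro Collect_cong conj_cong refl) (simp only:)
qed

context nn_sample
begin

lemma integral_cball_indicator:
  "(LINT u|lborel. indicator (cball (0::real^'p) r) u * 1) = measure lborel (cball (0::real^'p) r)"
  by simp

definition unit_ball_mean :: "(real ^ 'p \<Rightarrow> real) \<Rightarrow> real" where
  "unit_ball_mean g = (LINT u|lborel. indicator (cball 0 1) u * g u) / vol_ball TYPE('p)"

text \<open>The factor 1 keeps the integrand in the form of \<open>kernel_truncate\<close>.\<close>

definition ball_count :: "real \<Rightarrow> nat \<Rightarrow> 'w \<Rightarrow> real" where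
  "ball_count r = kernel_avg (\<lambda>u. indicator (cball 0 r) u * 1)"

lemma ball_count_eq: "ball_count r n \<omega> = (\<Sum>i\<in>{1..n}. of_bool (norm (U n i \<omega>) \<le> r)) / real (k n)"
  by (simp add: ball_count_def kernel_avg_def indicator_def)

lemma ball_count_meas [measurable]: "ball_count r n \<in> borel_measurable M"
  unfolding ball_count_def by measurable

lemma ball_count_limit:
  "(LINT u|lborel. indicator (cball (0::real^'p) r) u * 1) / vol_ball TYPE('p) = r ^ CARD('p)" if "r \<ge> 0" for r
proof -
  have "unit_ball_vol (real CARD('p)) \<noteq> 0"
    by (metis less_irrefl of_nat_0_le_iff unit_ball_vol_pos)
  then show ?thesis
    using that content_cball[of r "0::real^'p"] content_cball[of 1 "0::real^'p"]
    unfolding integral_cball_indicator by (simp add: vol_ball_def)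
qed

lemma kernel_ball: "r \<le> 2 \<Longrightarrow> kernel (\<lambda>u. indicator (cball 0 r) u * 1)"
  by (rule kernel_truncate[of _ 1]) auto

lemma ball_count_L2:
  assumes "0 \<le> r" "r \<le> 2"
  shows "(\<lambda>n. expectation (\<lambda>\<omega>. (ball_count r n \<omega> - r ^ CARD('p))\<^sup>2)) \<longlonglongrightarrow> 0"
  using kernel_avg_tendsto_L2[OF kernel_ball[OF assms(2)]]
  unfolding ball_count_def ball_count_limit[OF assms(1)] .

lemma kernel_avg_whp:
  assumes "kernel g" "e > 0"
  shows "whp M (\<lambda>n \<omega>. \<bar>kernel_avg g n \<omega> - (LINT u|lborel. g u) / vol_ball TYPE('p)\<bar> \<le> e)"
  using kernel_meas[OF assms(1)]
  by (intro whp_second_moment integrable_kernel_avg kernel_avg_tendsto_L2 assms) auto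

lemma ball_count_whp:
  assumes "0 \<le> r" "r \<le> 2" "e > 0"
  shows "whp M (\<lambda>n \<omega>. \<bar>ball_count r n \<omega> - r ^ CARD('p)\<bar> \<le> e)"
  using kernel_avg_whp[OF kernel_ball[OF assms(2)] assms(3)]
  unfolding ball_count_def ball_count_limit[OF assms(1)] .

section \<open>From the ball of radius \<open>\<tau>\<close> to the nearest neighbours\<close>

definition nbh :: "nat \<Rightarrow> 'w \<Rightarrow> nat set" where
  "nbh n \<omega> = nearest n (k n) (\<lambda>i. Xs i \<omega>) x"

lemma nbh_finite [simp]: "finite (nbh n \<omega>)" and nbh_subset: "nbh n \<omega> \<subseteq> {1..n}"
  unfolding nbh_def by (rule finite_nearest nearest_subset)+

lemma card_nbh: "n \<ge> 1 \<Longrightarrow> card (nbh n \<omega>) = k n"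
  unfolding nbh_def using k_range[of n] by (intro card_nearest) auto

lemma norm_U_le: "n \<ge> 1 \<Longrightarrow> norm (U n i \<omega>) \<le> r \<longleftrightarrow> dist (Xs i \<omega>) x \<le> r * \<tau> n"
  unfolding U_proj by (rule norm_proj_le)

lemma nbh_diff:
  assumes "n \<ge> 1"
  shows "(\<Sum>i\<in>{1..n}. \<bar>of_bool (i \<in> nbh n \<omega>) - of_bool (norm (U n i \<omega>) \<le> 1)\<bar>) / real (k n) =
    \<bar>ball_count 1 n \<omega> - 1\<bar>"
proof -
  have "(\<Sum>i\<in>{1..n}. \<bar>of_bool (i \<in> nbh n \<omega>) - of_bool (norm (U n i \<omega>) \<le> 1)\<bar>) =
     \<bar>(\<Sum>i\<in>{1..n}. of_bool (norm (U n i \<omega>) \<le> 1)) - real (k n)\<bar>"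
    unfolding norm_U_le[OF assms] nbh_def using k_range[OF assms]
    by (intro sum_abs_nearest_diff) auto
  moreover have "ball_count 1 n \<omega> - 1 = ((\<Sum>i\<in>{1..n}. of_bool (norm (U n i \<omega>) \<le> 1)) - real (k n)) / real (k n)"
    using k_pos[OF assms] by (simp add: ball_count_eq diff_divide_distrib)
  ultimately show ?thesis by (simp only: abs_divide abs_of_nat)
qed

text \<open>In units of \<open>k\<close> the ball of radius \<open>2 * \<tau>\<close> holds about
  \<open>2 ^ p \<ge> 2\<close> points, hence at least 1 after an error of at most 1. A ball with at
  least \<open>k\<close> points contains all neighbours.\<close>

lemma whp_nbh_ball: "whp M (\<lambda>n \<omega>. n \<ge> 1 \<and> (\<forall>i\<in>nbh n \<omega>. norm (U n i \<omega>) \<le> 2))"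
proof (rule whp_mono[OF ball_count_whp[of 2 1]])
  show "\<forall>\<^sub>F n in sequentially. \<forall>\<omega>\<in>space M. \<bar>ball_count 2 n \<omega> - 2 ^ CARD('p)\<bar> \<le> 1 \<longrightarrow>
      n \<ge> 1 \<and> (\<forall>i\<in>nbh n \<omega>. norm (U n i \<omega>) \<le> 2)"
    using eventually_ge_at_top[of 1]
  proof eventually_elim
    case (elim n)
    show ?case
    proof (intro ballI impI conjI)
      fix \<omega> assume "\<bar>ball_count 2 n \<omega> - 2 ^ CARD('p)\<bar> \<le> 1"
      moreover have "(2::real) \<le> 2 ^ CARD('p)" using self_le_power[of "2::real" "CARD('p)"] by simp
      ultimately have "ball_count 2 n \<omega> \<ge> 1" by linarith
      then have "real (k n) \<le> (\<Sum>i\<in>{1..n}. of_bool (norm (U n i \<omega>) \<le> 2))"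
        using k_pos[OF elim] by (simp add: ball_count_eq le_divide_eq)
      also have "\<dots> = real (card {i \<in> {1..n}. dist (Xs i \<omega>) x \<le> 2 * \<tau> n})"
        unfolding norm_U_le[OF elim] of_bool_def by (simp add: sum.If_cases Int_def)
      finally have "nbh n \<omega> \<subseteq> {i \<in> {1..n}. dist (Xs i \<omega>) x \<le> 2 * \<tau> n}"
        unfolding nbh_def using k_range[OF elim] by (intro nearest_subset_cball) auto
      then show "\<And>i. i \<in> nbh n \<omega> \<Longrightarrow> norm (U n i \<omega>) \<le> 2"
        unfolding norm_U_le[OF elim] by blast
    qed (rule elim)
  qed
qed auto

text \<open>Passing from the neighbours to the ball costs at most
  \<open>C * \<bar>ball_count 1 n \<omega> - 1\<bar>\<close>: the indices in only one of the two
  sets still lie within radius 2, where \<open>g\<close> is bounded by \<open>C\<close>.\<close>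

lemma nbh_average:
  assumes gm [measurable]: "g \<in> borel_measurable borel" and gC: "\<And>u. norm u \<le> 2 \<Longrightarrow> \<bar>g u\<bar> \<le> C" and "e > 0"
  shows "whp M (\<lambda>n \<omega>. \<bar>(\<Sum>i\<in>nbh n \<omega>. g (U n i \<omega>)) / real (k n) - unit_ball_mean g\<bar> \<le> e)"
proof -
  have C0: "C \<ge> 0" using gC[of 0] by simp
  let ?g1 = "\<lambda>u. indicator (cball 0 1) u * g u"
  have "whp M (\<lambda>n \<omega>. (n \<ge> 1 \<and> (\<forall>i\<in>nbh n \<omega>. norm (U n i \<omega>) \<le> 2)) \<and>
     \<bar>ball_count 1 n \<omega> - 1 ^ CARD('p)\<bar> \<le> e / (2 * (C + 1)) \<and>
     \<bar>kernel_avg ?g1 n \<omega> - (LINT u|lborel. ?g1 u) / vol_ball TYPE('p)\<bar> \<le> e / 2)"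
    using C0 \<open>e > 0\<close> by (intro whp_conj whp_nbh_ball ball_count_whp kernel_avg_whp kernel_truncate[of _ C] gC gm) auto
  then show ?thesis
  proof (rule whp_mono, intro always_eventually allI ballI impI, elim conjE)
    fix n \<omega>
    assume n: "n \<ge> 1" and near: "\<forall>i\<in>nbh n \<omega>. norm (U n i \<omega>) \<le> 2"
      and cnt: "\<bar>ball_count 1 n \<omega> - 1 ^ CARD('p)\<bar> \<le> e / (2 * (C + 1))"
      and avg: "\<bar>kernel_avg ?g1 n \<omega> - (LINT u|lborel. ?g1 u) / vol_ball TYPE('p)\<bar> \<le> e / 2"
    let ?d = "\<lambda>i. of_bool (i \<in> nbh n \<omega>) - of_bool (norm (U n i \<omega>) \<le> 1) :: real"
    have "(\<Sum>i\<in>nbh n \<omega>. g (U n i \<omega>)) = (\<Sum>i\<in>{1..n}. of_bool (i \<in> nbh n \<omega>) * g (U n i \<omega>))"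
      using nbh_subset[of n \<omega>] by (intro sum.mono_neutral_cong_left) auto
    then have eq: "(\<Sum>i\<in>nbh n \<omega>. g (U n i \<omega>)) / real (k n) - kernel_avg ?g1 n \<omega> =
       (\<Sum>i\<in>{1..n}. ?d i * g (U n i \<omega>)) / real (k n)"
      unfolding kernel_avg_def indicator_cball_0
      by (simp only: diff_divide_distrib[symmetric] sum_subtractf[symmetric] left_diff_distrib)
    have "\<bar>(\<Sum>i\<in>{1..n}. ?d i * g (U n i \<omega>)) / real (k n)\<bar> \<le> (\<Sum>i\<in>{1..n}. \<bar>?d i\<bar> * C) / real (k n)"
      unfolding abs_divide abs_of_nat
    proof (intro divide_right_mono order_trans[OF sum_abs] sum_mono)
      fix i assume "i \<in> {1..n}"
      show "\<bar>?d i * g (U n i \<omega>)\<bar> \<le> \<bar>?d i\<bar> * C"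
      proof (cases "norm (U n i \<omega>) \<le> 2")
        case True
        then show ?thesis unfolding abs_mult using gC by (intro mult_left_mono) auto
      next
        case False
        then have "i \<notin> nbh n \<omega>" "\<not> norm (U n i \<omega>) \<le> 1" using near by auto
        then show ?thesis by simp
      qed
    qed simp
    also have "\<dots> = C * ((\<Sum>i\<in>{1..n}. \<bar>?d i\<bar>) / real (k n))" 
      by (simp only: sum_distrib_right[symmetric] times_divide_eq_right times_divide_eq_left mult.commute[of C])
    also have "\<dots> = C * \<bar>ball_count 1 n \<omega> - 1\<bar>" by (simp only: nbh_diff[OF n])
    also have "\<dots> \<le> C * (e / (2 * (C + 1)))" using cnt C0 by (intro mult_left_mono) auto
    also have "\<dots> \<le> (C + 1) * (e / (2 * (C + 1)))" using C0 \<open>e > 0\<close> by (intro mult_right_mono) auto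
    also have "\<dots> = e / 2"
    proof -
      have "D * (e / (2 * D)) = e / 2" if "D > 0" for D using that by simp
      from this[of "C + 1"] show ?thesis using C0 by linarith
    qed
    finally show "\<bar>(\<Sum>i\<in>nbh n \<omega>. g (U n i \<omega>)) / real (k n) - unit_ball_mean g\<bar> \<le> e"
      using avg unfolding unit_ball_mean_def eq[symmetric] by linarith
  qed
qed

definition ball_noise :: "(real ^ 'p \<Rightarrow> real) \<Rightarrow> nat \<Rightarrow> 'w \<Rightarrow> real" where
  "ball_noise g n \<omega> = (\<Sum>i\<in>{1..n}. (Ys i \<omega> - \<pi> (Xs i \<omega>)) * (indicator (cball 0 1) (U n i \<omega>) * g (U n i \<omega>))) / sqrt (real (k n))"

definition nbh_noise :: "(real ^ 'p \<Rightarrow> real) \<Rightarrow> nat \<Rightarrow> 'w \<Rightarrow> real" where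
  "nbh_noise g n \<omega> = (\<Sum>i\<in>nbh n \<omega>. (Ys i \<omega> - \<pi> (Xs i \<omega>)) * g (U n i \<omega>)) / sqrt (real (k n))"

lemma residual_square_le: "((Ys i \<omega> - \<pi> z) * t)\<^sup>2 \<le> t\<^sup>2"
proof -
  have "\<bar>(Ys i \<omega> - \<pi> z) * t\<bar> \<le> \<bar>t\<bar>"
    using mult_right_mono[OF residual_bound[of i \<omega> z], of "\<bar>t\<bar>"] by (simp add: abs_mult)
  then show ?thesis by (simp add: abs_le_square_iff)
qed

lemma ball_noise_meas [measurable (raw)]:
  assumes [measurable]: "g \<in> borel_measurable borel"
  shows "ball_noise g n \<in> borel_measurable M"
  unfolding ball_noise_def[abs_def] by measurable

text \<open>By orthogonality the second moment is a sum of individual ones, at most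
  \<open>n / k\<close> times a kernel mean. That quantity converges and is therefore bounded; the
  tightness of the score rests on it.\<close>

lemma ball_noise_second_moment:
  assumes gm [measurable]: "g \<in> borel_measurable borel" and gC: "\<And>u. norm u \<le> 2 \<Longrightarrow> \<bar>g u\<bar> \<le> C"
  shows "integrable M (\<lambda>\<omega>. (ball_noise g n \<omega>)\<^sup>2)"
    and "\<exists>B. \<forall>n. expectation (\<lambda>\<omega>. (ball_noise g n \<omega>)\<^sup>2) \<le> B"
proof -
  have C0: "C \<ge> 0" using gC[of 0] by simp
  define q where "q u = indicator (cball 0 1) u * g u" for u
  have qm [measurable]: "q \<in> borel_measurable borel" unfolding q_def[abs_def] by measurable
  have qC: "\<bar>q u\<bar> \<le> C" for u using gC[of u] C0 by (auto simp: q_def indicator_def)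
  define H where "H n i zs = q (proj n (zs i))" for n :: nat and i :: nat and zs :: "nat \<Rightarrow> real ^ 'p"
  have comp: "(\<lambda>w. H n i (\<lambda>j. snd (w j))) \<in> borel_measurable (PiM {1..n} (\<lambda>_. borel :: (real \<times> (real ^ 'p)) measure))"
    if "i \<in> {1..n}" for i n
    unfolding H_def by (rule measurable_component_compose[OF that, of "\<lambda>z. q (proj n (snd z))"]) (simp add: borel_prod[symmetric])
  have upd: "(\<lambda>z. H n i (zs(j := z))) \<in> borel_measurable borel" for n i zs j
    unfolding H_def by (cases "i = j") auto
  note orth = residual_orthogonal[of n "H n" C for n, OF comp upd]
  define Z where "Z n i \<omega> = (Ys i \<omega> - \<pi> (Xs i \<omega>)) * H n i (\<lambda>j. Xs j \<omega>)" for n i \<omega>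
  have Z: "integrable M (\<lambda>\<omega>. (\<Sum>i\<in>{1..n}. Z n i \<omega>)\<^sup>2)"
    "expectation (\<lambda>\<omega>. (\<Sum>i\<in>{1..n}. Z n i \<omega>)\<^sup>2) = (\<Sum>i\<in>{1..n}. expectation (\<lambda>\<omega>. (Z n i \<omega>)\<^sup>2))" for n
    unfolding Z_def by (rule orth; auto simp: H_def qC)+
  have sq: "(ball_noise g n \<omega>)\<^sup>2 = (\<Sum>i\<in>{1..n}. Z n i \<omega>)\<^sup>2 / real (k n)" for n \<omega>
    unfolding ball_noise_def Z_def H_def q_def by (simp add: power_divide U_proj)
  show "integrable M (\<lambda>\<omega>. (ball_noise g n \<omega>)\<^sup>2)" for n
    unfolding sq using Z(1) by simp
  have int_q2: "integrable M (\<lambda>\<omega>. (q (U n i \<omega>))\<^sup>2)" for n i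
    using C0 qC[of "U n i _"] by (intro integrable_bounded[of _ "C\<^sup>2"]) (auto simp flip: abs_le_square_iff)
  have le: "expectation (\<lambda>\<omega>. (ball_noise g n \<omega>)\<^sup>2) \<le> real n / real (k n) * expectation (\<lambda>\<omega>. 1 * (q (U n 1 \<omega>))\<^sup>2)" for n
  proof -
    have "expectation (\<lambda>\<omega>. (Z n i \<omega>)\<^sup>2) \<le> expectation (\<lambda>\<omega>. (q (U n 1 \<omega>))\<^sup>2)" if "i \<in> {1..n}" for i
    proof -
      have "expectation (\<lambda>\<omega>. (Z n i \<omega>)\<^sup>2) \<le> expectation (\<lambda>\<omega>. (q (U n i \<omega>))\<^sup>2)"
        unfolding Z_def H_def U_proj[symmetric]
        by (intro integral_mono' int_q2) (auto simp: residual_square_le)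
      also have "\<dots> = expectation (\<lambda>\<omega>. (q (U n 1 \<omega>))\<^sup>2)"
        using expectation_pair_eq[of i "\<lambda>z. (q (proj n (snd z)))\<^sup>2"] that
        by (simp add: U_proj borel_prod[symmetric])
      finally show ?thesis .
    qed
    then have "(\<Sum>i\<in>{1..n}. expectation (\<lambda>\<omega>. (Z n i \<omega>)\<^sup>2)) \<le> real n * expectation (\<lambda>\<omega>. (q (U n 1 \<omega>))\<^sup>2)"
      using sum_mono[of "{1..n}" "\<lambda>i. expectation (\<lambda>\<omega>. (Z n i \<omega>)\<^sup>2)" "\<lambda>_. expectation (\<lambda>\<omega>. (q (U n 1 \<omega>))\<^sup>2)"] by simp
    moreover have "expectation (\<lambda>\<omega>. (ball_noise g n \<omega>)\<^sup>2) = expectation (\<lambda>\<omega>. (\<Sum>i\<in>{1..n}. Z n i \<omega>)\<^sup>2) / real (k n)"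
      unfolding sq by (rule integral_divide_zero)
    ultimately show ?thesis unfolding Z(2) by (simp add: divide_right_mono)
  qed
  have "kernel (\<lambda>u. (q u)\<^sup>2)"
  proof (rule kernelI)
    show "\<bar>(q u)\<^sup>2\<bar> \<le> C\<^sup>2" for u using power_mono[OF qC[of u], of 2] by simp
  qed (auto simp: q_def)
  then have "(\<lambda>n. real n / real (k n) * expectation (\<lambda>\<omega>. 1 * (q (U n 1 \<omega>))\<^sup>2))
      \<longlonglongrightarrow> 1 * ((LINT u|lborel. (q u)\<^sup>2) / vol_ball TYPE('p))"
    by (intro kernel_mean_tendsto[of "\<lambda>_. 1" 1]) auto
  then have "Bseq (\<lambda>n. real n / real (k n) * expectation (\<lambda>\<omega>. 1 * (q (U n 1 \<omega>))\<^sup>2))"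
    by (intro convergent_imp_Bseq convergentI)
  then obtain B where B: "\<And>n. norm (real n / real (k n) * expectation (\<lambda>\<omega>. 1 * (q (U n 1 \<omega>))\<^sup>2)) \<le> B"
    by (rule BseqE) blast
  have "expectation (\<lambda>\<omega>. (ball_noise g n \<omega>)\<^sup>2) \<le> B" for n
    using le[of n] B[of n] unfolding real_norm_def by linarith
  then show "\<exists>B. \<forall>n. expectation (\<lambda>\<omega>. (ball_noise g n \<omega>)\<^sup>2) \<le> B" by blast
qed

end

section \<open>Central limit theorem for the score\<close>

lemma (in prob_space) expectation_abs_le_sqrt:
  fixes Z :: "'a \<Rightarrow> real"
  assumes "integrable M Z" "integrable M (\<lambda>\<omega>. (Z \<omega>)\<^sup>2)"
  shows "expectation (\<lambda>\<omega>. \<bar>Z \<omega>\<bar>) \<le> sqrt (expectation (\<lambda>\<omega>. (Z \<omega>)\<^sup>2))"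
proof (rule real_le_rsqrt)
  have "0 \<le> variance (\<lambda>\<omega>. \<bar>Z \<omega>\<bar>)" by (rule variance_positive)
  also have "\<dots> = expectation (\<lambda>\<omega>. \<bar>Z \<omega>\<bar>\<^sup>2) - (expectation (\<lambda>\<omega>. \<bar>Z \<omega>\<bar>))\<^sup>2"
    using assms by (intro variance_eq) auto
  finally show "(expectation (\<lambda>\<omega>. \<bar>Z \<omega>\<bar>))\<^sup>2 \<le> expectation (\<lambda>\<omega>. (Z \<omega>)\<^sup>2)" by simp
qed

context nn_sample
begin

text \<open>Bounding the difference term by term would give o(k) terms over \<open>sqrt k\<close>,
  which need not vanish. Orthogonality with weights depending on the design bounds its second moment
  by \<open>C\<^sup>2\<close> times the mean of
  \<open>\<bar>ball_count 1 n \<omega> - 1\<bar>\<close>, and this tends to 0.\<close>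

lemma nbh_noise_close:
  assumes gm [measurable]: "g \<in> borel_measurable borel" and gC: "\<And>u. norm u \<le> 2 \<Longrightarrow> \<bar>g u\<bar> \<le> C" and "e > 0"
  shows "whp M (\<lambda>n \<omega>. \<bar>nbh_noise g n \<omega> - ball_noise g n \<omega>\<bar> \<le> e)"
proof -
  have C0: "C \<ge> 0" using gC[of 0] by simp
  \<comment> \<open>Truncation at radius 2 gives a globally bounded weight, as orthogonality
    demands; it changes nothing on the event that all neighbours lie within this radius.\<close>
  define q where "q u = indicator (cball 0 2) u * g u" for u
  have qm [measurable]: "q \<in> borel_measurable borel" unfolding q_def[abs_def] by measurable
  have qC: "\<bar>q u\<bar> \<le> C" for u using gC[of u] C0 by (auto simp: q_def indicator_def)
  define s where "s n i zs = of_bool (i \<in> nearest n (k n) zs x) - (of_bool (norm (proj n (zs i)) \<le> 1) :: real)"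
    for n i :: nat and zs :: "nat \<Rightarrow> real ^ 'p"
  define H where "H n i zs = s n i zs * q (proj n (zs i))" for n i :: nat and zs :: "nat \<Rightarrow> real ^ 'p"
  have s_le: "\<bar>s n i zs\<bar> \<le> 1" for n i zs by (simp add: s_def)
  have s_meas: "(\<lambda>z. H n i (\<lambda>j. Z j z)) \<in> borel_measurable N"
    if i: "i \<in> {1..n}" and Z: "\<And>j. j \<in> {1..n} \<Longrightarrow> Z j \<in> borel_measurable N" for n i and N :: "'b measure" and Z
  proof -
    note measurable_nearest[OF Z, measurable]
    note Z[OF i, measurable]
    show ?thesis unfolding H_def s_def by measurable
  qed
  define Z where "Z n i \<omega> = (Ys i \<omega> - \<pi> (Xs i \<omega>)) * H n i (\<lambda>j. Xs j \<omega>)" for n i \<omega>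
  have H_le: "\<bar>H n i zs\<bar> \<le> C" for n i zs
    using mult_mono[OF s_le qC] by (simp add: H_def abs_mult)
  have H1: "(\<lambda>w. H n i (\<lambda>j. snd (w j))) \<in> borel_measurable (PiM {1..n} (\<lambda>_. borel :: (real \<times> (real ^ 'p)) measure))"
    if "i \<in> {1..n}" for i n
    using that by (intro s_meas measurable_component_compose) (auto simp: borel_prod[symmetric])
  have H2: "(\<lambda>z. H n i (zs(j := z))) \<in> borel_measurable borel" if "i \<in> {1..n}" for n i zs j
  proof (rule s_meas[OF that])
    show "(\<lambda>z. (zs(j := z)) l) \<in> borel_measurable borel" for l by (cases "l = j") auto
  qed
  have H3: "(\<lambda>\<omega>. H n i (\<lambda>j. Xs j \<omega>)) \<in> borel_measurable M" if "i \<in> {1..n}" for n i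
    by (rule s_meas[OF that]) simp
  have H5: "H n i zs = H n i zs'" if "i \<in> {1..n}" "\<And>j. j \<in> {1..n} \<Longrightarrow> zs j = zs' j" for n i zs zs'
    unfolding H_def s_def using nearest_cong[of n zs zs' "k n" x] that by simp
  note orth = residual_orthogonal[of n "H n" C for n, OF H1 H2 H3 H_le H5, folded Z_def]
  define D where "D n \<omega> = (\<Sum>i\<in>{1..n}. Z n i \<omega>) / sqrt (real (k n))" for n \<omega>
  have Zm: "Z n i \<in> borel_measurable M" if "i \<in> {1..n}" for n i
    unfolding Z_def[abs_def] using H3[OF that] by measurable
  have Dm: "D n \<in> borel_measurable M" for n
    unfolding D_def[abs_def] using Zm by (intro borel_measurable_divide borel_measurable_sum) auto
  have sq: "(D n \<omega>)\<^sup>2 = (\<Sum>i\<in>{1..n}. Z n i \<omega>)\<^sup>2 / real (k n)" for n \<omega>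
    unfolding D_def by (simp add: power_divide)
  have D_int: "integrable M (\<lambda>\<omega>. (D n \<omega>)\<^sup>2)" for n
    unfolding sq by (rule integrable_divide_zero) (rule orth(1))
  have bc: "integrable M (\<lambda>\<omega>. (ball_count 1 n \<omega> - 1)\<^sup>2)" for n
    unfolding ball_count_def by (rule integrable_kernel_avg) (rule kernel_ball, simp)
  have bc1: "integrable M (\<lambda>\<omega>. ball_count 1 n \<omega> - 1)" for n
    by (rule square_integrable_imp_integrable[OF _ bc]) measurable
  have le: "expectation (\<lambda>\<omega>. (D n \<omega>)\<^sup>2) \<le> C\<^sup>2 * sqrt (expectation (\<lambda>\<omega>. (ball_count 1 n \<omega> - 1)\<^sup>2))" if n: "n \<ge> 1" for n
  proof -
    have Z2: "(Z n i \<omega>)\<^sup>2 \<le> C\<^sup>2 * \<bar>s n i (\<lambda>j. Xs j \<omega>)\<bar>" for i \<omega>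
    proof -
      have "(Z n i \<omega>)\<^sup>2 \<le> (H n i (\<lambda>j. Xs j \<omega>))\<^sup>2" unfolding Z_def by (rule residual_square_le)
      also have "\<dots> = (s n i (\<lambda>j. Xs j \<omega>))\<^sup>2 * (q (proj n (Xs i \<omega>)))\<^sup>2" by (simp add: H_def power_mult_distrib)
      also have "\<dots> \<le> \<bar>s n i (\<lambda>j. Xs j \<omega>)\<bar> * C\<^sup>2"
      proof (rule mult_mono)
        show "(s n i (\<lambda>j. Xs j \<omega>))\<^sup>2 \<le> \<bar>s n i (\<lambda>j. Xs j \<omega>)\<bar>" by (simp add: s_def)
        show "(q (proj n (Xs i \<omega>)))\<^sup>2 \<le> C\<^sup>2" using power_mono[OF qC[of "proj n (Xs i \<omega>)"], of 2] by simp
      qed auto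
      finally show ?thesis by (simp add: mult.commute)
    qed
    have "(\<Sum>i\<in>{1..n}. (Z n i \<omega>)\<^sup>2) / real (k n) \<le> C\<^sup>2 * \<bar>ball_count 1 n \<omega> - 1\<bar>" for \<omega>
    proof -
      have "(\<Sum>i\<in>{1..n}. (Z n i \<omega>)\<^sup>2) / real (k n) \<le> (\<Sum>i\<in>{1..n}. C\<^sup>2 * \<bar>s n i (\<lambda>j. Xs j \<omega>)\<bar>) / real (k n)"
        by (intro divide_right_mono sum_mono Z2) simp
      also have "\<dots> = C\<^sup>2 * ((\<Sum>i\<in>{1..n}. \<bar>s n i (\<lambda>j. Xs j \<omega>)\<bar>) / real (k n))"
        by (simp only: sum_distrib_left[symmetric] times_divide_eq_right)
      also have "(\<Sum>i\<in>{1..n}. \<bar>s n i (\<lambda>j. Xs j \<omega>)\<bar>) / real (k n) = \<bar>ball_count 1 n \<omega> - 1\<bar>"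
        unfolding s_def nbh_diff[OF n, symmetric] nbh_def U_proj ..
      finally show ?thesis .
    qed
    note pt = this
    have "expectation (\<lambda>\<omega>. (D n \<omega>)\<^sup>2) = (\<Sum>i\<in>{1..n}. expectation (\<lambda>\<omega>. (Z n i \<omega>)\<^sup>2)) / real (k n)"
      unfolding sq integral_divide_zero by (simp only: orth(2))
    also have "\<dots> = expectation (\<lambda>\<omega>. (\<Sum>i\<in>{1..n}. (Z n i \<omega>)\<^sup>2) / real (k n))"
    proof -
      have "integrable M (\<lambda>\<omega>. (Z n i \<omega>)\<^sup>2)" if "i \<in> {1..n}" for i
      proof (rule integrable_bounded)
        show "\<bar>(Z n i \<omega>)\<^sup>2\<bar> \<le> C\<^sup>2" for \<omega>
          using Z2[of i \<omega>] mult_left_mono[OF s_le[of n i "\<lambda>j. Xs j \<omega>"], of "C\<^sup>2"] by simp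
      qed (use Zm[OF that] in measurable)
      then show ?thesis by (simp only: integral_divide_zero Bochner_Integration.integral_sum)
    qed
    also have "\<dots> \<le> expectation (\<lambda>\<omega>. C\<^sup>2 * \<bar>ball_count 1 n \<omega> - 1\<bar>)"
      using bc1[of n] pt by (intro integral_mono') auto
    also have "\<dots> = C\<^sup>2 * expectation (\<lambda>\<omega>. \<bar>ball_count 1 n \<omega> - 1\<bar>)" by simp
    also have "\<dots> \<le> C\<^sup>2 * sqrt (expectation (\<lambda>\<omega>. (ball_count 1 n \<omega> - 1)\<^sup>2))"
      by (intro mult_left_mono expectation_abs_le_sqrt bc bc1) simp
    finally show ?thesis .
  qed
  have lim: "(\<lambda>n. C\<^sup>2 * sqrt (expectation (\<lambda>\<omega>. (ball_count 1 n \<omega> - 1)\<^sup>2))) \<longlonglongrightarrow> C\<^sup>2 * sqrt 0"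
    using ball_count_L2[of 1] by (intro tendsto_mult tendsto_const tendsto_real_sqrt) simp
  have "(\<lambda>n. expectation (\<lambda>\<omega>. (D n \<omega>)\<^sup>2)) \<longlonglongrightarrow> 0"
  proof (rule tendsto_sandwich[OF _ _ tendsto_const])
    show "\<forall>\<^sub>F n in sequentially. expectation (\<lambda>\<omega>. (D n \<omega>)\<^sup>2)
        \<le> C\<^sup>2 * sqrt (expectation (\<lambda>\<omega>. (ball_count 1 n \<omega> - 1)\<^sup>2))"
      using eventually_ge_at_top[of 1] by eventually_elim (rule le)
    show "(\<lambda>n. C\<^sup>2 * sqrt (expectation (\<lambda>\<omega>. (ball_count 1 n \<omega> - 1)\<^sup>2))) \<longlonglongrightarrow> 0"
      using lim by simp
  qed simp
  then have "whp M (\<lambda>n \<omega>. \<bar>D n \<omega>\<bar> \<le> e)"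
    by (intro whp_second_moment Dm D_int \<open>e > 0\<close>)
  from whp_conj[OF whp_nbh_ball this] show ?thesis
  proof (rule whp_mono, intro always_eventually allI ballI impI, elim conjE)
    fix n \<omega> assume n: "n \<ge> 1" and near: "\<forall>i\<in>nbh n \<omega>. norm (U n i \<omega>) \<le> 2" and D: "\<bar>D n \<omega>\<bar> \<le> e"
    have "(\<Sum>i\<in>nbh n \<omega>. (Ys i \<omega> - \<pi> (Xs i \<omega>)) * g (U n i \<omega>)) =
        (\<Sum>i\<in>{1..n}. of_bool (i \<in> nbh n \<omega>) * ((Ys i \<omega> - \<pi> (Xs i \<omega>)) * g (U n i \<omega>)))"
      using nbh_subset[of n \<omega>] by (intro sum.mono_neutral_cong_left) auto
    then have "nbh_noise g n \<omega> - ball_noise g n \<omega> =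
       (\<Sum>i\<in>{1..n}. of_bool (i \<in> nbh n \<omega>) * ((Ys i \<omega> - \<pi> (Xs i \<omega>)) * g (U n i \<omega>)) -
          (Ys i \<omega> - \<pi> (Xs i \<omega>)) * (indicator (cball 0 1) (U n i \<omega>) * g (U n i \<omega>))) / sqrt (real (k n))"
      unfolding nbh_noise_def ball_noise_def by (simp only: diff_divide_distrib[symmetric] sum_subtractf)
    also have "\<dots> = D n \<omega>"
      unfolding D_def
    proof (intro arg_cong2[of _ _ _ _ "(/)"] sum.cong refl)
      fix i assume "i \<in> {1..n}"
      show "of_bool (i \<in> nbh n \<omega>) * ((Ys i \<omega> - \<pi> (Xs i \<omega>)) * g (U n i \<omega>)) -
          (Ys i \<omega> - \<pi> (Xs i \<omega>)) * (indicator (cball 0 1) (U n i \<omega>) * g (U n i \<omega>)) = Z n i \<omega>"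
        unfolding Z_def H_def s_def q_def U_proj[symmetric] indicator_cball_0 nbh_def[symmetric]
        using near by (cases "norm (U n i \<omega>) \<le> 1"; cases "i \<in> nbh n \<omega>") auto
    qed
    finally show "\<bar>nbh_noise g n \<omega> - ball_noise g n \<omega>\<bar> \<le> e" using D by simp
  qed
qed

text \<open>For a binary response the squared residual equals \<open>\<pi> * (1 - \<pi>)\<close>
  plus the residual times \<open>1 - 2 * \<pi>\<close>, and the latter integrates to 0 against
  functions of the design.\<close>

lemma expectation_residual_square:
  assumes [measurable]: "\<psi> \<in> borel_measurable borel" and \<psi>C: "\<And>z. \<bar>\<psi> z\<bar> \<le> C" and "i \<ge> 1"
  shows "expectation (\<lambda>\<omega>. (Ys i \<omega> - \<pi> (Xs i \<omega>))\<^sup>2 * \<psi> (Xs i \<omega>)) =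
    expectation (\<lambda>\<omega>. \<pi> (Xs i \<omega>) * (1 - \<pi> (Xs i \<omega>)) * \<psi> (Xs i \<omega>))"
proof -
  have C0: "C \<ge> 0" using \<psi>C[of 0] by simp
  have p: "0 \<le> \<pi> z" "\<pi> z \<le> 1" for z using \<pi>_range[of z] by auto
  have b1: "\<bar>(1 - 2 * \<pi> z) * \<psi> z\<bar> \<le> C" for z
    using mult_mono[of "\<bar>1 - 2 * \<pi> z\<bar>" 1, OF _ \<psi>C[of z]] p[of z] by (simp add: abs_mult)
  have b2: "\<bar>\<pi> z * (1 - \<pi> z) * \<psi> z\<bar> \<le> C" for z
  proof -
    have "\<bar>\<pi> z * (1 - \<pi> z)\<bar> \<le> 1" using p[of z] unfolding abs_mult by (intro mult_le_one) auto
    then show ?thesis using mult_mono[OF _ \<psi>C[of z]] by (fastforce simp: abs_mult)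
  qed
  have "(Ys i \<omega> - \<pi> (Xs i \<omega>))\<^sup>2 = (Ys i \<omega> - \<pi> (Xs i \<omega>)) * (1 - 2 * \<pi> (Xs i \<omega>)) + \<pi> (Xs i \<omega>) * (1 - \<pi> (Xs i \<omega>))" for \<omega>
    using binary[of i \<omega>] by (auto simp: power2_eq_square algebra_simps)
  then have "expectation (\<lambda>\<omega>. (Ys i \<omega> - \<pi> (Xs i \<omega>))\<^sup>2 * \<psi> (Xs i \<omega>)) =
    expectation (\<lambda>\<omega>. (Ys i \<omega> - \<pi> (Xs i \<omega>)) * ((1 - 2 * \<pi> (Xs i \<omega>)) * \<psi> (Xs i \<omega>)) + \<pi> (Xs i \<omega>) * (1 - \<pi> (Xs i \<omega>)) * \<psi> (Xs i \<omega>))"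
    by (simp only: distrib_right mult.assoc)
  also have "\<dots> = expectation (\<lambda>\<omega>. (Ys i \<omega> - \<pi> (Xs i \<omega>)) * ((1 - 2 * \<pi> (Xs i \<omega>)) * \<psi> (Xs i \<omega>))) +
      expectation (\<lambda>\<omega>. \<pi> (Xs i \<omega>) * (1 - \<pi> (Xs i \<omega>)) * \<psi> (Xs i \<omega>))"
  proof (intro Bochner_Integration.integral_add integrable_bounded[of _ C])
    fix \<omega>
    show "\<bar>(Ys i \<omega> - \<pi> (Xs i \<omega>)) * ((1 - 2 * \<pi> (Xs i \<omega>)) * \<psi> (Xs i \<omega>))\<bar> \<le> C"
      using mult_mono[OF residual_bound[of i \<omega> "Xs i \<omega>"] b1[of "Xs i \<omega>"]] by (simp add: abs_mult)
  qed (use b2 in auto)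
  also have "expectation (\<lambda>\<omega>. (Ys i \<omega> - \<pi> (Xs i \<omega>)) * ((1 - 2 * \<pi> (Xs i \<omega>)) * \<psi> (Xs i \<omega>))) = 0"
    using regression[OF \<open>i \<ge> 1\<close>, of "\<lambda>z. (1 - 2 * \<pi> z) * \<psi> z" C] b1 by simp
  finally show ?thesis by simp
qed

text \<open>Central limit theorem for a triangular array, with summands bounded by
  \<open>C / sqrt k\<close>. It suffices to evaluate at 1, since a scalar multiple or linear
  functional of the score is again a noise of this form with another \<open>g\<close>.\<close>

lemma ball_noise_char:
  assumes gm [measurable]: "g \<in> borel_measurable borel" and gC: "\<And>u. norm u \<le> 2 \<Longrightarrow> \<bar>g u\<bar> \<le> C"
  shows "(\<lambda>n. CLINT \<omega>|M. iexp (ball_noise g n \<omega>)) \<longlonglongrightarrow>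
    exp (- complex_of_real (\<pi> x * (1 - \<pi> x) * unit_ball_mean (\<lambda>u. (g u)\<^sup>2)) / 2)"
proof -
  define S where "S = \<pi> x * (1 - \<pi> x) * unit_ball_mean (\<lambda>u. (g u)\<^sup>2)"
  have C0: "C \<ge> 0" using gC[of 0] by simp
  define q where "q u = indicator (cball 0 1) u * g u" for u
  have qm [measurable]: "q \<in> borel_measurable borel" unfolding q_def[abs_def] by measurable
  have qC: "\<bar>q u\<bar> \<le> C" for u using gC[of u] C0 by (auto simp: q_def indicator_def)
  have q2C: "(q u)\<^sup>2 \<le> C\<^sup>2" for u using power_mono[OF qC[of u], of 2] by simp
  define \<xi> where "\<xi> n z = (fst z - \<pi> (snd z)) * q (proj n (snd z)) / sqrt (real (k n))" for n and z :: "real \<times> (real ^ 'p)"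
  have \<xi>m [measurable]: "\<xi> n \<in> borel_measurable borel" for n
    unfolding \<xi>_def[abs_def] by (simp add: borel_prod[symmetric])
  define \<Xi> where "\<Xi> n i \<omega> = \<xi> n (Ys i \<omega>, Xs i \<omega>)" for n i \<omega>
  have \<Xi>m [measurable]: "\<Xi> n i \<in> borel_measurable M" for n i unfolding \<Xi>_def[abs_def] by measurable
  define \<phi> where "\<phi> n = char (distr M borel (\<Xi> n 1)) 1" for n
  define \<sigma> where "\<sigma> n = expectation (\<lambda>\<omega>. (\<Xi> n 1 \<omega>)\<^sup>2)" for n
  have \<Xi>_le: "\<bar>\<Xi> n i \<omega>\<bar> \<le> C / sqrt (real (k n))" for n i \<omega>
  proof -
    have "\<bar>Ys i \<omega> - \<pi> (Xs i \<omega>)\<bar> * \<bar>q (proj n (Xs i \<omega>))\<bar> \<le> 1 * C"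
      by (intro mult_mono residual_bound qC) auto
    then show ?thesis by (simp add: \<Xi>_def \<xi>_def abs_mult abs_divide divide_right_mono)
  qed
  have int1: "integrable M (\<Xi> n i)" for n i
    by (intro integrable_bounded[of _ "C / sqrt (real (k n))"] \<Xi>_le) simp
  have int2: "integrable M (\<lambda>\<omega>. (\<Xi> n i \<omega>)\<^sup>2)" for n i
  proof (rule integrable_bounded)
    show "\<bar>(\<Xi> n i \<omega>)\<^sup>2\<bar> \<le> (C / sqrt (real (k n)))\<^sup>2" for \<omega>
      using power_mono[OF \<Xi>_le[of n i \<omega>], of 2] by simp
  qed simp
  have mean0: "expectation (\<Xi> n 1) = 0" for n
  proof -
    have "expectation (\<lambda>\<omega>. (Ys 1 \<omega> - \<pi> (Xs 1 \<omega>)) * (q (proj n (Xs 1 \<omega>)) / sqrt (real (k n)))) = 0"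
    proof (rule regression[of 1 "\<lambda>z. q (proj n z) / sqrt (real (k n))"])
      show "\<bar>q (proj n z) / sqrt (real (k n))\<bar> \<le> C / sqrt (real (k n))" for z
        using qC by (simp add: abs_divide divide_right_mono)
    qed auto
    then show ?thesis by (simp add: \<Xi>_def[abs_def] \<xi>_def)
  qed
  have char_eq: "(CLINT \<omega>|M. iexp (ball_noise g n \<omega>)) = \<phi> n ^ n" for n
  proof -
    have "ball_noise g n \<omega> = (\<Sum>i\<in>{1..n}. \<Xi> n i \<omega>)" for \<omega>
      unfolding ball_noise_def \<Xi>_def \<xi>_def q_def U_proj by (simp only: fst_conv snd_conv sum_divide_distrib)
    then have "(CLINT \<omega>|M. iexp (ball_noise g n \<omega>)) = char (distr M borel (\<lambda>\<omega>. \<Sum>i\<in>{1..n}. \<Xi> n i \<omega>)) 1"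
      unfolding char_def by (subst integral_distr) auto
    also have "\<dots> = (\<Prod>i\<in>{1..n}. char (distr M borel (\<Xi> n i)) 1)"
    proof (rule char_distr_sum)
      show "indep_vars (\<lambda>_. borel) (\<Xi> n) {1..n}"
        unfolding \<Xi>_def[abs_def]
        by (rule indep_vars_compose2[where X = "\<lambda>i \<omega>. (Ys i \<omega>, Xs i \<omega>)" and Y = "\<lambda>_. \<xi> n", OF indep_vars_subset[OF indep]]) auto
    qed
    also have "\<dots> = (\<Prod>i\<in>{1..n}. \<phi> n)"
    proof (rule prod.cong[OF refl])
      fix i assume i: "i \<in> {1..n}"
      have "distr M borel (\<Xi> n j) = distr \<nu> borel (\<xi> n)" if "j \<ge> 1" for j
        unfolding law[OF that, symmetric] by (subst distr_distr) (auto simp: o_def \<Xi>_def[abs_def])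
      then show "char (distr M borel (\<Xi> n i)) 1 = \<phi> n" using i by (simp add: \<phi>_def)
    qed
    finally show ?thesis by simp
  qed
  have k2: "kernel (\<lambda>u. (q u)\<^sup>2)"
    by (rule kernelI[of _ "C\<^sup>2"]) (auto simp: q2C, simp add: q_def)
  have "(\<lambda>n. real n / real (k n) * expectation (\<lambda>\<omega>. (\<pi> (Xs 1 \<omega>) * (1 - \<pi> (Xs 1 \<omega>))) * (q (U n 1 \<omega>))\<^sup>2))
     \<longlonglongrightarrow> (\<pi> x * (1 - \<pi> x)) * ((LINT u|lborel. (q u)\<^sup>2) / vol_ball TYPE('p))"
  proof (rule kernel_mean_tendsto[of "\<lambda>z. \<pi> z * (1 - \<pi> z)" 1, OF _ _ _ k2])
    show "\<bar>\<pi> z * (1 - \<pi> z)\<bar> \<le> 1" for z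
      using \<pi>_range[of z] unfolding abs_mult by (intro mult_le_one) auto
    show "isCont (\<lambda>z. \<pi> z * (1 - \<pi> z)) x" using \<pi>_cont by (intro continuous_intros)
  qed measurable
  moreover have "real n / real (k n) * expectation (\<lambda>\<omega>. (\<pi> (Xs 1 \<omega>) * (1 - \<pi> (Xs 1 \<omega>))) * (q (U n 1 \<omega>))\<^sup>2) = real n * \<sigma> n" for n
  proof -
    have "expectation (\<lambda>\<omega>. (Ys 1 \<omega> - \<pi> (Xs 1 \<omega>))\<^sup>2 * (q (proj n (Xs 1 \<omega>)))\<^sup>2) =
      expectation (\<lambda>\<omega>. \<pi> (Xs 1 \<omega>) * (1 - \<pi> (Xs 1 \<omega>)) * (q (proj n (Xs 1 \<omega>)))\<^sup>2)"
      using q2C by (intro expectation_residual_square[of "\<lambda>z. (q (proj n z))\<^sup>2" "C\<^sup>2"]) auto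
    moreover have "\<sigma> n = expectation (\<lambda>\<omega>. (Ys 1 \<omega> - \<pi> (Xs 1 \<omega>))\<^sup>2 * (q (proj n (Xs 1 \<omega>)))\<^sup>2) / real (k n)"
      unfolding \<sigma>_def \<Xi>_def \<xi>_def by (simp add: power_mult_distrib power_divide)
    ultimately show ?thesis by (simp add: U_proj)
  qed
  moreover have "(LINT u|lborel. (q u)\<^sup>2) / vol_ball TYPE('p) = unit_ball_mean (\<lambda>u. (g u)\<^sup>2)"
  proof -
    have "(q u)\<^sup>2 = indicator (cball 0 1) u * (g u)\<^sup>2" for u by (cases "u \<in> cball 0 1") (simp_all add: q_def)
    then show ?thesis by (simp only: unit_ball_mean_def)
  qed
  ultimately have n\<sigma>: "(\<lambda>n. real n * \<sigma> n) \<longlonglongrightarrow> S" by (simp add: S_def)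
  have \<sigma>0: "\<sigma> n \<ge> 0" for n by (simp add: \<sigma>_def)
  have S0: "S \<ge> 0" by (rule LIMSEQ_le_const[OF n\<sigma>]) (auto simp: \<sigma>0)
  have \<phi>_close: "cmod (\<phi> n - (1 - \<sigma> n / 2)) \<le> C / sqrt (real (k n)) * \<sigma> n" for n
  proof -
    have "cmod (\<phi> n - (1 - 1\<^sup>2 * \<sigma> n / 2)) \<le>
        (1\<^sup>2 / 6) * expectation (\<lambda>\<omega>. min (6 * (\<Xi> n 1 \<omega>)\<^sup>2) (\<bar>1\<bar> * \<bar>\<Xi> n 1 \<omega>\<bar> ^ 3))"
      unfolding \<phi>_def
      by (rule char_approx3') (use int1 int2 mean0 in \<open>auto simp: \<sigma>_def\<close>)
    also have "\<dots> \<le> (1\<^sup>2 / 6) * expectation (\<lambda>\<omega>. C / sqrt (real (k n)) * (\<Xi> n 1 \<omega>)\<^sup>2)"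
    proof (intro mult_left_mono integral_mono')
      fix \<omega>
      have "\<bar>\<Xi> n 1 \<omega>\<bar> ^ 3 = \<bar>\<Xi> n 1 \<omega>\<bar> * (\<Xi> n 1 \<omega>)\<^sup>2" 
        using power2_abs[of "\<Xi> n 1 \<omega>"] by (simp only: power3_eq_cube power2_eq_square mult.assoc)
      also have "\<dots> \<le> C / sqrt (real (k n)) * (\<Xi> n 1 \<omega>)\<^sup>2" by (intro mult_right_mono \<Xi>_le) simp
      finally show "min (6 * (\<Xi> n 1 \<omega>)\<^sup>2) (\<bar>1\<bar> * \<bar>\<Xi> n 1 \<omega>\<bar> ^ 3) \<le> C / sqrt (real (k n)) * (\<Xi> n 1 \<omega>)\<^sup>2"
        by simp
    qed (use int2[of n 1] C0 in auto)
    also have "\<dots> = 1 / 6 * (C / sqrt (real (k n)) * \<sigma> n)" by (simp add: \<sigma>_def)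
    also have "\<dots> \<le> C / sqrt (real (k n)) * \<sigma> n"
      using C0 \<sigma>0[of n] by (intro mult_left_le_one_le) auto
    finally show ?thesis by simp
  qed
  have \<phi>1: "cmod (\<phi> n) \<le> 1" for n
    unfolding \<phi>_def by (intro real_distribution.cmod_char_le_1 real_distribution_distr) simp
  \<comment> \<open>The power \<open>\<phi> n ^ n\<close> is compared with \<open>a n ^ n\<close>
    and then with \<open>b n ^ n\<close>, which converges to the Gaussian value. For numbers in the
    unit disc, nth powers differ by at most n times the difference of the bases; this is why all
    three must eventually have modulus at most 1.\<close>
  define a where "a n = complex_of_real (1 - \<sigma> n / 2)" for n
  define b where "b n = complex_of_real (1 + (- S / 2) / real n)" for n
  have "(\<lambda>n. 1 / real n * (real n * \<sigma> n)) \<longlonglongrightarrow> 0"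
    using tendsto_mult[OF lim_1_over_n n\<sigma>] by simp
  then have "\<sigma> \<longlonglongrightarrow> 0"
  proof (rule Lim_transform_eventually)
    show "\<forall>\<^sub>F n in sequentially. 1 / real n * (real n * \<sigma> n) = \<sigma> n"
      using eventually_gt_at_top[of 0] by eventually_elim simp
  qed
  then have "\<forall>\<^sub>F n in sequentially. \<sigma> n < 2" by (rule order_tendstoD) simp
  then have a1: "\<forall>\<^sub>F n in sequentially. cmod (a n) \<le> 1"
    by eventually_elim (use \<sigma>0 in \<open>auto simp: a_def abs_le_iff simp del: of_real_diff of_real_divide\<close>)
  have "(\<lambda>n. S * (1 / real n)) \<longlonglongrightarrow> S * 0" by (intro tendsto_mult tendsto_const lim_1_over_n)
  then have "\<forall>\<^sub>F n in sequentially. S * (1 / real n) < 2" by (rule order_tendstoD) simp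
  then have b1: "\<forall>\<^sub>F n in sequentially. cmod (b n) \<le> 1"
    by eventually_elim (use S0 in \<open>auto simp: b_def abs_le_iff simp del: of_real_diff of_real_divide of_real_add\<close>)
  have sqk: "(\<lambda>n. C / sqrt (real (k n))) \<longlonglongrightarrow> 0"
    using tendsto_mult[OF tendsto_const[of C] tendsto_real_sqrt[OF inverse_k_lim]] by (simp add: real_sqrt_divide)
  have lim1: "(\<lambda>n. \<phi> n ^ n - a n ^ n) \<longlonglongrightarrow> 0"
  proof (rule tendsto_norm_zero_cancel, rule tendsto_sandwich[OF _ _ tendsto_const])
    show "\<forall>\<^sub>F n in sequentially. cmod (\<phi> n ^ n - a n ^ n) \<le> C / sqrt (real (k n)) * (real n * \<sigma> n)"
      using a1
    proof eventually_elim
      case (elim n)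
      have "cmod (\<phi> n ^ n - a n ^ n) \<le> real n * cmod (\<phi> n - a n)"
        by (rule norm_power_diff[OF \<phi>1 elim])
      also have "\<dots> \<le> real n * (C / sqrt (real (k n)) * \<sigma> n)"
        using \<phi>_close[of n] by (intro mult_left_mono) (auto simp: a_def)
      finally show ?case by (simp add: mult_ac)
    qed
    show "(\<lambda>n. C / sqrt (real (k n)) * (real n * \<sigma> n)) \<longlonglongrightarrow> 0"
      using tendsto_mult[OF sqk n\<sigma>] by simp
  qed auto
  have lim2: "(\<lambda>n. a n ^ n - b n ^ n) \<longlonglongrightarrow> 0"
  proof (rule tendsto_norm_zero_cancel, rule tendsto_sandwich[OF _ _ tendsto_const])
    show "\<forall>\<^sub>F n in sequentially. cmod (a n ^ n - b n ^ n) \<le> \<bar>real n * \<sigma> n - S\<bar>"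
      using a1 b1 eventually_gt_at_top[of 0]
    proof eventually_elim
      case (elim n)
      have "cmod (a n ^ n - b n ^ n) \<le> real n * cmod (a n - b n)"
        by (rule norm_power_diff[OF elim(1,2)])
      also have "a n - b n = complex_of_real ((S / real n - \<sigma> n) / 2)"
        by (simp add: a_def b_def diff_divide_distrib)
      also have "real n * cmod \<dots> = \<bar>real n * ((S / real n - \<sigma> n) / 2)\<bar>"
        unfolding norm_of_real by (simp add: abs_mult)
      also have "real n * ((S / real n - \<sigma> n) / 2) = (S - real n * \<sigma> n) / 2"
        using elim(3) by (simp add: field_simps)
      also have "\<bar>\<dots>\<bar> \<le> \<bar>real n * \<sigma> n - S\<bar>"
        by (simp only: abs_divide abs_minus_commute[of S]) simp
      finally show ?case .
    qed
    show "(\<lambda>n. \<bar>real n * \<sigma> n - S\<bar>) \<longlonglongrightarrow> 0"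
      using tendsto_rabs[OF tendsto_diff[OF n\<sigma> tendsto_const[of S]]] by simp
  qed auto
  have lim3: "(\<lambda>n. b n ^ n) \<longlonglongrightarrow> complex_of_real (exp (- S / 2))"
    unfolding b_def of_real_power[symmetric] by (intro tendsto_of_real tendsto_exp_limit_sequentially)
  have "(\<lambda>n. (\<phi> n ^ n - a n ^ n) + (a n ^ n - b n ^ n) + b n ^ n) \<longlonglongrightarrow> 0 + 0 + complex_of_real (exp (- S / 2))"
    by (intro tendsto_add lim1 lim2 lim3)
  moreover have "complex_of_real (exp (- S / 2)) = exp (- complex_of_real S / 2)"
    by (simp flip: exp_of_real)
  ultimately show ?thesis unfolding char_eq S_def[symmetric] by simp
qed

end

section \<open>Bias and normalization\<close>

lemma inner_pair_Basis_bound: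
  fixes b :: "real \<times> (real ^ 'p)"
  assumes "b \<in> Basis" "norm v \<le> 2"
  shows "\<bar>(1, v) \<bullet> b\<bar> \<le> 3"
proof -
  have "\<bar>(1, v) \<bullet> b\<bar> \<le> norm (1::real, v)" by (rule Basis_le_norm[OF assms(1)])
  also have "\<dots> \<le> norm (1::real) + norm v" by (rule norm_Pair_le)
  finally show ?thesis using assms(2) by simp
qed

lemma filterlim_powr_at_top:
  assumes "r > 0"
  shows "filterlim (\<lambda>t::real. t powr r) at_top at_top"
  unfolding filterlim_at_top
proof
  fix Z :: real
  show "\<forall>\<^sub>F t in at_top. Z \<le> t powr r"
    using eventually_ge_at_top[of "max Z 1 powr (1 / r)"]
  proof eventually_elim
    case (elim t)
    have "Z \<le> (max Z 1 powr (1 / r)) powr r" using assms by (simp add: powr_powr)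
    also have "\<dots> \<le> t powr r" using elim assms by (intro powr_mono2) auto
    finally show ?case .
  qed
qed

context nn_sample
begin

definition admissible :: "(real ^ 'p \<Rightarrow> real) \<Rightarrow> bool" where
  "admissible g \<longleftrightarrow> g \<in> borel_measurable borel \<and> (\<exists>C. \<forall>u. norm u \<le> 2 \<longrightarrow> \<bar>g u\<bar> \<le> C)"

lemma admissible_continuous: "continuous_on UNIV g \<Longrightarrow> admissible g"
proof -
  assume c: "continuous_on UNIV g"
  have "compact (g ` cball 0 2)" by (intro compact_continuous_image continuous_on_subset[OF c]) auto
  then have "bounded (g ` cball 0 2)" by (rule compact_imp_bounded)
  then obtain C where "\<And>u. u \<in> cball 0 2 \<Longrightarrow> \<bar>g u\<bar> \<le> C" unfolding bounded_iff by (metis imageI real_norm_def)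
  then show "admissible g"
    using borel_measurable_continuous_onI[OF c] unfolding admissible_def by auto
qed

lemma admissible_integrable: "admissible g \<Longrightarrow> integrable lborel (\<lambda>u. indicator (cball 0 1) u * g u)"
proof -
  assume "admissible g"
  then obtain C where "g \<in> borel_measurable borel" "\<And>u. norm u \<le> 2 \<Longrightarrow> \<bar>g u\<bar> \<le> C"
    by (auto simp: admissible_def)
  then show ?thesis by (intro integrable_cball_bounded[of _ _ C]) auto
qed

lemma unit_ball_mean_const: "unit_ball_mean (\<lambda>_. a) = a"
  using V_pos by (simp add: unit_ball_mean_def vol_ball_def)

lemma unit_ball_mean_add: "admissible g \<Longrightarrow> admissible h \<Longrightarrow>
    unit_ball_mean (\<lambda>u. g u + h u) = unit_ball_mean g + unit_ball_mean h"
  unfolding unit_ball_mean_def using admissible_integrable[of g] admissible_integrable[of h]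
  by (simp add: distrib_left add_divide_distrib)

lemma unit_ball_mean_cmult: "unit_ball_mean (\<lambda>u. a * g u) = a * unit_ball_mean g"
  unfolding unit_ball_mean_def by (simp add: mult.left_commute)

lemma unit_ball_mean_sum:
  assumes "\<And>i. i \<in> I \<Longrightarrow> admissible (g i)"
  shows "unit_ball_mean (\<lambda>u. \<Sum>i\<in>I. g i u) = (\<Sum>i\<in>I. unit_ball_mean (g i))"
  unfolding unit_ball_mean_def using admissible_integrable[OF assms]
  by (simp add: sum_distrib_left sum_divide_distrib Bochner_Integration.integral_sum)

lemma unit_ball_mean_odd:
  assumes "g \<in> borel_measurable borel" "\<And>u. g (- u) = - g u"
  shows "unit_ball_mean g = 0"
  unfolding unit_ball_mean_def using ball_odd_moment[OF assms] by simp

lemma unit_ball_mean_components: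
  "unit_ball_mean (\<lambda>v. v $ i * v $ j) = (if i = j then 1 / (real CARD('p) + 2) else 0)"
proof -
  have i: "axis i 1 \<in> (Basis :: (real ^ 'p) set)" for i by (simp add: axis_in_Basis_iff)
  show ?thesis
  proof (cases "i = j")
    case True
    then show ?thesis using ball_second_moment[OF i[of j]] V_pos
      by (simp add: unit_ball_mean_def inner_axis power2_eq_square vol_ball_def)
  next
    case False
    then have "axis i (1::real) \<noteq> axis j 1" by (simp add: axis_eq_axis)
    then show ?thesis using ball_mixed_moment[OF i[of i] i[of j]] False
      by (simp add: unit_ball_mean_def inner_axis)
  qed
qed

text \<open>Mixed moments vanish and pure ones equal \<open>1 / (p + 2)\<close>, so only the trace
  survives. Applied to the Hessian it produces the Laplacian of the bias.\<close>

lemma unit_ball_mean_quadratic: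
  "unit_ball_mean (\<lambda>v. v \<bullet> (A *v v)) = trace A / (real CARD('p) + 2)"
proof -
  have eq: "v \<bullet> (A *v v) = (\<Sum>i\<in>UNIV. \<Sum>j\<in>UNIV. A $ i $ j * (v $ i * v $ j))" for v
    by (simp add: inner_vec_def matrix_vector_mult_def sum_distrib_left mult_ac)
  have adm: "admissible (\<lambda>v. A $ i $ j * (v $ i * v $ j))" "admissible (\<lambda>v. \<Sum>j\<in>UNIV. A $ i $ j * (v $ i * v $ j))" for i j
    by (intro admissible_continuous continuous_intros)+
  have "unit_ball_mean (\<lambda>v. v \<bullet> (A *v v)) = (\<Sum>i\<in>UNIV. \<Sum>j\<in>UNIV. A $ i $ j * unit_ball_mean (\<lambda>v. v $ i * v $ j))"
    unfolding eq using adm by (simp add: unit_ball_mean_sum unit_ball_mean_cmult)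
  also have "\<dots> = trace A / (real CARD('p) + 2)"
    unfolding unit_ball_mean_components trace_def
    by (simp add: if_distrib sum_divide_distrib cong: if_cong)
  finally show ?thesis .
qed

lemma unit_ball_mean_inner_square:
  "unit_ball_mean (\<lambda>v. (a \<bullet> v)\<^sup>2) = (norm a)\<^sup>2 / (real CARD('p) + 2)"
proof -
  define A where "A = (\<chi> i j. a $ i * a $ j)"
  have "v \<bullet> (A *v v) = (a \<bullet> v)\<^sup>2" for v
  proof -
    have "A *v v = (a \<bullet> v) *\<^sub>R a"
      by (simp add: A_def matrix_vector_mult_def vec_eq_iff inner_vec_def sum_distrib_left sum_distrib_right mult_ac)
    then show ?thesis by (simp add: inner_commute power2_eq_square)
  qed
  then have "unit_ball_mean (\<lambda>v. (a \<bullet> v)\<^sup>2) = trace A / (real CARD('p) + 2)"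
    using unit_ball_mean_quadratic[of A] by simp
  also have "trace A = (norm a)\<^sup>2"
    by (simp add: trace_def A_def power2_norm_eq_inner inner_vec_def)
  finally show ?thesis .
qed

lemma unit_ball_mean_affine_square:
  fixes u :: "real \<times> (real ^ 'p)"
  shows "unit_ball_mean (\<lambda>v. (u \<bullet> (1, v))\<^sup>2) = (fst u)\<^sup>2 + (norm (snd u))\<^sup>2 / (real CARD('p) + 2)"
proof -
  have "(u \<bullet> (1, v))\<^sup>2 = (fst u)\<^sup>2 + (2 * fst u * (snd u \<bullet> v) + (snd u \<bullet> v)\<^sup>2)" for v
    by (simp add: inner_prod_def power2_eq_square algebra_simps)
  then have "unit_ball_mean (\<lambda>v. (u \<bullet> (1, v))\<^sup>2) =
      unit_ball_mean (\<lambda>v. (fst u)\<^sup>2 + (2 * fst u * (snd u \<bullet> v) + (snd u \<bullet> v)\<^sup>2))" by simp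
  also have "\<dots> = unit_ball_mean (\<lambda>v. (fst u)\<^sup>2) + (unit_ball_mean (\<lambda>v. 2 * fst u * (snd u \<bullet> v)) + unit_ball_mean (\<lambda>v. (snd u \<bullet> v)\<^sup>2))"
    by (subst unit_ball_mean_add, (intro admissible_continuous continuous_intros)+,
        subst unit_ball_mean_add, (intro admissible_continuous continuous_intros)+) (rule refl)
  also have "unit_ball_mean (\<lambda>v. 2 * fst u * (snd u \<bullet> v)) = 0"
    by (rule unit_ball_mean_odd) auto
  finally show ?thesis by (simp only: unit_ball_mean_const unit_ball_mean_inner_square)
qed

text \<open>\<open>Gamma_op\<close> is \<open>\<pi> x * (1 - \<pi> x)\<close> times the second
  moment matrix of \<open>(1, v)\<close> with \<open>v\<close> uniform on the unit ball. It thus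
  arises both as limiting Hessian and as covariance of the score.\<close>

lemma inner_Gamma_op:
  fixes u :: "real \<times> (real ^ 'p)"
  shows "u \<bullet> Gamma_op \<pi> x u = \<pi> x * (1 - \<pi> x) * unit_ball_mean (\<lambda>v. (u \<bullet> (1, v))\<^sup>2)"
  unfolding unit_ball_mean_affine_square power2_norm_eq_inner
  by (simp add: Gamma_op_def case_prod_beta inner_prod_def power2_eq_square algebra_simps)

text \<open>The misfit is an even quadratic form: against the odd slope coordinates it averages to
  0, which is why the bias has no slope part, and against the intercept it gives a trace and a
  squared gradient norm.\<close>

lemma unit_ball_mean_misfit:
  assumes "b \<in> (Basis :: (real \<times> (real ^ 'p)) set)"
  shows "unit_ball_mean (\<lambda>v. misfit \<pi> x v * ((1, v) \<bullet> b)) = bias_coeff \<pi> x * ((1, 0) \<bullet> b)"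
proof -
  define r where "r = (1 - 2 * \<pi> x) / (\<pi> x * (1 - \<pi> x))"
  have cont: "continuous_on UNIV (\<lambda>v. misfit \<pi> x v)"
    unfolding misfit_def by (intro continuous_intros matrix_vector_mult_linear_continuous_on) simp
  consider "b = (1, 0)" | a where "b = (0, a)" using assms by (auto simp: Basis_prod_def)
  then show ?thesis
  proof cases
    case 1
    have aux: "1 / 2 * (T / d) + (- r / 2) * (G / d) = 1 / (2 * d) * (T - r * G)" for T d G :: real
      by (cases "d = 0") (simp_all add: field_simps)
    have "misfit \<pi> x v * ((1, v) \<bullet> b) = (1 / 2) * (v \<bullet> (hessian \<pi> x *v v)) + (- r / 2) * (gradient \<pi> x \<bullet> v)\<^sup>2" for v
      unfolding misfit_def 1 r_def[symmetric] by (simp add: field_simps)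
    then have "unit_ball_mean (\<lambda>v. misfit \<pi> x v * ((1, v) \<bullet> b)) =
      unit_ball_mean (\<lambda>v. (1 / 2) * (v \<bullet> (hessian \<pi> x *v v)) + (- r / 2) * (gradient \<pi> x \<bullet> v)\<^sup>2)" by presburger
    also have "\<dots> = unit_ball_mean (\<lambda>v. (1 / 2) * (v \<bullet> (hessian \<pi> x *v v))) + unit_ball_mean (\<lambda>v. (- r / 2) * (gradient \<pi> x \<bullet> v)\<^sup>2)"
      by (intro unit_ball_mean_add admissible_continuous continuous_intros matrix_vector_mult_linear_continuous_on)
    also have "\<dots> = bias_coeff \<pi> x"
      unfolding unit_ball_mean_cmult unit_ball_mean_quadratic unit_ball_mean_inner_square bias_coeff_def laplacian_def r_def[symmetric]
      by (rule aux)
    finally show ?thesis by (simp add: 1)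
  next
    case 2
    have "unit_ball_mean (\<lambda>v. misfit \<pi> x v * ((1, v) \<bullet> b)) = 0"
    proof (rule unit_ball_mean_odd)
      show "(\<lambda>v. misfit \<pi> x v * ((1, v) \<bullet> b)) \<in> borel_measurable borel"
        unfolding 2 by (intro borel_measurable_continuous_onI continuous_intros cont)
      show "misfit \<pi> x (- v) * ((1, - v) \<bullet> b) = - (misfit \<pi> x v * ((1, v) \<bullet> b))" for v
        using matrix_vector_mult_scaleR[of "hessian \<pi> x" "-1" v] by (simp add: 2 misfit_def)
    qed
    then show ?thesis by (simp add: 2)
  qed
qed

section \<open>The growth conditions in terms of \<open>\<tau>\<close> and \<open>k\<close>\<close>

definition rate :: "nat \<Rightarrow> real" where "rate n = \<tau> n * sqrt (real (k n))"

lemma rate_pos: "n \<ge> 1 \<Longrightarrow> rate n > 0"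
  using \<tau>_pos k_pos by (simp add: rate_def)

text \<open>The link to the hypotheses: \<open>rate n ^ p\<close> is
  \<open>k powr (1 + p / 2) / n\<close> up to the constant
  \<open>1 / (f x * vol_ball)\<close>.\<close>

lemma rate_eq:
  assumes "n \<ge> 1"
  shows "rate n = (real (k n) powr (1 + real CARD('p) / 2) / real n * (1 / (f x * vol_ball TYPE('p)))) powr (1 / real CARD('p))"
proof -
  have "rate n ^ CARD('p) = \<tau> n ^ CARD('p) * (real (k n) powr (1 / 2)) powr real CARD('p)"
    using k_pos[OF assms] by (simp add: rate_def power_mult_distrib powr_half_sqrt powr_realpow)
  also have "\<dots> = real (k n) powr (1 + real CARD('p) / 2) / real n * (1 / (f x * vol_ball TYPE('p)))"
    unfolding \<tau>_power[OF assms] using k_pos[OF assms] by (simp add: powr_powr powr_add)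
  finally have eq: "rate n ^ CARD('p) = real (k n) powr (1 + real CARD('p) / 2) / real n * (1 / (f x * vol_ball TYPE('p)))" .
  have "rate n = (rate n powr real CARD('p)) powr (1 / real CARD('p))"
    using rate_pos[OF assms] by (simp add: powr_powr)
  also have "rate n powr real CARD('p) = rate n ^ CARD('p)"
    using rate_pos[OF assms] by (rule powr_realpow)
  finally show ?thesis unfolding eq .
qed

lemma rate_at_top:
  assumes "filterlim (\<lambda>n. real (k n) powr (1 + real CARD('p) / 2) / real n) at_top sequentially"
  shows "filterlim rate at_top sequentially"
proof -
  define a where "a = 1 / (f x * vol_ball TYPE('p))"
  have "a > 0" using f_pos V_pos by (simp add: a_def)
  then have "filterlim (\<lambda>n. a * (real (k n) powr (1 + real CARD('p) / 2) / real n)) at_top sequentially"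
    by (intro filterlim_tendsto_pos_mult_at_top[OF tendsto_const] assms)
  then have "filterlim (\<lambda>n. (a * (real (k n) powr (1 + real CARD('p) / 2) / real n)) powr (1 / real CARD('p))) at_top sequentially"
    by (intro filterlim_compose[OF filterlim_powr_at_top]) auto
  then show ?thesis
    by (rule filterlim_mono_eventually[OF _ order_refl order_refl])
      (use eventually_ge_at_top[of 1] in \<open>eventually_elim, simp add: rate_eq a_def mult.commute\<close>)
qed

text \<open>The power \<open>p / 2\<close> of \<open>\<tau>\<^sup>2 * sqrt k\<close> is
  \<open>k powr (1 + p / 4) / n\<close> up to a constant factor, so the upper growth condition
  bounds the scale of the bias.\<close>

lemma bias_scale_bounded:
  assumes "bounded (range (\<lambda>n. real (k n) powr (1 + real CARD('p) / 4) / real n))"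
  obtains B where "\<And>n. n \<ge> 1 \<Longrightarrow> (\<tau> n)\<^sup>2 * sqrt (real (k n)) \<le> B" "B \<ge> 0"
proof -
  obtain C where C: "\<And>n. real (k n) powr (1 + real CARD('p) / 4) / real n \<le> C"
    using assms unfolding bounded_iff by (auto simp: abs_le_iff)
  define a where "a = 1 / (f x * vol_ball TYPE('p))"
  have a: "a > 0" using f_pos V_pos by (simp add: a_def)
  have "(\<tau> n)\<^sup>2 * sqrt (real (k n)) \<le> (C * a) powr (2 / real CARD('p))" if n: "n \<ge> 1" for n
  proof -
    let ?y = "(\<tau> n)\<^sup>2 * sqrt (real (k n))"
    have y: "?y > 0" using \<tau>_pos[OF n] k_pos[OF n] by simp
    have "?y powr (real CARD('p) / 2) = (\<tau> n powr 2) powr (real CARD('p) / 2) * (real (k n) powr (1 / 2)) powr (real CARD('p) / 2)"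
      using \<tau>_pos[OF n] k_pos[OF n] by (simp add: powr_mult powr_half_sqrt)
    also have "\<dots> = \<tau> n powr real CARD('p) * real (k n) powr (real CARD('p) / 4)"
      by (simp add: powr_powr)
    also have "\<tau> n powr real CARD('p) = \<tau> n ^ CARD('p)" using \<tau>_pos[OF n] by (rule powr_realpow)
    also have "\<tau> n ^ CARD('p) * real (k n) powr (real CARD('p) / 4) = real (k n) powr (1 + real CARD('p) / 4) / real n * a"
      unfolding \<tau>_power[OF n] a_def using k_pos[OF n] by (simp add: powr_add)
    also have "\<dots> \<le> C * a" using C[of n] a by (intro mult_right_mono) auto
    finally have "(?y powr (real CARD('p) / 2)) powr (2 / real CARD('p)) \<le> (C * a) powr (2 / real CARD('p))"
      by (intro powr_mono2) auto
    then show ?thesis using y by (simp add: powr_powr)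
  qed
  then show ?thesis by (intro that[of "(C * a) powr (2 / real CARD('p))"]) auto
qed

text \<open>The assumed sequence times \<open>f x * vol_ball\<close> is
  \<open>(l / rate) ^ p\<close>; taking the p-th root, continuous on nonnegative numbers, gives the
  limit.\<close>

lemma penalty_lim:
  assumes l: "\<And>n. n \<ge> 1 \<Longrightarrow> l n \<ge> (0::real)"
    and lim: "(\<lambda>n. real n * l n ^ CARD('p) / real (k n) powr (1 + real CARD('p) / 2)) \<longlonglongrightarrow> c"
  shows "(\<lambda>n. l n / rate n) \<longlonglongrightarrow> (c * f x * vol_ball TYPE('p)) powr (1 / real CARD('p))"
proof -
  define a where "a = f x * vol_ball TYPE('p)"
  have a: "a > 0" using f_pos V_pos by (simp add: a_def)
  have "(\<lambda>n. real n * l n ^ CARD('p) / real (k n) powr (1 + real CARD('p) / 2) * a) \<longlonglongrightarrow> c * a"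
    by (intro tendsto_mult lim tendsto_const)
  moreover have "\<forall>\<^sub>F n in sequentially. 0 \<le> real n * l n ^ CARD('p) / real (k n) powr (1 + real CARD('p) / 2) * a"
    using eventually_ge_at_top[of 1] by eventually_elim (use l a in auto)
  ultimately have "(\<lambda>n. (real n * l n ^ CARD('p) / real (k n) powr (1 + real CARD('p) / 2) * a) powr (1 / real CARD('p)))
     \<longlonglongrightarrow> (c * a) powr (1 / real CARD('p))"
    by (intro tendsto_powr'[OF _ tendsto_const]) auto
  moreover have "\<forall>\<^sub>F n in sequentially. (real n * l n ^ CARD('p) / real (k n) powr (1 + real CARD('p) / 2) * a) powr (1 / real CARD('p)) =
     l n / rate n"
    using eventually_ge_at_top[of 1]
  proof eventually_elim
    case (elim n)
    have ln: "(l n ^ CARD('p)) powr (1 / real CARD('p)) = l n"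
    proof (cases "l n = 0")
      case False
      then have "l n > 0" using l[OF elim] by simp
      then show ?thesis by (simp add: powr_realpow[symmetric] powr_powr)
    qed simp
    let ?q = "real (k n) powr (1 + real CARD('p) / 2) / real n * (1 / a)"
    have "real n * l n ^ CARD('p) / real (k n) powr (1 + real CARD('p) / 2) * a = l n ^ CARD('p) / ?q"
      using elim by simp
    also have "(l n ^ CARD('p) / ?q) powr (1 / real CARD('p)) = (l n ^ CARD('p)) powr (1 / real CARD('p)) / ?q powr (1 / real CARD('p))"
      by (rule powr_divide)
    also have "\<dots> = l n / rate n"
      by (simp only: ln rate_eq[OF elim] a_def)
    finally show ?case .
  qed
  ultimately show ?thesis by (simp add: tendsto_cong a_def mult.assoc)
qed

end

section \<open>Expansion of the penalized log likelihood\<close>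

lemma convex_on_affine:
  fixes f :: "real \<Rightarrow> real" and q :: "'a::real_vector \<Rightarrow> real"
  assumes "convex_on UNIV f" and q: "\<And>t u v. q ((1 - t) *\<^sub>R u + t *\<^sub>R v) = (1 - t) * q u + t * q v"
  shows "convex_on UNIV (\<lambda>u. f (q u))"
proof (rule convex_onI)
  fix t :: real and u v :: 'a assume "0 < t" "t < 1"
  then show "f (q ((1 - t) *\<^sub>R u + t *\<^sub>R v)) \<le> (1 - t) * f (q u) + t * f (q v)"
    unfolding q using convex_onD[OF assms(1), of t "q u" "q v"] by simp
qed simp

lemma convex_on_sum_fun:
  assumes "finite I" "\<And>i. i \<in> I \<Longrightarrow> convex_on UNIV (f i)"
  shows "convex_on UNIV (\<lambda>u. \<Sum>i\<in>I. f i u)"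
  using assms by (induction I rule: finite_induct) (auto intro: convex_on_add convex_onI)

text \<open>Stated for affine reparametrizations \<open>p1\<close>, \<open>p2\<close> so that it
  applies directly in the rescaled coordinates; \<open>d\<close> will be the objective at the true
  parameters.\<close>

lemma concave_on_penalized_loglik:
  fixes xs :: "nat \<Rightarrow> real ^ 'p" and p1 :: "'b::real_vector \<Rightarrow> real" and p2 :: "'b \<Rightarrow> real ^ 'p"
  assumes "l \<ge> 0"
    and p1: "\<And>t u v. p1 ((1 - t) *\<^sub>R u + t *\<^sub>R v) = (1 - t) * p1 u + t * p1 v"
    and p2: "\<And>t u v. p2 ((1 - t) *\<^sub>R u + t *\<^sub>R v) = (1 - t) *\<^sub>R p2 u + t *\<^sub>R p2 v"
  shows "concave_on UNIV (\<lambda>u. penalized_loglik n k l ys xs x (p1 u, p2 u) - d)"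
proof -
  define \<eta> where "\<eta> i u = p1 u + p2 u \<bullet> (xs i - x)" for i u
  have \<eta>: "\<eta> i ((1 - t) *\<^sub>R u + t *\<^sub>R v) = (1 - t) * \<eta> i u + t * \<eta> i v" for i t u v
    unfolding \<eta>_def p1 p2 by (simp add: inner_add_left algebra_simps)
  have 1: "convex_on UNIV (\<lambda>u. softplus (\<eta> i u))" for i
    by (rule convex_on_affine[OF convex_softplus \<eta>])
  have lin: "convex_on UNIV (\<lambda>u. - (ys i * \<eta> i u))" for i
    by (rule convex_on_affine[where f = "\<lambda>s. - (ys i * s)" and q = "\<eta> i", OF _ \<eta>]) (auto intro!: convex_onI simp: algebra_simps)
  have abs: "convex_on UNIV (\<lambda>t::real. \<bar>t\<bar>)"
    by (rule convex_onI) (auto simp: abs_mult intro!: order_trans[OF abs_triangle_ineq])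
  have "convex_on UNIV (\<lambda>u. \<Sum>i\<in>nearest n k xs x. softplus (\<eta> i u) + - (ys i * \<eta> i u))"
    by (intro convex_on_sum_fun convex_on_add 1 lin) simp
  moreover have "convex_on UNIV (\<lambda>u. l * (\<Sum>j\<in>UNIV. \<bar>p2 u $ j\<bar>))"
    using \<open>l \<ge> 0\<close>
    by (intro convex_on_cmul convex_on_sum_fun convex_on_affine[OF abs]) (auto simp: p2)
  ultimately have "convex_on UNIV (\<lambda>u. (\<Sum>i\<in>nearest n k xs x. softplus (\<eta> i u) + - (ys i * \<eta> i u)) + l * (\<Sum>j\<in>UNIV. \<bar>p2 u $ j\<bar>))"
    by (rule convex_on_add)
  then have "convex_on UNIV (\<lambda>u. ((\<Sum>i\<in>nearest n k xs x. softplus (\<eta> i u) + - (ys i * \<eta> i u)) + l * (\<Sum>j\<in>UNIV. \<bar>p2 u $ j\<bar>)) + d)"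
    by (rule convex_on_add) (auto intro: convex_onI simp: algebra_simps)
  moreover have "- (penalized_loglik n k l ys xs x (p1 u, p2 u) - d) =
     ((\<Sum>i\<in>nearest n k xs x. softplus (\<eta> i u) + - (ys i * \<eta> i u)) + l * (\<Sum>j\<in>UNIV. \<bar>p2 u $ j\<bar>)) + d" for u
    unfolding penalized_loglik_def local_loglik_def prod.case loglik_term norm1_def \<eta>_def[symmetric]
    by (simp add: sum_subtractf sum_negf sum.distrib)
  ultimately show ?thesis unfolding concave_on_def by (simp only:)
qed

lemma sgn_nonneg_abs_diff:
  assumes "g \<noteq> 0" "\<bar>t\<bar> \<le> \<bar>g\<bar>"
  shows "\<bar>g + t\<bar> - \<bar>g\<bar> = sgn_nonneg g * t"
  using assms by (auto simp: sgn_nonneg_def)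

text \<open>A perturbation that does not carry a nonzero component across 0 changes its absolute
  value linearly; at a zero component the absolute value itself is left.\<close>

lemma penalty_increment:
  fixes g v :: "real ^ 'p"
  assumes "r > 0" and "\<And>j. g $ j \<noteq> 0 \<Longrightarrow> \<bar>v $ j\<bar> \<le> r * \<bar>g $ j\<bar>"
  shows "norm1 (g + (1 / r) *\<^sub>R v) - norm1 g =
    (\<Sum>j\<in>UNIV. sgn_nonneg (g $ j) * (v $ j) * of_bool (g $ j \<noteq> 0) + \<bar>v $ j\<bar> * of_bool (g $ j = 0)) / r"
  unfolding norm1_def sum_subtractf[symmetric] sum_divide_distrib
proof (rule sum.cong[OF refl])
  fix j
  show "\<bar>(g + (1 / r) *\<^sub>R v) $ j\<bar> - \<bar>g $ j\<bar> =
      (sgn_nonneg (g $ j) * (v $ j) * of_bool (g $ j \<noteq> 0) + \<bar>v $ j\<bar> * of_bool (g $ j = 0)) / r"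
  proof (cases "g $ j = 0")
    case True
    then show ?thesis using assms(1) by (simp add: abs_divide)
  next
    case False
    have "\<bar>v $ j / r\<bar> \<le> \<bar>g $ j\<bar>"
      using assms(2)[OF False] assms(1) by (simp add: abs_divide divide_le_eq mult.commute)
    from sgn_nonneg_abs_diff[OF False this] show ?thesis using False by simp
  qed
qed

text \<open>The directional derivative of the l1 norm at \<open>g\<close> in direction
  \<open>v\<close>.\<close>

definition l1_slope :: "real ^ 'p \<Rightarrow> real ^ 'p \<Rightarrow> real" where
  "l1_slope g v = (\<Sum>j\<in>UNIV. sgn_nonneg (g $ j) * (v $ j) * of_bool (g $ j \<noteq> 0) + \<bar>v $ j\<bar> * of_bool (g $ j = 0))"

lemma l1_slope_bound: "\<bar>l1_slope g v\<bar> \<le> real CARD('p) * norm (v :: real ^ 'p)"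
proof -
  have "\<bar>l1_slope g v\<bar> \<le> (\<Sum>j\<in>(UNIV::'p set). norm v)"
    unfolding l1_slope_def
  proof (rule order_trans[OF sum_abs], rule sum_mono)
    fix j
    show "\<bar>sgn_nonneg (g $ j) * (v $ j) * of_bool (g $ j \<noteq> 0) + \<bar>v $ j\<bar> * of_bool (g $ j = 0)\<bar> \<le> norm v"
      using component_le_norm_cart[of v j] by (auto simp: sgn_nonneg_def)
  qed
  then show ?thesis by simp
qed

lemma inner_square_sum:
  fixes u v :: "'a::euclidean_space"
  shows "(u \<bullet> v)\<^sup>2 = (\<Sum>a\<in>Basis. \<Sum>b\<in>Basis. (u \<bullet> a) * (u \<bullet> b) * ((v \<bullet> a) * (v \<bullet> b)))"
  unfolding euclidean_inner[of u v] power2_eq_square sum_product by (simp add: mult_ac)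

lemma abs_bilinear_le:
  fixes u :: "'a::euclidean_space" and e :: "'a \<Rightarrow> 'a \<Rightarrow> real"
  assumes "\<And>a b. a \<in> Basis \<Longrightarrow> b \<in> Basis \<Longrightarrow> \<bar>e a b\<bar> \<le> d"
  shows "\<bar>\<Sum>a\<in>Basis. \<Sum>b\<in>Basis. (u \<bullet> a) * (u \<bullet> b) * e a b\<bar> \<le> (real DIM('a))\<^sup>2 * (norm u)\<^sup>2 * d"
proof -
  have "\<bar>(u \<bullet> a) * (u \<bullet> b) * e a b\<bar> \<le> norm u * norm u * d" if "a \<in> Basis" "b \<in> Basis" for a b
    unfolding abs_mult using that assms[OF that] Basis_le_norm[of _ u] by (intro mult_mono) auto
  then have "\<bar>\<Sum>a\<in>Basis. \<Sum>b\<in>Basis. (u \<bullet> a) * (u \<bullet> b) * e a b\<bar> \<le> (\<Sum>a\<in>(Basis::'a set). \<Sum>b\<in>(Basis::'a set). norm u * norm u * d)"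
    by (intro order_trans[OF sum_abs] sum_mono)
  then show ?thesis by (simp add: power2_eq_square mult_ac)
qed

lemma abs_linear_le:
  fixes u v :: "'a::euclidean_space"
  assumes "\<And>b. b \<in> Basis \<Longrightarrow> \<bar>v \<bullet> b\<bar> \<le> d"
  shows "\<bar>u \<bullet> v\<bar> \<le> real DIM('a) * norm u * d"
proof -
  have "\<bar>(u \<bullet> b) * (v \<bullet> b)\<bar> \<le> norm u * d" if "b \<in> Basis" for b
    unfolding abs_mult using that assms[OF that] Basis_le_norm[of _ u] by (intro mult_mono) auto
  then have "\<bar>u \<bullet> v\<bar> \<le> (\<Sum>b\<in>(Basis::'a set). norm u * d)"
    unfolding euclidean_inner[of u v] by (intro order_trans[OF sum_abs] sum_mono)
  then show ?thesis by simp
qed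

text \<open>A deterministic expansion with four error sources: the score, the empirical second
  moment matrix, the variation of the logistic weights, and the cubic Taylor remainder. Since
  \<open>norm (1, U i) \<le> 3\<close>, each \<open>d i\<close> is at most
  \<open>3 * K / sqrt k\<close>, whence 9 and 27; \<open>k\<close> cubic remainders leave a factor
  \<open>1 / sqrt k\<close>. \<open>D\<close> counts basis vectors.\<close>

lemma loglik_expansion:
  fixes U :: "'i \<Rightarrow> real ^ 'p" and u :: "real \<times> (real ^ 'p)" and Y \<eta> :: "'i \<Rightarrow> real"
  assumes N: "finite N" "card N = k" "k > 0" and U: "\<And>i. i \<in> N \<Longrightarrow> norm (U i) \<le> 2"
    and \<eta>: "\<And>i. i \<in> N \<Longrightarrow> \<bar>expit (\<eta> i) * (1 - expit (\<eta> i)) - w\<bar> \<le> \<delta>"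
    and avg: "\<And>a b. a \<in> Basis \<Longrightarrow> b \<in> Basis \<Longrightarrow>
      \<bar>(\<Sum>i\<in>N. ((1, U i) \<bullet> a) * ((1, U i) \<bullet> b)) / real k - m a b\<bar> \<le> \<delta>'"
    and score: "\<And>b. b \<in> Basis \<Longrightarrow> \<bar>(\<Sum>i\<in>N. (Y i - expit (\<eta> i)) * ((1, U i) \<bullet> b)) / sqrt (real k) - V \<bullet> b\<bar> \<le> \<delta>''"
    and q: "\<And>u. q u = (\<Sum>a\<in>Basis. \<Sum>b\<in>Basis. (u \<bullet> a) * (u \<bullet> b) * m a b)"
    and "w \<ge> 0" and K: "norm u \<le> K"
  defines "d \<equiv> \<lambda>i. (u \<bullet> (1, U i)) / sqrt (real k)" and "D \<equiv> real DIM(real \<times> (real ^ 'p))"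
  shows "\<bar>(\<Sum>i\<in>N. Y i * (\<eta> i + d i) - softplus (\<eta> i + d i)) - (\<Sum>i\<in>N. Y i * \<eta> i - softplus (\<eta> i)) -
      (u \<bullet> V - w * q u / 2)\<bar> \<le> D * K * \<delta>'' + w * (D\<^sup>2 * K\<^sup>2 * \<delta>') / 2 + 9 * K\<^sup>2 * \<delta> / 2 + 27 * K ^ 3 / sqrt (real k)"
proof -
  define W where "W i = expit (\<eta> i) * (1 - expit (\<eta> i))" for i
  define r where "r i = softplus (\<eta> i + d i) - softplus (\<eta> i) - expit (\<eta> i) * d i - W i * (d i)\<^sup>2 / 2" for i
  define G where "G = (\<Sum>b\<in>(Basis :: (real \<times> (real ^ 'p)) set). ((\<Sum>i\<in>N. (Y i - expit (\<eta> i)) * ((1, U i) \<bullet> b)) / sqrt (real k)) *\<^sub>R b)"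
  have K0: "K \<ge> 0" using K norm_ge_zero[of u] by linarith
  have sk: "sqrt (real k) > 0" using N(3) by simp
  have \<delta>0: "\<delta> \<ge> 0"
  proof -
    have "N \<noteq> {}" using N by auto
    then obtain i where "i \<in> N" by blast
    from \<eta>[OF this] show ?thesis by linarith
  qed
  have uU: "\<bar>u \<bullet> (1, U i)\<bar> \<le> 3 * K" if "i \<in> N" for i
  proof -
    have "\<bar>u \<bullet> (1, U i)\<bar> \<le> norm u * norm (1::real, U i)" by (rule Cauchy_Schwarz_ineq2)
    also have "\<dots> \<le> K * 3"
      using norm_Pair_le[of "1::real" "U i"] U[OF that] K K0 by (intro mult_mono) auto
    finally show ?thesis by simp
  qed
  have Gu: "u \<bullet> G = (\<Sum>i\<in>N. (Y i - expit (\<eta> i)) * d i)"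
  proof -
    have "u \<bullet> G = (\<Sum>b\<in>Basis. (u \<bullet> b) * ((\<Sum>i\<in>N. (Y i - expit (\<eta> i)) * ((1, U i) \<bullet> b)) / sqrt (real k)))"
      unfolding G_def inner_sum_right by (simp add: mult.commute)
    also have "\<dots> = (\<Sum>b\<in>Basis. \<Sum>i\<in>N. (Y i - expit (\<eta> i)) / sqrt (real k) * ((u \<bullet> b) * ((1, U i) \<bullet> b)))"
      by (simp add: sum_distrib_left sum_divide_distrib mult_ac)
    also have "\<dots> = (\<Sum>i\<in>N. \<Sum>b\<in>Basis. (Y i - expit (\<eta> i)) / sqrt (real k) * ((u \<bullet> b) * ((1, U i) \<bullet> b)))"
      by (rule sum.swap)
    also have "\<dots> = (\<Sum>i\<in>N. (Y i - expit (\<eta> i)) / sqrt (real k) * (u \<bullet> (1, U i)))"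
      by (simp only: sum_distrib_left[symmetric] euclidean_inner[of u, symmetric])
    finally show ?thesis by (simp add: d_def)
  qed
  have t1: "\<bar>u \<bullet> G - u \<bullet> V\<bar> \<le> D * K * \<delta>''"
  proof -
    have "\<bar>(G - V) \<bullet> b\<bar> \<le> \<delta>''" if "b \<in> Basis" for b
      using score[OF that] that unfolding G_def
      by (simp add: inner_diff_left inner_sum_left inner_Basis if_distrib cong: if_cong)
    note this
    moreover have "\<delta>'' \<ge> 0"
    proof -
      obtain b where "b \<in> (Basis :: (real \<times> (real ^ 'p)) set)" using nonempty_Basis by blast
      from score[OF this] show ?thesis by linarith
    qed
    ultimately have "\<bar>u \<bullet> (G - V)\<bar> \<le> D * norm u * \<delta>''" "D * norm u * \<delta>'' \<le> D * K * \<delta>''"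
      unfolding D_def using K by (intro abs_linear_le mult_right_mono mult_left_mono; simp)+
    then show ?thesis by (simp add: inner_diff_right)
  qed
  have t2: "\<bar>(\<Sum>i\<in>N. (d i)\<^sup>2) - q u\<bar> \<le> D\<^sup>2 * K\<^sup>2 * \<delta>'"
  proof -
    have "(\<Sum>i\<in>N. (d i)\<^sup>2) = (\<Sum>i\<in>N. \<Sum>a\<in>Basis. \<Sum>b\<in>Basis. (u \<bullet> a) * (u \<bullet> b) * (((1, U i) \<bullet> a) * ((1, U i) \<bullet> b))) / real k"
      unfolding d_def power_divide by (simp add: sum_divide_distrib inner_square_sum)
    also have "\<dots> = (\<Sum>a\<in>Basis. \<Sum>b\<in>Basis. \<Sum>i\<in>N. (u \<bullet> a) * (u \<bullet> b) * (((1, U i) \<bullet> a) * ((1, U i) \<bullet> b))) / real k"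
      by (subst sum.swap, subst (2) sum.swap) (rule refl)
    also have "\<dots> = (\<Sum>a\<in>Basis. \<Sum>b\<in>Basis. (u \<bullet> a) * (u \<bullet> b) * ((\<Sum>i\<in>N. ((1, U i) \<bullet> a) * ((1, U i) \<bullet> b)) / real k))"
      by (simp only: sum_divide_distrib[symmetric] sum_distrib_left[symmetric] times_divide_eq_right)
    finally have "(\<Sum>i\<in>N. (d i)\<^sup>2) - q u = (\<Sum>a\<in>Basis. \<Sum>b\<in>Basis. (u \<bullet> a) * (u \<bullet> b) *
        ((\<Sum>i\<in>N. ((1, U i) \<bullet> a) * ((1, U i) \<bullet> b)) / real k - m a b))"
      unfolding q by (simp only: sum_subtractf[symmetric] right_diff_distrib[symmetric])
    then have "\<bar>(\<Sum>i\<in>N. (d i)\<^sup>2) - q u\<bar> \<le> D\<^sup>2 * (norm u)\<^sup>2 * \<delta>'"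
      unfolding D_def by (simp only:) (rule abs_bilinear_le[OF avg])
    also have "\<dots> \<le> D\<^sup>2 * K\<^sup>2 * \<delta>'"
    proof -
      obtain b where "b \<in> (Basis :: (real \<times> (real ^ 'p)) set)" using nonempty_Basis by blast
      then have "\<delta>' \<ge> 0" using avg[of b b] by linarith
      moreover have "(norm u)\<^sup>2 \<le> K\<^sup>2" using K by (intro power_mono) auto
      ultimately show ?thesis by (intro mult_right_mono mult_left_mono) auto
    qed
    finally show ?thesis .
  qed
  have dsq: "(d i)\<^sup>2 \<le> 9 * K\<^sup>2 / real k" if "i \<in> N" for i
    using power_mono[OF uU[OF that], of 2] unfolding d_def power_divide
    by (simp add: divide_right_mono power_mult_distrib)
  have t3: "\<bar>(\<Sum>i\<in>N. W i * (d i)\<^sup>2) - w * (\<Sum>i\<in>N. (d i)\<^sup>2)\<bar> \<le> 9 * K\<^sup>2 * \<delta>"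
  proof -
    have "\<bar>(\<Sum>i\<in>N. W i * (d i)\<^sup>2) - w * (\<Sum>i\<in>N. (d i)\<^sup>2)\<bar> = \<bar>\<Sum>i\<in>N. (W i - w) * (d i)\<^sup>2\<bar>"
      by (simp add: sum_distrib_left left_diff_distrib sum_subtractf)
    also have "\<dots> \<le> (\<Sum>i\<in>N. \<delta> * (9 * K\<^sup>2 / real k))"
    proof (rule order_trans[OF sum_abs], rule sum_mono)
      fix i assume "i \<in> N"
      then show "\<bar>(W i - w) * (d i)\<^sup>2\<bar> \<le> \<delta> * (9 * K\<^sup>2 / real k)"
        unfolding abs_mult using \<eta> dsq \<delta>0 by (intro mult_mono) (auto simp: W_def)
    qed
    also have "\<dots> = 9 * K\<^sup>2 * \<delta>" using N by simp
    finally show ?thesis .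
  qed
  have t4: "\<bar>\<Sum>i\<in>N. r i\<bar> \<le> 27 * K ^ 3 / sqrt (real k)"
  proof -
    have "\<bar>r i\<bar> \<le> (3 * K / sqrt (real k)) ^ 3" if "i \<in> N" for i
    proof -
      have "\<bar>r i\<bar> \<le> \<bar>d i\<bar> ^ 3" unfolding r_def W_def by (rule softplus_taylor)
      also have "\<dots> \<le> (3 * K / sqrt (real k)) ^ 3"
        using uU[OF that] by (intro power_mono) (auto simp: d_def abs_divide divide_right_mono)
      finally show ?thesis .
    qed
    then have "\<bar>\<Sum>i\<in>N. r i\<bar> \<le> (\<Sum>i\<in>N. (3 * K / sqrt (real k)) ^ 3)"
      by (intro order_trans[OF sum_abs] sum_mono)
    also have "\<dots> = real k * (3 * K / sqrt (real k)) ^ 3" using N by simp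
    also have "\<dots> = (sqrt (real k))\<^sup>2 * (3 * K / sqrt (real k)) ^ 3" by simp
    also have "\<dots> = 27 * K ^ 3 / sqrt (real k)"
      using sk by (simp only: power_divide power_mult_distrib power2_eq_square power3_eq_cube) (simp add: field_simps)
    finally show ?thesis .
  qed
  have "(\<Sum>i\<in>N. Y i * (\<eta> i + d i) - softplus (\<eta> i + d i)) - (\<Sum>i\<in>N. Y i * \<eta> i - softplus (\<eta> i)) =
     (\<Sum>i\<in>N. (Y i - expit (\<eta> i)) * d i - W i * (d i)\<^sup>2 / 2 - r i)"
    unfolding sum_subtractf[symmetric] by (intro sum.cong refl) (simp add: r_def algebra_simps)
  also have "\<dots> = u \<bullet> G - (\<Sum>i\<in>N. W i * (d i)\<^sup>2) / 2 - (\<Sum>i\<in>N. r i)"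
    by (simp add: sum_subtractf Gu sum_divide_distrib)
  finally have eq: "(\<Sum>i\<in>N. Y i * (\<eta> i + d i) - softplus (\<eta> i + d i)) - (\<Sum>i\<in>N. Y i * \<eta> i - softplus (\<eta> i)) =
     u \<bullet> G - (\<Sum>i\<in>N. W i * (d i)\<^sup>2) / 2 - (\<Sum>i\<in>N. r i)" .
  have t2': "\<bar>w * (\<Sum>i\<in>N. (d i)\<^sup>2) - w * q u\<bar> \<le> w * (D\<^sup>2 * K\<^sup>2 * \<delta>')"
    using mult_left_mono[OF t2 \<open>w \<ge> 0\<close>] \<open>w \<ge> 0\<close> by (simp add: right_diff_distrib[symmetric] abs_mult)
  show ?thesis unfolding eq using t1 t2' t3 t4 by linarith
qed

lemma sum_Basis_prod:
  fixes g :: "'a::euclidean_space \<times> 'b::euclidean_space \<Rightarrow> real"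
  shows "sum g Basis = (\<Sum>b\<in>Basis. g (b, 0)) + (\<Sum>b\<in>Basis. g (0, b))"
proof -
  have "inj_on (\<lambda>u. (u::'a, 0::'b)) Basis" "inj_on (\<lambda>u. (0::'a, u::'b)) Basis"
    by (auto intro!: inj_onI)
  then show ?thesis
    unfolding Basis_prod_def by (subst sum.union_disjoint) (auto simp: sum.reindex)
qed

section \<open>Convergence of the score in the rescaled model\<close>

locale nn_logistic = nn_sample M Ys Xs \<nu> \<pi> f x k
  for M :: "'w measure" and Ys and Xs :: "nat \<Rightarrow> 'w \<Rightarrow> real ^ 'p" and \<nu> \<pi> f x k +
  fixes l :: "nat \<Rightarrow> real" and c :: real
    and a_hat :: "nat \<Rightarrow> 'w \<Rightarrow> real" and b_hat :: "nat \<Rightarrow> 'w \<Rightarrow> real ^ 'p"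
  assumes C2: "C2_at \<pi> x" and \<pi>01: "\<pi> x \<in> {0<..<1}"
    and l_nonneg: "\<And>n. n \<ge> 1 \<Longrightarrow> l n \<ge> 0"
    and k_lower: "filterlim (\<lambda>n. real (k n) powr (1 + real CARD('p) / 2) / real n) at_top sequentially"
    and k_upper: "bounded (range (\<lambda>n. real (k n) powr (1 + real CARD('p) / 4) / real n))"
    and l_lim: "(\<lambda>n. real n * l n ^ CARD('p) / real (k n) powr (1 + real CARD('p) / 2)) \<longlonglongrightarrow> c"
    and est_max: "\<And>n. n \<ge> 1 \<Longrightarrow> AE \<omega> in M.
          (\<exists>ab. is_arg_max (penalized_loglik n (k n) (l n) (\<lambda>i. Ys i \<omega>) (\<lambda>i. Xs i \<omega>) x) (\<lambda>_. True) ab) \<longrightarrow>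
          is_arg_max (penalized_loglik n (k n) (l n) (\<lambda>i. Ys i \<omega>) (\<lambda>i. Xs i \<omega>) x) (\<lambda>_. True) (a_hat n \<omega>, b_hat n \<omega>)"
begin

definition l0 where "l0 = logit (\<pi> x)"
definition g0 where "g0 = gradient (logit \<circ> \<pi>) x"
definition w0 where "w0 = \<pi> x * (1 - \<pi> x)"
definition \<kappa> where "\<kappa> = (c * f x * vol_ball TYPE('p)) powr (1 / real CARD('p))"

definition W :: "nat \<Rightarrow> 'w \<Rightarrow> real \<times> (real ^ 'p)" where
  "W n \<omega> = (\<Sum>b\<in>Basis. ball_noise (\<lambda>v. (1, v) \<bullet> b) n \<omega> *\<^sub>R b)"

definition T :: "nat \<Rightarrow> real \<times> (real ^ 'p)" where
  "T n = ((\<tau> n)\<^sup>2 * sqrt (real (k n))) *\<^sub>R (bias_coeff \<pi> x *\<^sub>R (1, 0))"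

definition A :: "nat \<Rightarrow> 'w \<Rightarrow> real \<times> (real ^ 'p)" where
  "A n \<omega> = limit_argmax \<pi> f c x (W n \<omega> + T n)"

definition Z :: "nat \<Rightarrow> 'w \<Rightarrow> real \<times> (real ^ 'p)" where
  "Z n \<omega> = (sqrt (real (k n)) * (a_hat n \<omega> - l0), rate n *\<^sub>R (b_hat n \<omega> - g0))"

definition \<eta> where "\<eta> i \<omega> = l0 + g0 \<bullet> (Xs i \<omega> - x)"

abbreviation objective :: "nat \<Rightarrow> 'w \<Rightarrow> real \<times> (real ^ 'p) \<Rightarrow> real" where
  "objective n \<omega> \<equiv> penalized_loglik n (k n) (l n) (\<lambda>i. Ys i \<omega>) (\<lambda>i. Xs i \<omega>) x"

abbreviation estimates :: "nat \<Rightarrow> 'w \<Rightarrow> bool" where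
  "estimates n \<omega> \<equiv> (\<exists>ab. is_arg_max (objective n \<omega>) (\<lambda>_. True) ab) \<longrightarrow>
     is_arg_max (objective n \<omega>) (\<lambda>_. True) (a_hat n \<omega>, b_hat n \<omega>)"

abbreviation score_error :: "real \<times> (real ^ 'p) \<Rightarrow> nat \<Rightarrow> 'w \<Rightarrow> real" where
  "score_error b n \<omega> \<equiv> (\<Sum>i\<in>nbh n \<omega>. (Ys i \<omega> - expit (\<eta> i \<omega>)) * ((1, U n i \<omega>) \<bullet> b)) / sqrt (real (k n)) - (W n \<omega> + T n) \<bullet> b"

abbreviation bias_error :: "real \<times> (real ^ 'p) \<Rightarrow> nat \<Rightarrow> 'w \<Rightarrow> real" where
  "bias_error b n \<omega> \<equiv> (\<Sum>i\<in>nbh n \<omega>. (\<pi> (Xs i \<omega>) - expit (\<eta> i \<omega>)) * ((1, U n i \<omega>) \<bullet> b)) / sqrt (real (k n)) - T n \<bullet> b"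

lemma w0_pos: "w0 > 0"
  using \<pi>01 by (simp add: w0_def)

lemma expit_l0: "expit l0 = \<pi> x"
  unfolding l0_def by (rule expit_logit[OF \<pi>01])

lemma comp_meas [measurable]: "(\<lambda>v. (1, v) \<bullet> b) \<in> borel_measurable borel"
  for b :: "real \<times> (real ^ 'p)"
  by (intro borel_measurable_continuous_onI continuous_intros)

lemma W_meas [measurable]: "W n \<in> borel_measurable M"
  unfolding W_def[abs_def] by (intro borel_measurable_sum borel_measurable_scaleR borel_measurable_const ball_noise_meas comp_meas)

lemma W_inner_Basis: "b \<in> Basis \<Longrightarrow> W n \<omega> \<bullet> b = ball_noise (\<lambda>v. (1, v) \<bullet> b) n \<omega>"
  by (simp add: W_def inner_sum_left inner_Basis if_distrib cong: if_cong)

text \<open>Noise is linear in its weight function, so a linear functional of the score is a scalar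
  noise. This reduces the vector limit to \<open>ball_noise_char\<close>.\<close>

lemma inner_W: "t \<bullet> W n \<omega> = ball_noise (\<lambda>v. t \<bullet> (1, v)) n \<omega>"
proof -
  have "t \<bullet> W n \<omega> = (\<Sum>b\<in>Basis. (t \<bullet> b) * ball_noise (\<lambda>v. (1, v) \<bullet> b) n \<omega>)"
    by (simp add: W_def inner_sum_right mult.commute)
  also have "\<dots> = (\<Sum>b\<in>Basis. \<Sum>i\<in>{1..n}. (Ys i \<omega> - \<pi> (Xs i \<omega>)) * (indicator (cball 0 1) (U n i \<omega>) * ((t \<bullet> b) * ((1, U n i \<omega>) \<bullet> b)))) / sqrt (real (k n))"
    unfolding ball_noise_def sum_divide_distrib by (simp add: sum_distrib_left mult_ac)
  also have "(\<Sum>b\<in>Basis. \<Sum>i\<in>{1..n}. (Ys i \<omega> - \<pi> (Xs i \<omega>)) * (indicator (cball 0 1) (U n i \<omega>) * ((t \<bullet> b) * ((1, U n i \<omega>) \<bullet> b)))) =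
     (\<Sum>i\<in>{1..n}. \<Sum>b\<in>Basis. (Ys i \<omega> - \<pi> (Xs i \<omega>)) * (indicator (cball 0 1) (U n i \<omega>) * ((t \<bullet> b) * ((1, U n i \<omega>) \<bullet> b))))"
    by (rule sum.swap)
  also have "\<dots> = (\<Sum>i\<in>{1..n}. (Ys i \<omega> - \<pi> (Xs i \<omega>)) * (indicator (cball 0 1) (U n i \<omega>) * (t \<bullet> (1, U n i \<omega>))))"
    by (simp only: sum_distrib_left[symmetric] euclidean_inner[of t, symmetric])
  finally show ?thesis by (simp only: ball_noise_def)
qed

lemma W_tight:
  assumes "e > 0"
  shows "\<exists>K. \<forall>L\<ge>K. \<forall>n. prob {\<omega> \<in> space M. norm (W n \<omega>) > L} \<le> e"
proof -
  have adm: "\<And>u. norm u \<le> 2 \<Longrightarrow> \<bar>(1, u) \<bullet> b\<bar> \<le> 3" if "b \<in> Basis" for b :: "real \<times> (real ^ 'p)"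
    by (rule inner_pair_Basis_bound[OF that])
  have "\<forall>b\<in>(Basis :: (real \<times> (real ^ 'p)) set). \<exists>B. \<forall>n. expectation (\<lambda>\<omega>. (ball_noise (\<lambda>v. (1, v) \<bullet> b) n \<omega>)\<^sup>2) \<le> B"
    using ball_noise_second_moment(2)[OF comp_meas adm] by blast
  then obtain B where B: "\<And>b n. b \<in> Basis \<Longrightarrow> expectation (\<lambda>\<omega>. (ball_noise (\<lambda>v. (1, v) \<bullet> (b :: real \<times> (real ^ 'p))) n \<omega>)\<^sup>2) \<le> B b"
    by metis
  define S where "S = (\<Sum>b\<in>Basis. B b)"
  have sq: "(norm (W n \<omega>))\<^sup>2 = (\<Sum>b\<in>Basis. (ball_noise (\<lambda>v. (1::real, v) \<bullet> b) n \<omega>)\<^sup>2)" for n \<omega>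
    unfolding norm_power2_Basis by (intro sum.cong refl) (simp add: W_inner_Basis)
  have int: "integrable M (\<lambda>\<omega>. (ball_noise (\<lambda>v. (1, v) \<bullet> b) n \<omega>)\<^sup>2)" if "b \<in> Basis" for b :: "real \<times> (real ^ 'p)" and n
    by (rule ball_noise_second_moment(1)[OF comp_meas adm[OF that]])
  have ES: "expectation (\<lambda>\<omega>. (norm (W n \<omega>))\<^sup>2) \<le> S" for n
    unfolding sq S_def using int B by (subst Bochner_Integration.integral_sum) (auto intro: sum_mono)
  \<comment> \<open>Chebyshev with second moment at most \<open>S\<close>: the threshold gives
    \<open>S \<le> e * L\<close>, and \<open>L \<ge> 1\<close> gives
    \<open>e * L \<le> e * L\<^sup>2\<close>.\<close>
  have "prob {\<omega> \<in> space M. norm (W n \<omega>) > L} \<le> e" if L: "L \<ge> max 1 (S / e)" for L n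
  proof -
    have "prob {\<omega> \<in> space M. \<bar>norm (W n \<omega>)\<bar> > L} \<le> expectation (\<lambda>\<omega>. (norm (W n \<omega>))\<^sup>2) / L\<^sup>2"
      using L int unfolding sq by (intro prob_gt_le_second_moment[of "\<lambda>\<omega>. norm (W n \<omega>)", unfolded sq] Bochner_Integration.integrable_sum) auto
    also have "\<dots> \<le> S / L\<^sup>2" by (intro divide_right_mono ES) simp
    also have "\<dots> \<le> e"
    proof -
      have "S \<le> e * L" using L \<open>e > 0\<close> by (simp add: divide_le_eq mult.commute)
      also have "\<dots> \<le> e * L\<^sup>2" using L \<open>e > 0\<close> by (intro mult_left_mono) (auto simp: power2_eq_square)
      finally show ?thesis using L by (simp add: divide_le_eq)
    qed
    finally show ?thesis by simp
  qed
  then show ?thesis by blast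
qed

lemma exists_normal_Gamma: "\<exists>\<mu>. is_normal_vec 0 (Gamma_op \<pi> x) \<mu>"
proof (rule exists_normal_diagonal)
  let ?p = "real CARD('p) + 2"
  have p: "?p > 0" by linarith
  fix t :: "real \<times> (real ^ 'p)"
  \<comment> \<open>A basis vector with nonzero first component is the intercept direction, with
    variance \<open>w0\<close>; all others are slope directions, with variance
    \<open>w0 / (p + 2)\<close>.\<close>
  have "(\<Sum>b\<in>(Basis :: (real \<times> (real ^ 'p)) set). (sqrt (w0 * (if fst b \<noteq> 0 then 1 else 1 / ?p)) * (t \<bullet> b))\<^sup>2) =
     (\<Sum>b\<in>(Basis :: real set). w0 * (fst t \<bullet> b)\<^sup>2) + (\<Sum>b\<in>(Basis :: (real ^ 'p) set). w0 / ?p * (snd t \<bullet> b)\<^sup>2)"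
    using w0_pos p unfolding sum_Basis_prod by (simp add: power_mult_distrib inner_prod_def)
  also have "\<dots> = t \<bullet> Gamma_op \<pi> x t"
    unfolding inner_Gamma_op unit_ball_mean_affine_square norm_power2_Basis w0_def[symmetric]
    by (simp add: sum_distrib_left sum_divide_distrib distrib_left)
  finally show "t \<bullet> Gamma_op \<pi> x t = (\<Sum>b\<in>Basis. (sqrt (w0 * (if fst b \<noteq> 0 then 1 else 1 / ?p)) * (t \<bullet> b))\<^sup>2)" by simp
qed

lemma W_weak_conv:
  assumes "is_normal_vec 0 (Gamma_op \<pi> x) \<mu>"
  shows "weak_conv_vec (\<lambda>n. distr M borel (W n)) \<mu>"
proof (rule weak_conv_vec_char)
  show "prob_space (distr M borel (W n))" for n by (rule prob_space_distr) simp
  show "prob_space \<mu>" "sets \<mu> = sets borel" using assms by (auto simp: is_normal_vec_def)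
  fix t :: "real \<times> (real ^ 'p)"
  have c: "continuous_on UNIV (\<lambda>v. t \<bullet> (1, v))" by (intro continuous_intros)
  then obtain C where "(\<lambda>v. t \<bullet> (1, v)) \<in> borel_measurable borel" "\<And>v. norm v \<le> 2 \<Longrightarrow> \<bar>t \<bullet> (1, v)\<bar> \<le> C"
    using admissible_continuous[OF c] unfolding admissible_def by blast
  from ball_noise_char[OF this]
  have "(\<lambda>n. CLINT \<omega>|M. iexp (t \<bullet> W n \<omega>)) \<longlonglongrightarrow> exp (- complex_of_real (t \<bullet> Gamma_op \<pi> x t) / 2)"
    unfolding inner_W inner_Gamma_op .
  moreover have "(CLINT u|distr M borel (W n). iexp (t \<bullet> u)) = (CLINT \<omega>|M. iexp (t \<bullet> W n \<omega>))" for n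
    by (rule integral_distr) auto
  moreover have "(CLINT u|\<mu>. iexp (t \<bullet> u)) = exp (- complex_of_real (t \<bullet> Gamma_op \<pi> x t) / 2)"
  proof -
    have "(CLINT u|\<mu>. iexp (t \<bullet> u)) =
        exp (\<i> * complex_of_real (t \<bullet> 0) - complex_of_real (t \<bullet> Gamma_op \<pi> x t) / 2)"
      using assms unfolding is_normal_vec_def by blast
    then show ?thesis by simp
  qed
  ultimately show "(\<lambda>n. CLINT u|distr M borel (W n). iexp (t \<bullet> u)) \<longlonglongrightarrow> (CLINT u|\<mu>. iexp (t \<bullet> u))"
    by (simp only:)
next
  fix e :: real assume "e > 0"
  then obtain K where "\<forall>L\<ge>K. \<forall>n. prob {\<omega> \<in> space M. norm (W n \<omega>) > L} \<le> e"
    using W_tight by blast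
  moreover have "measure (distr M borel (W n)) {u. norm u > L} = prob {\<omega> \<in> space M. norm (W n \<omega>) > L}" for n L
    by (subst measure_distr) (auto intro!: arg_cong[where f = prob])
  ultimately show "\<exists>K. \<forall>L\<ge>K. \<forall>n. measure (distr M borel (W n)) {u. norm u > L} \<le> e"
    by (intro exI[of _ K]) simp
qed simp

text \<open>For a neighbour the model error is \<open>\<tau>\<^sup>2\<close> times the misfit at
  \<open>U\<close>, up to a small multiple of \<open>\<tau>\<^sup>2\<close>. Summing
  \<open>k\<close> such terms and dividing by \<open>sqrt k\<close> gives the bounded scale
  \<open>\<tau>\<^sup>2 * sqrt k\<close> times a neighbour average, which converges to the mean over
  the unit ball.\<close>

lemma bias_close:
  assumes b: "b \<in> Basis" and "e > 0"
  shows "whp M (\<lambda>n \<omega>. \<bar>bias_error b n \<omega>\<bar> \<le> e)"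
proof -
  obtain B where B: "\<And>n. n \<ge> 1 \<Longrightarrow> (\<tau> n)\<^sup>2 * sqrt (real (k n)) \<le> B" "B \<ge> 0"
    using bias_scale_bounded[OF k_upper] by blast
  \<comment> \<open>The 13 is 12 + 1. The 12 comes from the Taylor error,
    \<open>e1 * (2 * \<tau>)\<^sup>2\<close> times the bound 3 on a component of
    \<open>(1, U)\<close>; the 1 comes from the neighbour average. \<open>B + 1\<close> excludes
    division by 0.\<close>
  define e1 where "e1 = e / (13 * (B + 1))"
  have e1: "e1 > 0" "13 * B * e1 \<le> e"
  proof -
    show "e1 > 0" using \<open>e > 0\<close> B(2) by (simp add: e1_def)
    then have "13 * B * e1 \<le> 13 * (B + 1) * e1" by (intro mult_right_mono) auto
    also have "\<dots> = e" using B(2) by (simp add: e1_def)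
    finally show "13 * B * e1 \<le> e" .
  qed
  obtain d where d: "d > 0" "\<And>h. norm h \<le> d \<Longrightarrow> \<bar>\<pi> (x + h) - expit (l0 + g0 \<bullet> h) - misfit \<pi> x h\<bar> \<le> e1 * (norm h)\<^sup>2"
    using local_misfit[OF C2 \<pi>01 e1(1)] unfolding l0_def g0_def by blast
  define q where "q v = misfit \<pi> x v * ((1, v) \<bullet> b)" for v
  have "continuous_on UNIV q"
    unfolding q_def[abs_def] misfit_def by (intro continuous_intros matrix_vector_mult_linear_continuous_on) simp
  then obtain C where q: "q \<in> borel_measurable borel" "\<And>v. norm v \<le> 2 \<Longrightarrow> \<bar>q v\<bar> \<le> C"
    using admissible_continuous unfolding admissible_def by blast
  have "whp M (\<lambda>n \<omega>. (n \<ge> 1 \<and> (\<forall>i\<in>nbh n \<omega>. norm (U n i \<omega>) \<le> 2)) \<and>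
      \<bar>(\<Sum>i\<in>nbh n \<omega>. q (U n i \<omega>)) / real (k n) - unit_ball_mean q\<bar> \<le> e1)"
    by (intro whp_conj whp_nbh_ball nbh_average[OF q e1(1)])
  then show ?thesis
  proof (rule whp_mono)
    \<comment> \<open>Neighbours lie within \<open>2 * \<tau> n\<close>, so this puts them in the
      range \<open>d\<close> of the local expansion.\<close>
    have "\<forall>\<^sub>F n in sequentially. \<tau> n < d / 2" using \<tau>_lim d(1) by (intro order_tendstoD(2)[OF \<tau>_lim]) simp
    then show "\<forall>\<^sub>F n in sequentially. \<forall>\<omega>\<in>space M. (n \<ge> 1 \<and> (\<forall>i\<in>nbh n \<omega>. norm (U n i \<omega>) \<le> 2)) \<and>
      \<bar>(\<Sum>i\<in>nbh n \<omega>. q (U n i \<omega>)) / real (k n) - unit_ball_mean q\<bar> \<le> e1 \<longrightarrow>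
      \<bar>bias_error b n \<omega>\<bar> \<le> e"
    proof (eventually_elim, intro ballI impI, elim conjE)
      fix n \<omega> assume \<tau>d: "\<tau> n < d / 2" and n: "n \<ge> 1" and near: "\<forall>i\<in>nbh n \<omega>. norm (U n i \<omega>) \<le> 2"
        and avg: "\<bar>(\<Sum>i\<in>nbh n \<omega>. q (U n i \<omega>)) / real (k n) - unit_ball_mean q\<bar> \<le> e1"
      define y where "y = (\<tau> n)\<^sup>2 * sqrt (real (k n))"
      have k: "real (k n) > 0" "sqrt (real (k n)) > 0" using k_pos[OF n] by auto
      have y: "0 \<le> y" "y \<le> B" using B(1)[OF n] by (auto simp: y_def)
      have kk: "r / sqrt (real (k n)) = sqrt (real (k n)) * (r / real (k n))" for r
        using k by (simp add: field_simps)
      have summand: "\<bar>(\<pi> (Xs i \<omega>) - expit (\<eta> i \<omega>)) * ((1, U n i \<omega>) \<bullet> b) - (\<tau> n)\<^sup>2 * q (U n i \<omega>)\<bar> \<le> 12 * e1 * (\<tau> n)\<^sup>2"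
        if i: "i \<in> nbh n \<omega>" for i
      proof -
        let ?h = "\<tau> n *\<^sub>R U n i \<omega>"
        have Xh: "Xs i \<omega> = x + ?h" using \<tau>_pos[OF n] by (simp add: U_def)
        have U2: "norm (U n i \<omega>) \<le> 2" using near i by blast
        have nh: "norm ?h \<le> \<tau> n * 2" using U2 \<tau>_pos[OF n] by simp
        have "misfit \<pi> x ?h = (\<tau> n)\<^sup>2 * misfit \<pi> x (U n i \<omega>)"
          by (simp add: misfit_def matrix_vector_mult_scaleR power2_eq_square algebra_simps)
        then have "\<bar>\<pi> (Xs i \<omega>) - expit (\<eta> i \<omega>) - (\<tau> n)\<^sup>2 * misfit \<pi> x (U n i \<omega>)\<bar> \<le> e1 * (norm ?h)\<^sup>2"
          using d(2)[of ?h] nh \<tau>d unfolding \<eta>_def Xh by simp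
        also have "\<dots> \<le> e1 * (\<tau> n * 2)\<^sup>2" using nh e1(1) by (intro mult_left_mono power_mono) auto
        finally have "\<bar>\<pi> (Xs i \<omega>) - expit (\<eta> i \<omega>) - (\<tau> n)\<^sup>2 * misfit \<pi> x (U n i \<omega>)\<bar> * \<bar>(1, U n i \<omega>) \<bullet> b\<bar> \<le> (e1 * (\<tau> n * 2)\<^sup>2) * 3"
          using inner_pair_Basis_bound[OF b U2] e1(1) by (intro mult_mono) auto
        also have "(e1 * (\<tau> n * 2)\<^sup>2) * 3 = 12 * e1 * (\<tau> n)\<^sup>2" by (simp add: power_mult_distrib)
        also have "\<bar>\<pi> (Xs i \<omega>) - expit (\<eta> i \<omega>) - (\<tau> n)\<^sup>2 * misfit \<pi> x (U n i \<omega>)\<bar> * \<bar>(1, U n i \<omega>) \<bullet> b\<bar> =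
            \<bar>(\<pi> (Xs i \<omega>) - expit (\<eta> i \<omega>)) * ((1, U n i \<omega>) \<bullet> b) - (\<tau> n)\<^sup>2 * q (U n i \<omega>)\<bar>"
          unfolding abs_mult[symmetric] q_def by (simp only: left_diff_distrib mult.assoc)
        finally show ?thesis .
      qed
      have "\<bar>(\<Sum>i\<in>nbh n \<omega>. (\<pi> (Xs i \<omega>) - expit (\<eta> i \<omega>)) * ((1, U n i \<omega>) \<bullet> b)) - (\<tau> n)\<^sup>2 * (\<Sum>i\<in>nbh n \<omega>. q (U n i \<omega>))\<bar>
        \<le> (\<Sum>i\<in>nbh n \<omega>. 12 * e1 * (\<tau> n)\<^sup>2)"
        unfolding sum_distrib_left sum_subtractf[symmetric]
        by (intro order_trans[OF sum_abs] sum_mono summand)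
      also have "\<dots> = real (k n) * (12 * e1 * (\<tau> n)\<^sup>2)" by (simp add: card_nbh[OF n])
      finally have "\<bar>(\<Sum>i\<in>nbh n \<omega>. (\<pi> (Xs i \<omega>) - expit (\<eta> i \<omega>)) * ((1, U n i \<omega>) \<bullet> b)) - (\<tau> n)\<^sup>2 * (\<Sum>i\<in>nbh n \<omega>. q (U n i \<omega>))\<bar> / sqrt (real (k n))
        \<le> real (k n) * (12 * e1 * (\<tau> n)\<^sup>2) / sqrt (real (k n))"
        using k by (intro divide_right_mono) auto
      also have "\<dots> = 12 * e1 * y" unfolding kk y_def using k by simp
      finally have 1: "\<bar>(\<Sum>i\<in>nbh n \<omega>. (\<pi> (Xs i \<omega>) - expit (\<eta> i \<omega>)) * ((1, U n i \<omega>) \<bullet> b)) / sqrt (real (k n)) -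
          (\<tau> n)\<^sup>2 * (\<Sum>i\<in>nbh n \<omega>. q (U n i \<omega>)) / sqrt (real (k n))\<bar> \<le> 12 * e1 * y"
        using k by (simp add: diff_divide_distrib[symmetric] abs_divide)
      have eq: "(\<tau> n)\<^sup>2 * (\<Sum>i\<in>nbh n \<omega>. q (U n i \<omega>)) / sqrt (real (k n)) = y * ((\<Sum>i\<in>nbh n \<omega>. q (U n i \<omega>)) / real (k n))"
        unfolding kk y_def by simp
      have Tb: "T n \<bullet> b = y * unit_ball_mean q"
        unfolding T_def q_def[abs_def] unit_ball_mean_misfit[OF b] y_def
        by (simp only: inner_scaleR_left mult.assoc)
      have 2: "\<bar>(\<tau> n)\<^sup>2 * (\<Sum>i\<in>nbh n \<omega>. q (U n i \<omega>)) / sqrt (real (k n)) - T n \<bullet> b\<bar> \<le> y * e1"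
        unfolding eq Tb right_diff_distrib[symmetric] abs_mult using y avg by (intro mult_mono) auto
      have "12 * e1 * y + y * e1 = 13 * y * e1" by simp
      also have "\<dots> \<le> 13 * B * e1" using y e1(1) by (intro mult_right_mono) auto
      finally show "\<bar>bias_error b n \<omega>\<bar> \<le> e"
        using 1 2 e1(2) by linarith
    qed
  qed
qed

text \<open>The score residual splits into \<open>Y - \<pi> X\<close>, the noise, and
  \<open>\<pi> X - expit \<eta>\<close>, the model error. The noise is moved from the neighbours to
  the ball; the model error is the bias.\<close>

lemma score_close:
  assumes b: "b \<in> Basis" and "e > 0"
  shows "whp M (\<lambda>n \<omega>. \<bar>score_error b n \<omega>\<bar> \<le> e)"
proof -
  have "whp M (\<lambda>n \<omega>. \<bar>nbh_noise (\<lambda>v. (1, v) \<bullet> b) n \<omega> - ball_noise (\<lambda>v. (1, v) \<bullet> b) n \<omega>\<bar> \<le> e / 2 \<and>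
     \<bar>bias_error b n \<omega>\<bar> \<le> e / 2)"
    using \<open>e > 0\<close> by (intro whp_conj bias_close[OF b] nbh_noise_close[of _ 3] comp_meas inner_pair_Basis_bound[OF b]) simp_all
  then show ?thesis
  proof (rule whp_mono, intro always_eventually allI ballI impI, elim conjE)
    fix n \<omega>
    assume 1: "\<bar>nbh_noise (\<lambda>v. (1, v) \<bullet> b) n \<omega> - ball_noise (\<lambda>v. (1, v) \<bullet> b) n \<omega>\<bar> \<le> e / 2"
      and 2: "\<bar>bias_error b n \<omega>\<bar> \<le> e / 2"
    have "(\<Sum>i\<in>nbh n \<omega>. (Ys i \<omega> - expit (\<eta> i \<omega>)) * ((1, U n i \<omega>) \<bullet> b)) / sqrt (real (k n)) =
       nbh_noise (\<lambda>v. (1, v) \<bullet> b) n \<omega> +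
       (\<Sum>i\<in>nbh n \<omega>. (\<pi> (Xs i \<omega>) - expit (\<eta> i \<omega>)) * ((1, U n i \<omega>) \<bullet> b)) / sqrt (real (k n))"
      unfolding nbh_noise_def add_divide_distrib[symmetric] sum.distrib[symmetric] distrib_right[symmetric] by simp
    then show "\<bar>score_error b n \<omega>\<bar> \<le> e"
      using 1 2 unfolding inner_add_left W_inner_Basis[OF b] by linarith
  qed
qed

definition gram :: "real \<times> (real ^ 'p) \<Rightarrow> real \<times> (real ^ 'p) \<Rightarrow> real" where
  "gram a b = unit_ball_mean (\<lambda>v. ((1, v) \<bullet> a) * ((1, v) \<bullet> b))"

abbreviation gram_error :: "real \<times> (real ^ 'p) \<Rightarrow> real \<times> (real ^ 'p) \<Rightarrow> nat \<Rightarrow> 'w \<Rightarrow> real" where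
  "gram_error a b n \<omega> \<equiv> (\<Sum>i\<in>nbh n \<omega>. ((1, U n i \<omega>) \<bullet> a) * ((1, U n i \<omega>) \<bullet> b)) / real (k n) - gram a b"

lemma gram_close:
  assumes "e > 0"
  shows "whp M (\<lambda>n \<omega>. \<bar>gram_error a b n \<omega>\<bar> \<le> e)"
proof -
  have "continuous_on UNIV (\<lambda>v. ((1, v) \<bullet> a) * ((1, v) \<bullet> b))" by (intro continuous_intros)
  then obtain C where "(\<lambda>v. ((1, v) \<bullet> a) * ((1, v) \<bullet> b)) \<in> borel_measurable borel"
    "\<And>v. norm v \<le> 2 \<Longrightarrow> \<bar>((1, v) \<bullet> a) * ((1, v) \<bullet> b)\<bar> \<le> C"
    using admissible_continuous unfolding admissible_def by blast
  from nbh_average[OF this assms] show ?thesis unfolding gram_def .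
qed

lemma gram_quadratic:
  "unit_ball_mean (\<lambda>v. (u \<bullet> (1, v))\<^sup>2) = (\<Sum>a\<in>Basis. \<Sum>b\<in>Basis. (u \<bullet> a) * (u \<bullet> b) * gram a b)"
proof -
  have adm: "admissible (\<lambda>v. (u \<bullet> a) * (u \<bullet> b) * (((1, v) \<bullet> a) * ((1, v) \<bullet> b)))"
    "admissible (\<lambda>v. \<Sum>b\<in>Basis. (u \<bullet> a) * (u \<bullet> b) * (((1, v) \<bullet> a) * ((1, v) \<bullet> b)))" for a b :: "real \<times> (real ^ 'p)"
    by (intro admissible_continuous continuous_intros)+
  show ?thesis
    unfolding inner_square_sum gram_def using adm
    by (simp only: unit_ball_mean_sum unit_ball_mean_cmult)
qed

end

lemma norm_snd_le_norm: "norm (snd u) \<le> norm u"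
  by (metis norm_snd_le prod.collapse)

context nn_logistic
begin

section \<open>Localization of the rescaled estimator\<close>

definition H :: "nat \<Rightarrow> 'w \<Rightarrow> real \<times> (real ^ 'p) \<Rightarrow> real" where
  "H n \<omega> u =
    objective n \<omega>
      (l0 + fst u / sqrt (real (k n)), g0 + (1 / rate n) *\<^sub>R snd u) -
    objective n \<omega> (l0, g0)"

lemma concave_H: "n \<ge> 1 \<Longrightarrow> concave_on UNIV (H n \<omega>)"
  unfolding H_def[abs_def]
  by (rule concave_on_penalized_loglik[OF l_nonneg, where ?p1.0 = "\<lambda>u. l0 + fst u / sqrt (real (k n))"
        and ?p2.0 = "\<lambda>u. g0 + (1 / rate n) *\<^sub>R snd u"])
    (simp_all add: algebra_simps add_divide_distrib diff_divide_distrib)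

lemma H_rescaled:
  assumes "n \<ge> 1"
  shows "H n \<omega> (sqrt (real (k n)) * (a - l0), rate n *\<^sub>R (b - g0)) =
    objective n \<omega> (a, b) -
    objective n \<omega> (l0, g0)"
  using k_pos[OF assms] rate_pos[OF assms] by (simp add: H_def)

text \<open>Rescaling is a bijection of the parameter space, so a maximizer of \<open>H\<close>
  yields one of the objective; its existence triggers the defining property of the estimator, which
  is carried back to \<open>Z\<close>.\<close>

lemma Z_is_arg_max:
  assumes n: "n \<ge> 1"
    and est: "estimates n \<omega>"
    and ex: "\<exists>u. is_arg_max (H n \<omega>) (\<lambda>_. True) u"
  shows "is_arg_max (H n \<omega>) (\<lambda>_. True) (Z n \<omega>)"
proof -
  let ?L = "objective n \<omega>"
  obtain u where u: "\<And>v. H n \<omega> v \<le> H n \<omega> u" using ex by (auto simp: is_arg_max_linorder)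
  have "?L (a, b) \<le> ?L (l0 + fst u / sqrt (real (k n)), g0 + (1 / rate n) *\<^sub>R snd u)" for a b
    using u[of "(sqrt (real (k n)) * (a - l0), rate n *\<^sub>R (b - g0))"]
    unfolding H_rescaled[OF n] by (simp add: H_def)
  then have "is_arg_max ?L (\<lambda>_. True) (l0 + fst u / sqrt (real (k n)), g0 + (1 / rate n) *\<^sub>R snd u)"
    unfolding is_arg_max_linorder by auto
  then have "is_arg_max ?L (\<lambda>_. True) (a_hat n \<omega>, b_hat n \<omega>)" using est by blast
  then have max: "?L ab \<le> ?L (a_hat n \<omega>, b_hat n \<omega>)" for ab
    unfolding is_arg_max_linorder by blast
  have "H n \<omega> v \<le> H n \<omega> (Z n \<omega>)" for v
    unfolding Z_def H_rescaled[OF n] unfolding H_def using max by simp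
  then show ?thesis by (simp add: is_arg_max_linorder)
qed

lemma limit_objective_eq:
  "limit_objective \<pi> f c x V u = u \<bullet> V - w0 * unit_ball_mean (\<lambda>v. (u \<bullet> (1, v))\<^sup>2) / 2 - \<kappa> * l1_slope g0 (snd u)"
  unfolding limit_objective_def Let_def inner_Gamma_op l1_slope_def \<kappa>_def g0_def w0_def by simp

text \<open>A pointwise statement on a good event. \<open>small\<close> bounds the variation of the
  logistic weights over the neighbours, as these weights are 1-Lipschitz in the predictor;
  \<open>pen\<close> prevents nonzero slope components from changing sign.\<close>

lemma H_expansion:
  assumes n: "n \<ge> 1" and near: "\<forall>i\<in>nbh n \<omega>. norm (U n i \<omega>) \<le> 2"
    and gr: "\<forall>ab\<in>Basis \<times> Basis. \<bar>gram_error (fst ab) (snd ab) n \<omega>\<bar> \<le> \<delta>"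
    and sc: "\<forall>b\<in>Basis. \<bar>score_error b n \<omega>\<bar> \<le> \<delta>"
    and small: "norm g0 * (2 * \<tau> n) \<le> \<delta>"
    and pen: "\<And>j. g0 $ j \<noteq> 0 \<Longrightarrow> K \<le> rate n * \<bar>g0 $ j\<bar>"
    and K: "norm u \<le> K"
  defines "D \<equiv> real DIM(real \<times> (real ^ 'p))"
  shows "\<bar>H n \<omega> u - limit_objective \<pi> f c x (W n \<omega> + T n) u\<bar> \<le>
    D * K * \<delta> + w0 * (D\<^sup>2 * K\<^sup>2 * \<delta>) / 2 + 9 * K\<^sup>2 * \<delta> / 2 + 27 * K ^ 3 / sqrt (real (k n)) +
    \<bar>l n / rate n - \<kappa>\<bar> * (real CARD('p) * K)"
proof -
  have k: "k n > 0" using k_pos[OF n] by simp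
  define d where "d i = (u \<bullet> (1, U n i \<omega>)) / sqrt (real (k n))" for i
  have lin: "l0 + fst u / sqrt (real (k n)) + (g0 + (1 / rate n) *\<^sub>R snd u) \<bullet> (Xs i \<omega> - x) = \<eta> i \<omega> + d i" for i
  proof -
    have "(1 / rate n) * (snd u \<bullet> (Xs i \<omega> - x)) = (snd u \<bullet> U n i \<omega>) / sqrt (real (k n))"
      unfolding U_def rate_def by simp
    then show ?thesis
      by (simp add: \<eta>_def d_def inner_add_left inner_prod_def add_divide_distrib)
  qed
  have loglik: "H n \<omega> u = (\<Sum>i\<in>nbh n \<omega>. Ys i \<omega> * (\<eta> i \<omega> + d i) - softplus (\<eta> i \<omega> + d i)) -
      (\<Sum>i\<in>nbh n \<omega>. Ys i \<omega> * \<eta> i \<omega> - softplus (\<eta> i \<omega>)) -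
      l n * (norm1 (g0 + (1 / rate n) *\<^sub>R snd u) - norm1 g0)"
    unfolding H_def penalized_loglik_def local_loglik_def prod.case loglik_term nbh_def[symmetric] lin \<eta>_def[symmetric]
    by (simp add: algebra_simps)
  have "norm1 (g0 + (1 / rate n) *\<^sub>R snd u) - norm1 g0 = l1_slope g0 (snd u) / rate n"
    unfolding l1_slope_def
  proof (rule penalty_increment[OF rate_pos[OF n]])
    fix j assume "g0 $ j \<noteq> 0"
    have "\<bar>snd u $ j\<bar> \<le> norm (snd u)" by (rule component_le_norm_cart)
    also have "\<dots> \<le> norm u" by (rule norm_snd_le_norm)
    finally show "\<bar>snd u $ j\<bar> \<le> rate n * \<bar>g0 $ j\<bar>" using K pen[OF \<open>g0 $ j \<noteq> 0\<close>] by linarith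
  qed
  then have penalty: "\<bar>l n * (norm1 (g0 + (1 / rate n) *\<^sub>R snd u) - norm1 g0) - \<kappa> * l1_slope g0 (snd u)\<bar> \<le>
      \<bar>l n / rate n - \<kappa>\<bar> * (real CARD('p) * K)"
  proof -
    have "\<bar>l1_slope g0 (snd u)\<bar> \<le> real CARD('p) * norm (snd u)" by (rule l1_slope_bound)
    also have "\<dots> \<le> real CARD('p) * K" using K norm_snd_le_norm[of u] by (intro mult_left_mono) auto
    finally have "\<bar>l n / rate n - \<kappa>\<bar> * \<bar>l1_slope g0 (snd u)\<bar> \<le> \<bar>l n / rate n - \<kappa>\<bar> * (real CARD('p) * K)"
      by (intro mult_left_mono) auto
    moreover assume "norm1 (g0 + (1 / rate n) *\<^sub>R snd u) - norm1 g0 = l1_slope g0 (snd u) / rate n"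
    ultimately show ?thesis by (simp add: abs_mult[symmetric] left_diff_distrib)
  qed
  have main: "\<bar>(\<Sum>i\<in>nbh n \<omega>. Ys i \<omega> * (\<eta> i \<omega> + d i) - softplus (\<eta> i \<omega> + d i)) -
      (\<Sum>i\<in>nbh n \<omega>. Ys i \<omega> * \<eta> i \<omega> - softplus (\<eta> i \<omega>)) -
      (u \<bullet> (W n \<omega> + T n) - w0 * unit_ball_mean (\<lambda>v. (u \<bullet> (1, v))\<^sup>2) / 2)\<bar> \<le>
      D * K * \<delta> + w0 * (D\<^sup>2 * K\<^sup>2 * \<delta>) / 2 + 9 * K\<^sup>2 * \<delta> / 2 + 27 * K ^ 3 / sqrt (real (k n))"
    unfolding d_def D_def
  proof (rule loglik_expansion[where m = gram])
    show "finite (nbh n \<omega>)" "card (nbh n \<omega>) = k n" "k n > 0" using k card_nbh[OF n] by auto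
    show "norm (U n i \<omega>) \<le> 2" if "i \<in> nbh n \<omega>" for i using near that by blast
    show "\<bar>expit (\<eta> i \<omega>) * (1 - expit (\<eta> i \<omega>)) - w0\<bar> \<le> \<delta>" if "i \<in> nbh n \<omega>" for i
    proof -
      have "\<bar>expit (\<eta> i \<omega>) * (1 - expit (\<eta> i \<omega>)) - w0\<bar> \<le> \<bar>\<eta> i \<omega> - l0\<bar>"
        using expit_lipschitz_deriv[of "\<eta> i \<omega>" l0] unfolding expit_l0 w0_def .
      also have "\<dots> = \<bar>g0 \<bullet> (Xs i \<omega> - x)\<bar>" by (simp add: \<eta>_def)
      also have "\<dots> \<le> norm g0 * norm (Xs i \<omega> - x)" by (rule Cauchy_Schwarz_ineq2)
      also have "\<dots> \<le> norm g0 * (2 * \<tau> n)"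
        using near that norm_U_le[OF n, of i \<omega> 2] by (intro mult_left_mono) (auto simp: dist_norm)
      finally show ?thesis using small by linarith
    qed
    show "\<bar>gram_error a b n \<omega>\<bar> \<le> \<delta>"
      if "a \<in> Basis" "b \<in> Basis" for a b using gr that by auto
    show "\<bar>score_error b n \<omega>\<bar> \<le> \<delta>"
      if "b \<in> Basis" for b using sc that by blast
    show "unit_ball_mean (\<lambda>v. (u \<bullet> (1, v))\<^sup>2) = (\<Sum>a\<in>Basis. \<Sum>b\<in>Basis. (u \<bullet> a) * (u \<bullet> b) * gram a b)" for u
      by (rule gram_quadratic)
    show "w0 \<ge> 0" using w0_pos by simp
  qed (rule K)
  show ?thesis unfolding loglik limit_objective_eq using main penalty by linarith
qed

text \<open>The limit objective vanishes at 0, so the quadratic gap bounds a multiple of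
  \<open>(norm A)\<^sup>2\<close> by the value at the maximizer, and this value grows at most
  linearly in \<open>norm A\<close>. Dividing by \<open>norm A\<close> gives the claim.\<close>

lemma A_bound: "w0 / (2 * (real CARD('p) + 2)) * norm (A n \<omega>) \<le> norm (W n \<omega> + T n) + \<kappa> * real CARD('p)"
proof (cases "A n \<omega> = 0")
  case True
  then show ?thesis by (simp add: \<kappa>_def)
next
  case False
  let ?V = "W n \<omega> + T n" and ?A = "A n \<omega>"
  have k0: "\<kappa> \<ge> 0" by (simp add: \<kappa>_def)
  have "limit_objective \<pi> f c x ?V 0 = 0"
    by (simp add: limit_objective_eq l1_slope_def unit_ball_mean_const[of 0])
  then have "w0 / (2 * (real CARD('p) + 2)) * (norm ?A)\<^sup>2 \<le> limit_objective \<pi> f c x ?V ?A"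
    using limit_argmax_gap[of \<pi> x f c ?V 0, OF \<pi>01] by (simp add: A_def w0_def)
  also have "\<dots> \<le> norm ?A * norm ?V + \<kappa> * (real CARD('p) * norm ?A)"
  proof -
    have "?A \<bullet> ?V \<le> norm ?A * norm ?V" by (rule norm_cauchy_schwarz)
    moreover have "w0 * unit_ball_mean (\<lambda>v. (?A \<bullet> (1, v))\<^sup>2) \<ge> 0"
      unfolding unit_ball_mean_affine_square using w0_pos by simp
    moreover have "- (\<kappa> * l1_slope g0 (snd ?A)) \<le> \<kappa> * (real CARD('p) * norm ?A)"
    proof -
      have "- l1_slope g0 (snd ?A) \<le> real CARD('p) * norm (snd ?A)" using l1_slope_bound[of g0 "snd ?A"] by linarith
      also have "\<dots> \<le> real CARD('p) * norm ?A" by (intro mult_left_mono norm_snd_le_norm) simp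
      finally show ?thesis using mult_left_mono[OF _ k0] by fastforce
    qed
    ultimately show ?thesis unfolding limit_objective_eq by linarith
  qed
  finally have "norm ?A * (w0 / (2 * (real CARD('p) + 2)) * norm ?A) \<le> norm ?A * (norm ?V + \<kappa> * real CARD('p))"
    by (simp only: power2_eq_square distrib_left mult_ac)
  from mult_left_le_imp_le[OF this] show ?thesis using False by simp
qed

text \<open>A bound on \<open>W\<close> confines \<open>A\<close> to a fixed ball, on which the
  expansion of \<open>H\<close> is uniform. There \<open>H\<close> inherits a strict drop from
  \<open>A\<close> to the sphere of radius \<open>e\<close> around it, and concavity does the
  rest.\<close>

lemma est_close:
  assumes "e > 0"
  shows "whp M (\<lambda>n \<omega>. norm (W n \<omega>) \<le> K \<longrightarrow> norm (Z n \<omega> - A n \<omega>) < e)"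
proof -
  obtain B where B: "\<And>n. n \<ge> 1 \<Longrightarrow> (\<tau> n)\<^sup>2 * sqrt (real (k n)) \<le> B" "B \<ge> 0"
    using bias_scale_bounded[OF k_upper] by blast
  define \<gamma> where "\<gamma> = w0 / (2 * (real CARD('p) + 2))"
  have \<gamma>: "\<gamma> > 0" using w0_pos by (simp add: \<gamma>_def add_pos_pos)
  \<comment> \<open>The quotient bounds \<open>norm A\<close> when \<open>norm W \<le> K\<close>;
    adding \<open>e\<close> places the whole sphere around \<open>A\<close> inside the ball of
    radius \<open>KA\<close>.\<close>
  define KA where "KA = (\<bar>K\<bar> + B * \<bar>bias_coeff \<pi> x\<bar> + \<kappa> * real CARD('p)) / \<gamma> + e"
  have k0: "\<kappa> \<ge> 0" by (simp add: \<kappa>_def)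
  have KA0: "KA > 0" unfolding KA_def using \<gamma> k0 B(2) \<open>e > 0\<close> by (intro add_nonneg_pos) auto
  \<comment> \<open>The limit objective drops by \<open>\<gamma> * e\<^sup>2 = 4 * \<theta>\<close>
    on the sphere. An approximation error \<open>\<theta>\<close> at each of the two compared points
    still leaves a positive drop for \<open>H\<close>.\<close>
  define \<theta> where "\<theta> = \<gamma> * e\<^sup>2 / 4"
  have \<theta>: "\<theta> > 0" using \<gamma> \<open>e > 0\<close> by (simp add: \<theta>_def)
  define D where "D = real DIM(real \<times> (real ^ 'p))"
  \<comment> \<open>\<open>Q - 1\<close> collects the coefficients of \<open>\<delta>\<close> in the
    error of the expansion, and the 1 keeps \<open>Q\<close> positive. These errors get a third of
    \<open>\<theta>\<close>; the cubic remainder and the penalty get the other two thirds.\<close>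
  define Q where "Q = D * KA + w0 * (D\<^sup>2 * KA\<^sup>2) / 2 + 9 * KA\<^sup>2 / 2 + 1"
  have "D * KA \<ge> 0" "w0 * (D\<^sup>2 * KA\<^sup>2) / 2 \<ge> 0" "9 * KA\<^sup>2 / 2 \<ge> 0"
    using KA0 w0_pos by (auto simp: D_def)
  then have Q: "Q > 0" unfolding Q_def by linarith
  define \<delta> where "\<delta> = \<theta> / (3 * Q)"
  have \<delta>: "\<delta> > 0" "D * KA * \<delta> + w0 * (D\<^sup>2 * KA\<^sup>2 * \<delta>) / 2 + 9 * KA\<^sup>2 * \<delta> / 2 \<le> \<theta> / 3"
  proof -
    show d: "\<delta> > 0" using \<theta> Q by (simp add: \<delta>_def)
    have "D * KA * \<delta> + w0 * (D\<^sup>2 * KA\<^sup>2 * \<delta>) / 2 + 9 * KA\<^sup>2 * \<delta> / 2 = (Q - 1) * \<delta>"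
      by (simp add: Q_def field_simps)
    also have "\<dots> \<le> Q * \<delta>" using d by (intro mult_right_mono) auto
    also have "\<dots> = \<theta> / 3" using Q by (simp add: \<delta>_def)
    finally show "D * KA * \<delta> + w0 * (D\<^sup>2 * KA\<^sup>2 * \<delta>) / 2 + 9 * KA\<^sup>2 * \<delta> / 2 \<le> \<theta> / 3" .
  qed
  have ev: "\<forall>\<^sub>F n in sequentially. norm g0 * (2 * \<tau> n) < \<delta> \<and> 27 * KA ^ 3 / sqrt (real (k n)) < \<theta> / 3 \<and>
      \<bar>l n / rate n - \<kappa>\<bar> * (real CARD('p) * KA) < \<theta> / 3 \<and> (\<forall>j\<in>UNIV. g0 $ j \<noteq> 0 \<longrightarrow> KA \<le> rate n * \<bar>g0 $ j\<bar>)"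
  proof (intro eventually_conj)
    have "(\<lambda>n. norm g0 * (2 * \<tau> n)) \<longlonglongrightarrow> norm g0 * (2 * 0)" by (intro tendsto_intros \<tau>_lim)
    then show "\<forall>\<^sub>F n in sequentially. norm g0 * (2 * \<tau> n) < \<delta>" using \<delta>(1) by (intro order_tendstoD(2)) auto
    have "(\<lambda>n. 27 * KA ^ 3 * sqrt (1 / real (k n))) \<longlonglongrightarrow> 27 * KA ^ 3 * sqrt 0"
      by (intro tendsto_mult tendsto_const tendsto_real_sqrt inverse_k_lim)
    then have "(\<lambda>n. 27 * KA ^ 3 / sqrt (real (k n))) \<longlonglongrightarrow> 0" by (simp add: real_sqrt_divide)
    then show "\<forall>\<^sub>F n in sequentially. 27 * KA ^ 3 / sqrt (real (k n)) < \<theta> / 3"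
      using \<theta> by (intro order_tendstoD(2)) auto
    have "(\<lambda>n. l n / rate n) \<longlonglongrightarrow> \<kappa>" unfolding \<kappa>_def by (rule penalty_lim[OF l_nonneg l_lim])
    then have "(\<lambda>n. \<bar>l n / rate n - \<kappa>\<bar> * (real CARD('p) * KA)) \<longlonglongrightarrow> \<bar>\<kappa> - \<kappa>\<bar> * (real CARD('p) * KA)"
      by (intro tendsto_intros)
    then show "\<forall>\<^sub>F n in sequentially. \<bar>l n / rate n - \<kappa>\<bar> * (real CARD('p) * KA) < \<theta> / 3"
      using \<theta> by (intro order_tendstoD(2)) auto
    show "\<forall>\<^sub>F n in sequentially. \<forall>j\<in>UNIV. g0 $ j \<noteq> 0 \<longrightarrow> KA \<le> rate n * \<bar>g0 $ j\<bar>"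
    proof (rule eventually_ball_finite)
      show "\<forall>j\<in>UNIV. \<forall>\<^sub>F n in sequentially. g0 $ j \<noteq> 0 \<longrightarrow> KA \<le> rate n * \<bar>g0 $ j\<bar>"
      proof
        fix j
        show "\<forall>\<^sub>F n in sequentially. g0 $ j \<noteq> 0 \<longrightarrow> KA \<le> rate n * \<bar>g0 $ j\<bar>"
          using filterlim_at_top[THEN iffD1, OF rate_at_top[OF k_lower], rule_format, of "KA / \<bar>g0 $ j\<bar>"]
          by eventually_elim (auto simp: divide_le_eq)
      qed
    qed simp
  qed
  have "whp M (\<lambda>n \<omega>. (n \<ge> 1 \<and> (\<forall>i\<in>nbh n \<omega>. norm (U n i \<omega>) \<le> 2)) \<and>
     (\<forall>ab\<in>Basis \<times> Basis. \<bar>gram_error (fst ab) (snd ab) n \<omega>\<bar> \<le> \<delta>) \<and>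
     (\<forall>b\<in>Basis. \<bar>score_error b n \<omega>\<bar> \<le> \<delta>) \<and>
     (estimates n \<omega>))"
    using \<delta>(1) by (intro whp_conj whp_ball whp_nbh_ball gram_close score_close whp_AE eventually_sequentiallyI[of 1] est_max) auto
  then show ?thesis
  proof (rule whp_mono)
    show "\<forall>\<^sub>F n in sequentially. \<forall>\<omega>\<in>space M. (n \<ge> 1 \<and> (\<forall>i\<in>nbh n \<omega>. norm (U n i \<omega>) \<le> 2)) \<and>
     (\<forall>ab\<in>Basis \<times> Basis. \<bar>gram_error (fst ab) (snd ab) n \<omega>\<bar> \<le> \<delta>) \<and>
     (\<forall>b\<in>Basis. \<bar>score_error b n \<omega>\<bar> \<le> \<delta>) \<and>
     (estimates n \<omega>) \<longrightarrow>
      norm (W n \<omega>) \<le> K \<longrightarrow> norm (Z n \<omega> - A n \<omega>) < e"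
      using ev
    proof (eventually_elim, intro ballI impI, elim conjE)
      fix n \<omega>
      assume n: "n \<ge> 1" and near: "\<forall>i\<in>nbh n \<omega>. norm (U n i \<omega>) \<le> 2"
        and gr: "\<forall>ab\<in>Basis \<times> Basis. \<bar>gram_error (fst ab) (snd ab) n \<omega>\<bar> \<le> \<delta>"
        and sc: "\<forall>b\<in>Basis. \<bar>score_error b n \<omega>\<bar> \<le> \<delta>"
        and est: "estimates n \<omega>"
        and WK: "norm (W n \<omega>) \<le> K"
        and small: "norm g0 * (2 * \<tau> n) < \<delta>" and s2: "27 * KA ^ 3 / sqrt (real (k n)) < \<theta> / 3"
        and s3: "\<bar>l n / rate n - \<kappa>\<bar> * (real CARD('p) * KA) < \<theta> / 3"
        and pen: "\<forall>j\<in>UNIV. g0 $ j \<noteq> 0 \<longrightarrow> KA \<le> rate n * \<bar>g0 $ j\<bar>"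
      let ?Q = "limit_objective \<pi> f c x (W n \<omega> + T n)"
      have HQ: "\<bar>H n \<omega> u - ?Q u\<bar> \<le> \<theta>" if "norm u \<le> KA" for u
      proof -
        have "\<bar>H n \<omega> u - ?Q u\<bar> \<le> D * KA * \<delta> + w0 * (D\<^sup>2 * KA\<^sup>2 * \<delta>) / 2 + 9 * KA\<^sup>2 * \<delta> / 2 +
            27 * KA ^ 3 / sqrt (real (k n)) + \<bar>l n / rate n - \<kappa>\<bar> * (real CARD('p) * KA)"
          unfolding D_def using pen that by (intro H_expansion[OF n near gr sc less_imp_le[OF small]]) auto
        then show ?thesis using \<delta>(2) s2 s3 by linarith
      qed
      have TB: "norm (T n) \<le> B * \<bar>bias_coeff \<pi> x\<bar>"
      proof -
        have "norm (T n) = \<bar>(\<tau> n)\<^sup>2 * sqrt (real (k n))\<bar> * \<bar>bias_coeff \<pi> x\<bar>"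
          by (simp add: T_def norm_Pair abs_mult)
        also have "\<dots> \<le> B * \<bar>bias_coeff \<pi> x\<bar>" using B(1)[OF n] by (intro mult_right_mono) auto
        finally show ?thesis .
      qed
      have "\<gamma> * norm (A n \<omega>) \<le> \<bar>K\<bar> + B * \<bar>bias_coeff \<pi> x\<bar> + \<kappa> * real CARD('p)"
        using A_bound[of n \<omega>] norm_triangle_ineq[of "W n \<omega>" "T n"] WK TB unfolding \<gamma>_def[symmetric] by linarith
      then have "norm (A n \<omega>) \<le> (\<bar>K\<bar> + B * \<bar>bias_coeff \<pi> x\<bar> + \<kappa> * real CARD('p)) / \<gamma>"
        using \<gamma> by (simp add: le_divide_eq mult.commute)
      then have AK: "norm (A n \<omega>) + e \<le> KA" unfolding KA_def by simp
      have "(\<exists>u. is_arg_max (H n \<omega>) (\<lambda>_. True) u) \<and> (\<forall>u. is_arg_max (H n \<omega>) (\<lambda>_. True) u \<longrightarrow> norm (u - A n \<omega>) < e)"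
      proof (rule concave_on_argmax_near[OF concave_H[OF n] \<open>e > 0\<close>])
        fix u assume u: "norm (u - A n \<omega>) = e"
        have "norm u \<le> norm (A n \<omega>) + norm (u - A n \<omega>)" by (metis add.commute norm_triangle_sub)
        then have "\<bar>H n \<omega> u - ?Q u\<bar> \<le> \<theta>" "\<bar>H n \<omega> (A n \<omega>) - ?Q (A n \<omega>)\<bar> \<le> \<theta>"
          using AK u \<open>e > 0\<close> by (intro HQ; linarith)+
        moreover have "?Q u \<le> ?Q (A n \<omega>) - \<gamma> * e\<^sup>2"
          using limit_argmax_gap[of \<pi> x f c "W n \<omega> + T n" u, OF \<pi>01]
          unfolding A_def[symmetric] w0_def[symmetric] \<gamma>_def[symmetric] u .
        moreover have "\<gamma> * e\<^sup>2 = 4 * \<theta>" by (simp add: \<theta>_def)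
        ultimately show "H n \<omega> u < H n \<omega> (A n \<omega>)" using \<theta> by linarith
      qed
      then show "norm (Z n \<omega> - A n \<omega>) < e"
        using Z_is_arg_max[OF n est] by blast
    qed
  qed
qed

text \<open>Tightness of \<open>W\<close> removes the restriction to bounded scores at the price of
  probability \<open>d / 2\<close>.\<close>

lemma Z_minus_A_small:
  assumes "e > 0"
  shows "whp M (\<lambda>n \<omega>. norm (Z n \<omega> - A n \<omega>) \<le> e)"
  unfolding whp_def
proof (intro allI impI)
  fix d :: real assume "d > 0"
  then obtain K where K: "\<And>n. prob {\<omega> \<in> space M. norm (W n \<omega>) > K} \<le> d / 2"
    using W_tight[of "d / 2"] by (meson half_gt_zero order_refl)
  have "\<forall>\<^sub>F n in sequentially. \<exists>E\<in>events. prob E \<le> d / 2 \<and>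
      {\<omega> \<in> space M. \<not> (norm (W n \<omega>) \<le> K \<longrightarrow> norm (Z n \<omega> - A n \<omega>) < e)} \<subseteq> E"
    using est_close[OF assms, of K] \<open>d > 0\<close> unfolding whp_def by (meson half_gt_zero)
  then show "\<forall>\<^sub>F n in sequentially. \<exists>E\<in>events. prob E \<le> d \<and> {\<omega> \<in> space M. \<not> norm (Z n \<omega> - A n \<omega>) \<le> e} \<subseteq> E"
  proof eventually_elim
    case (elim n)
    then obtain E where E: "E \<in> events" "prob E \<le> d / 2"
      "{\<omega> \<in> space M. \<not> (norm (W n \<omega>) \<le> K \<longrightarrow> norm (Z n \<omega> - A n \<omega>) < e)} \<subseteq> E" by blast
    let ?F = "{\<omega> \<in> space M. norm (W n \<omega>) > K}"
    have F: "?F \<in> events" by measurable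
    have "prob (E \<union> ?F) \<le> d" using measure_Un_le[OF E(1) F] E(2) K[of n] by linarith
    moreover have "{\<omega> \<in> space M. \<not> norm (Z n \<omega> - A n \<omega>) \<le> e} \<subseteq> E \<union> ?F"
      using E(3) by (auto simp: not_le subset_eq)
    ultimately show ?case using E(1) F by (intro bexI[of _ "E \<union> ?F"]) auto
  qed
qed

lemma A_meas [measurable]: "A n \<in> borel_measurable M"
proof -
  have [measurable]: "limit_argmax \<pi> f c x \<in> borel_measurable borel"
    by (rule borel_measurable_continuous_onI[OF continuous_limit_argmax])
  show ?thesis unfolding A_def[abs_def] by measurable
qed

end

section \<open>The theorem\<close>

lemma penalized_loglik_cong:
  assumes "\<And>i. i \<in> {1..n} \<Longrightarrow> ys i = ys' i" "\<And>i. i \<in> {1..n} \<Longrightarrow> xs i = xs' i"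
  shows "penalized_loglik n k l ys xs x = penalized_loglik n k l ys' xs' x"
proof -
  have N: "nearest n k xs x = nearest n k xs' x" by (rule nearest_cong) (rule assms(2))
  have "(\<Sum>i\<in>nearest n k xs x. ys i * ln (expit (a + b \<bullet> (xs i - x))) + (1 - ys i) * ln (1 - expit (a + b \<bullet> (xs i - x)))) =
     (\<Sum>i\<in>nearest n k xs' x. ys' i * ln (expit (a + b \<bullet> (xs' i - x))) + (1 - ys' i) * ln (1 - expit (a + b \<bullet> (xs' i - x))))" for a b
    unfolding N
  proof (rule sum.cong[OF refl])
    fix i assume "i \<in> nearest n k xs' x"
    then have "i \<in> {1..n}" using nearest_subset by blast
    then show "ys i * ln (expit (a + b \<bullet> (xs i - x))) + (1 - ys i) * ln (1 - expit (a + b \<bullet> (xs i - x))) =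
      ys' i * ln (expit (a + b \<bullet> (xs' i - x))) + (1 - ys' i) * ln (1 - expit (a + b \<bullet> (xs' i - x)))"
      by (simp only: assms)
  qed
  then show ?thesis
    unfolding penalized_loglik_def local_loglik_def by (simp add: fun_eq_iff)
qed

lemma C2_at_isCont:
  assumes "C2_at f x" shows "isCont f x"
proof -
  have "f differentiable (at x)"
    using assms eventually_nhds_x_imp_x unfolding C2_at_def by blast
  then show ?thesis by (rule differentiable_imp_continuous_within)
qed

text \<open>The fraction is \<open>k powr (1 + r) / n\<close>, bounded, times
  \<open>k powr (- r)\<close>, which vanishes. With \<open>r = p / 4\<close> the upper growth
  condition makes the neighbourhood shrink.\<close>

lemma neighbour_fraction_lim:
  assumes k: "filterlim k at_top sequentially" and "r > 0"
    and b: "bounded (range (\<lambda>n. real (k n) powr (1 + r) / real n))"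
    and pos: "\<And>n. n \<ge> 1 \<Longrightarrow> k n \<ge> (1::nat)"
  shows "(\<lambda>n. real (k n) / real n) \<longlonglongrightarrow> 0"
proof -
  obtain C where C: "\<And>n. \<bar>real (k n) powr (1 + r) / real n\<bar> \<le> C"
    using b unfolding bounded_iff by auto
  have rk: "filterlim (\<lambda>n. real (k n)) at_top sequentially"
    by (rule filterlim_compose[OF filterlim_real_sequentially k])
  have "(\<lambda>n. real (k n) powr (- r)) \<longlonglongrightarrow> 0"
    using \<open>r > 0\<close> by (intro tendsto_neg_powr rk) auto
  from tendsto_mult[OF tendsto_const[of C] this]
  have lim: "(\<lambda>n. C * real (k n) powr (- r)) \<longlonglongrightarrow> 0" by simp
  show ?thesis
  proof (rule tendsto_sandwich[OF _ _ tendsto_const lim])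
    show "\<forall>\<^sub>F n in sequentially. real (k n) / real n \<le> C * real (k n) powr (- r)"
      using eventually_ge_at_top[of 1]
    proof eventually_elim
      case (elim n)
      then have "real (k n) > 0" using pos[of n] by simp
      then have "real (k n) / real n = real (k n) powr (1 + r) / real n * real (k n) powr (- r)"
        by (simp add: powr_add powr_minus)
      also have "\<dots> \<le> C * real (k n) powr (- r)"
        using C[of n] by (intro mult_right_mono) auto
      finally show ?case .
    qed
  qed simp
qed

lemma (in prob_space) regression_orthogonality:
  fixes X :: "'a \<Rightarrow> 'b::euclidean_space" and Y :: "'a \<Rightarrow> real"
  assumes [measurable]: "Y \<in> borel_measurable M" "X \<in> borel_measurable M"
    and bin: "\<And>\<omega>. \<omega> \<in> space M \<Longrightarrow> Y \<omega> \<in> {0, 1}"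
    and [measurable]: "\<pi> \<in> borel_measurable borel" and \<pi>r: "\<And>z. \<pi> z \<in> {0..1}"
    and cond: "AE \<omega> in M. real_cond_exp M (vimage_algebra (space M) X borel) (\<lambda>\<omega>. indicator {1} (Y \<omega>)) \<omega> = \<pi> (X \<omega>)"
    and [measurable]: "\<psi> \<in> borel_measurable borel" and \<psi>: "\<And>z. \<bar>\<psi> z\<bar> \<le> C"
  shows "expectation (\<lambda>\<omega>. (Y \<omega> - \<pi> (X \<omega>)) * \<psi> (X \<omega>)) = 0"
proof -
  let ?F = "vimage_algebra (space M) X borel"
  have "subalgebra M ?F"
    unfolding subalgebra_def by (auto simp: sets_vimage_algebra2 intro!: measurable_sets)
  then interpret finite_measure_subalgebra M ?F by unfold_locales
  have XF: "X \<in> ?F \<rightarrow>\<^sub>M borel" by (rule measurable_vimage_algebra1) simp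
  have \<psi>F: "(\<lambda>\<omega>. \<psi> (X \<omega>)) \<in> borel_measurable ?F" by (rule measurable_compose[OF XF]) simp
  have i1: "integrable M (\<lambda>\<omega>. \<psi> (X \<omega>) * indicator {1} (Y \<omega>))"
  proof (rule integrable_const_bound[of _ C])
    have "0 \<le> C" using \<psi>[of 0] by linarith
    then show "AE \<omega> in M. norm (\<psi> (X \<omega>) * indicator {1} (Y \<omega>)) \<le> C" using \<psi> by (auto simp: indicator_def)
  qed measurable
  have i2: "integrable M (\<lambda>\<omega>. \<psi> (X \<omega>) * \<pi> (X \<omega>))"
  proof (rule integrable_const_bound[of _ C])
    have "\<bar>\<psi> z * \<pi> z\<bar> \<le> C" for z
      using mult_mono[OF \<psi>[of z], of "\<bar>\<pi> z\<bar>" 1] \<pi>r[of z] \<psi>[of z] by (simp add: abs_mult)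
    then show "AE \<omega> in M. norm (\<psi> (X \<omega>) * \<pi> (X \<omega>)) \<le> C" by simp
  qed measurable
  have "expectation (\<lambda>\<omega>. \<psi> (X \<omega>) * indicator {1} (Y \<omega>)) =
     expectation (\<lambda>\<omega>. \<psi> (X \<omega>) * real_cond_exp M ?F (\<lambda>\<omega>. indicator {1} (Y \<omega>)) \<omega>)"
    by (rule real_cond_exp_intg(2)[symmetric, OF i1 \<psi>F]) measurable
  also have "\<dots> = expectation (\<lambda>\<omega>. \<psi> (X \<omega>) * \<pi> (X \<omega>))"
    using cond by (intro integral_cong_AE) (auto intro: borel_measurable_times)
  finally have eq: "expectation (\<lambda>\<omega>. \<psi> (X \<omega>) * indicator {1} (Y \<omega>)) = expectation (\<lambda>\<omega>. \<psi> (X \<omega>) * \<pi> (X \<omega>))" .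
  have "expectation (\<lambda>\<omega>. (Y \<omega> - \<pi> (X \<omega>)) * \<psi> (X \<omega>)) =
    expectation (\<lambda>\<omega>. \<psi> (X \<omega>) * indicator {1} (Y \<omega>) - \<psi> (X \<omega>) * \<pi> (X \<omega>))"
  proof (rule Bochner_Integration.integral_cong[OF refl])
    fix \<omega> assume "\<omega> \<in> space M"
    from bin[OF this] consider "Y \<omega> = 0" | "Y \<omega> = 1" by blast
    then show "(Y \<omega> - \<pi> (X \<omega>)) * \<psi> (X \<omega>) = \<psi> (X \<omega>) * indicator {1} (Y \<omega>) - \<psi> (X \<omega>) * \<pi> (X \<omega>)"
      by cases (simp_all add: algebra_simps)
  qed
  then show ?thesis using i1 i2 eq by simp
qed

theorem theorem2:
  fixes M :: "'w measure"
    and Y :: "'w \<Rightarrow> real" and X :: "'w \<Rightarrow> real ^ 'p"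
    and Ys :: "nat \<Rightarrow> 'w \<Rightarrow> real" and Xs :: "nat \<Rightarrow> 'w \<Rightarrow> real ^ 'p"
    and \<pi> f\<^sub>X :: "real ^ 'p \<Rightarrow> real" and x :: "real ^ 'p"
    and k :: "nat \<Rightarrow> nat" and l :: "nat \<Rightarrow> real" and c :: real
    and a_hat :: "nat \<Rightarrow> 'w \<Rightarrow> real" and b_hat :: "nat \<Rightarrow> 'w \<Rightarrow> real ^ 'p"
  assumes M: "prob_space M"
    and Y_meas: "Y \<in> borel_measurable M" and X_meas: "X \<in> borel_measurable M"
    and Y_binary: "\<forall>\<omega>\<in>space M. Y \<omega> \<in> {0, 1}"
    and indep: "prob_space.indep_vars M (\<lambda>_. borel) (\<lambda>i \<omega>. (Ys i \<omega>, Xs i \<omega>)) {1..}"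
    and copies: "\<forall>i\<ge>1. distr M borel (\<lambda>\<omega>. (Ys i \<omega>, Xs i \<omega>)) = distr M borel (\<lambda>\<omega>. (Y \<omega>, X \<omega>))"
    and \<pi>_meas: "\<pi> \<in> borel_measurable borel" and \<pi>_range: "\<forall>z. \<pi> z \<in> {0..1}"
    and \<pi>_cond: "AE \<omega> in M. real_cond_exp M (vimage_algebra (space M) X borel)
                        (\<lambda>\<omega>. indicator {1} (Y \<omega>)) \<omega> = \<pi> (X \<omega>)"
    and A1: "\<forall>z. f\<^sub>X z \<ge> 0" "distributed M lborel X (\<lambda>z. ennreal (f\<^sub>X z))"
            "continuous_on UNIV f\<^sub>X" "f\<^sub>X x > 0"
    and A2: "C2_at \<pi> x" "\<pi> x \<in> {0<..<1}"
    and k_range: "\<forall>n\<ge>1. k n \<in> {1..n}" and l_nonneg: "\<forall>n\<ge>1. l n \<ge> 0"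
    and k_lim: "filterlim k at_top sequentially"
    and k_lower: "filterlim (\<lambda>n. real (k n) powr (1 + real CARD('p) / 2) / real n)
                    at_top sequentially"
    and k_upper: "bounded (range (\<lambda>n. real (k n) powr (1 + real CARD('p) / 4) / real n))"
    and c_nonneg: "c \<ge> 0"
    and l_lim: "(\<lambda>n. real n * l n ^ CARD('p) / real (k n) powr (1 + real CARD('p) / 2))
                  \<longlonglongrightarrow> c"
    and est_meas: "\<forall>n\<ge>1. a_hat n \<in> borel_measurable M" "\<forall>n\<ge>1. b_hat n \<in> borel_measurable M"
    and est_max: "\<forall>n\<ge>1. AE \<omega> in M.
          (\<exists>ab. is_arg_max
             (penalized_loglik n (k n) (l n) (\<lambda>i. Ys i \<omega>) (\<lambda>i. Xs i \<omega>) x) (\<lambda>_. True) ab) \<longrightarrow>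
          is_arg_max
             (penalized_loglik n (k n) (l n) (\<lambda>i. Ys i \<omega>) (\<lambda>i. Xs i \<omega>) x) (\<lambda>_. True)
             (a_hat n \<omega>, b_hat n \<omega>)"
  shows "\<exists>W T R S A :: nat \<Rightarrow> 'w \<Rightarrow> real \<times> (real ^ 'p).
      (\<forall>n. W n \<in> borel_measurable M \<and> T n \<in> borel_measurable M \<and> R n \<in> borel_measurable M \<and>
           S n \<in> borel_measurable M \<and> A n \<in> borel_measurable M) \<and>
      (\<exists>\<mu>. is_normal_vec 0 (Gamma_op \<pi> x) \<mu> \<and> weak_conv_vec (\<lambda>n. distr M borel (W n)) \<mu>) \<and>
      (\<forall>n\<ge>1. \<forall>\<omega>\<in>space M. T n \<omega> =
         ((tau f\<^sub>X n (k n) x)\<^sup>2 * sqrt (real (k n))) *\<^sub>R (bias_coeff \<pi> x *\<^sub>R (1, 0) + S n \<omega>)) \<and>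
      small_o_P M S \<and> small_o_P M R \<and>
      (\<forall>n\<ge>1. \<forall>\<omega>\<in>space M.
         is_arg_max (limit_objective \<pi> f\<^sub>X c x (W n \<omega> + T n \<omega>)) (\<lambda>_. True) (A n \<omega>)) \<and>
      (\<forall>n\<ge>1. distr M borel (\<lambda>\<omega>.
           (sqrt (real (k n)) * (a_hat n \<omega> - (logit \<circ> \<pi>) x),
            (tau f\<^sub>X n (k n) x * sqrt (real (k n))) *\<^sub>R (b_hat n \<omega> - gradient (logit \<circ> \<pi>) x)))
         = distr M borel (\<lambda>\<omega>. A n \<omega> + R n \<omega>))"
proof -
  interpret prob_space M by (rule M)
  define \<nu> where "\<nu> = distr M borel (\<lambda>\<omega>. (Y \<omega>, X \<omega>))"
  \<comment> \<open>The copies are binary only almost surely, and nothing is assumed about index 0.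
    The modified sample is binary everywhere and measurable at every index, has the same joint laws
    from index 1 on, and almost surely gives the same likelihood.\<close>
  define Ys' where "Ys' i \<omega> = (if i = 0 then 0 else of_bool (Ys i \<omega> = 1) :: real)" for i \<omega>
  define Xs' where "Xs' i \<omega> = (if i = 0 then x else Xs i \<omega>)" for i \<omega>
  note Y_meas[measurable] X_meas[measurable] \<pi>_meas[measurable]
  have pair [measurable]: "(\<lambda>\<omega>. (Ys i \<omega>, Xs i \<omega>)) \<in> borel_measurable M" if "i \<ge> 1" for i
    using indep that unfolding indep_vars_def by auto
  have fst_m: "fst \<in> borel_measurable (borel :: (real \<times> (real ^ 'p)) measure)"
    and snd_m: "snd \<in> borel_measurable (borel :: (real \<times> (real ^ 'p)) measure)"
    by (simp_all add: borel_prod[symmetric])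
  have Ys_m: "Ys i \<in> borel_measurable M" and Xs_m: "Xs i \<in> borel_measurable M" if "i \<ge> 1" for i
    using measurable_compose[OF pair[OF that] fst_m] measurable_compose[OF pair[OF that] snd_m] by simp_all
  have YX_m: "(\<lambda>\<omega>. (Y \<omega>, X \<omega>)) \<in> borel_measurable M" by measurable
  have Ys'_m: "Ys' i \<in> borel_measurable M" for i
  proof (cases "i = 0")
    case False
    then have [measurable]: "Ys i \<in> borel_measurable M" using Ys_m[of i] by simp
    show ?thesis unfolding Ys'_def[abs_def] using False by simp
  qed (simp add: Ys'_def[abs_def])
  have Xs'_m: "Xs' i \<in> borel_measurable M" for i
    using Xs_m[of i] by (cases "i = 0") (simp_all add: Xs'_def[abs_def])
  have bin_AE: "AE \<omega> in M. Ys i \<omega> \<in> {0, 1}" if i: "i \<ge> 1" for i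
  proof -
    let ?S = "{z :: real \<times> (real ^ 'p). fst z \<in> {0, 1}}"
    have S: "?S \<in> sets borel"
      using measurable_sets[OF fst_m, of "{0, 1}"] by (simp add: vimage_def)
    have "AE z in \<nu>. z \<in> ?S"
      unfolding \<nu>_def using S Y_binary by (subst AE_distr_iff[OF YX_m]) auto
    moreover have "distr M borel (\<lambda>\<omega>. (Ys i \<omega>, Xs i \<omega>)) = \<nu>" using copies i by (simp add: \<nu>_def)
    ultimately have "AE z in distr M borel (\<lambda>\<omega>. (Ys i \<omega>, Xs i \<omega>)). z \<in> ?S" by (simp only:)
    then show ?thesis using S by (subst (asm) AE_distr_iff[OF pair[OF i]]) auto
  qed
  have Ys'_eq: "AE \<omega> in M. Ys' i \<omega> = Ys i \<omega>" if i: "i \<ge> 1" for i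
    using bin_AE[OF i] by eventually_elim (use i in \<open>auto simp: Ys'_def\<close>)
  have law': "distr M borel (\<lambda>\<omega>. (Ys' i \<omega>, Xs' i \<omega>)) = \<nu>" if i: "i \<ge> 1" for i
  proof -
    have "distr M borel (\<lambda>\<omega>. (Ys' i \<omega>, Xs' i \<omega>)) = distr M borel (\<lambda>\<omega>. (Ys i \<omega>, Xs i \<omega>))"
    proof (rule distr_cong_AE)
      show "AE \<omega> in M. (Ys' i \<omega>, Xs' i \<omega>) = (Ys i \<omega>, Xs i \<omega>)"
        using Ys'_eq[OF i] by eventually_elim (use i in \<open>simp add: Xs'_def\<close>)
    qed (use pair[OF i] Ys'_m Xs'_m in auto)
    then show ?thesis using copies i by (simp add: \<nu>_def)
  qed
  have indep': "indep_vars (\<lambda>_. borel) (\<lambda>i \<omega>. (Ys' i \<omega>, Xs' i \<omega>)) {1..}"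
  proof -
    have m: "(\<lambda>z :: real \<times> (real ^ 'p). (of_bool (fst z = 1) :: real, snd z)) \<in> borel \<rightarrow>\<^sub>M borel"
      by (simp add: borel_prod[symmetric])
    have "indep_vars (\<lambda>_. borel) (\<lambda>i \<omega>. (\<lambda>z. (of_bool (fst z = 1) :: real, snd z)) (Ys i \<omega>, Xs i \<omega>)) {1..}"
      by (rule indep_vars_compose2[OF indep m])
    then show ?thesis
      \<comment> \<open>Thresholding the response at the value 1 acts on each pair separately, so
        independence is inherited.\<close>
      by (rule iffD1[OF indep_vars_cong, rotated -1]) (auto simp: Ys'_def Xs'_def fun_eq_iff)
  qed
  have X_law: "distr M lborel X = density lborel (\<lambda>z. ennreal (f\<^sub>X z))"
    and f_m: "(\<lambda>z. ennreal (f\<^sub>X z)) \<in> borel_measurable lborel"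
    using A1(2) by (auto simp: distributed_def)
  have snd_law: "distr M lborel (Xs' i) = distr M lborel X" if i: "i \<ge> 1" for i
  proof -
    have "distr M lborel (Xs' i) = distr (distr M borel (\<lambda>\<omega>. (Ys' i \<omega>, Xs' i \<omega>))) lborel snd"
      using Ys'_m[of i] Xs'_m[of i] snd_m by (subst distr_distr) (auto simp: o_def)
    also have "\<dots> = distr M lborel X"
      unfolding law'[OF i] \<nu>_def using YX_m snd_m by (subst distr_distr) (auto simp: o_def)
    finally show ?thesis .
  qed
  have nn: "nn_sample M Ys' Xs' \<nu> \<pi> f\<^sub>X x k"
  proof (unfold_locales)
    show "Ys' i \<omega> \<in> {0, 1}" for i \<omega> by (simp add: Ys'_def)
    show "distributed M lborel (Xs' i) (\<lambda>z. ennreal (f\<^sub>X z))" if "1 \<le> i" for i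
      using snd_law[OF that] X_law f_m Xs'_m[of i] by (simp add: distributed_def)
    show "expectation (\<lambda>\<omega>. (Ys' i \<omega> - \<pi> (Xs' i \<omega>)) * \<psi> (Xs' i \<omega>)) = 0"
      if i: "1 \<le> i" and \<psi> [measurable]: "\<psi> \<in> borel_measurable borel" "\<And>z. \<bar>\<psi> z\<bar> \<le> C" for i \<psi> C
    proof -
      let ?h = "\<lambda>z :: real \<times> (real ^ 'p). (fst z - \<pi> (snd z)) * \<psi> (snd z)"
      have h: "?h \<in> borel_measurable borel" by (simp add: borel_prod[symmetric])
      have "expectation (\<lambda>\<omega>. ?h (Ys' i \<omega>, Xs' i \<omega>)) = integral\<^sup>L \<nu> ?h"
        unfolding law'[OF i, symmetric] using Ys'_m[of i] Xs'_m[of i] by (intro integral_distr[symmetric] h) measurable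
      also have "\<dots> = expectation (\<lambda>\<omega>. ?h (Y \<omega>, X \<omega>))"
        unfolding \<nu>_def by (intro integral_distr YX_m h)
      also have "\<dots> = 0"
        using regression_orthogonality[OF Y_meas X_meas _ \<pi>_meas _ \<pi>_cond \<psi>] Y_binary \<pi>_range by simp
      finally show ?thesis by simp
    qed
    show "isCont \<pi> x" by (rule C2_at_isCont[OF A2(1)])
    show "(\<lambda>n. real (k n) / real n) \<longlonglongrightarrow> 0"
      using k_range by (intro neighbour_fraction_lim[OF k_lim _ k_upper]) auto
  qed (use Ys'_m Xs'_m indep' law' \<pi>_meas \<pi>_range A1 k_range k_lim in auto)
  have loglik_eq: "AE \<omega> in M. penalized_loglik n (k n) (l n) (\<lambda>i. Ys' i \<omega>) (\<lambda>i. Xs' i \<omega>) x =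
      penalized_loglik n (k n) (l n) (\<lambda>i. Ys i \<omega>) (\<lambda>i. Xs i \<omega>) x" for n
  proof -
    have "AE \<omega> in M. \<forall>i\<in>{1..n}. Ys' i \<omega> = Ys i \<omega>"
      by (intro AE_finite_allI) (auto intro: Ys'_eq)
    then show ?thesis
      by eventually_elim (rule penalized_loglik_cong, auto simp: Xs'_def)
  qed
  interpret L: nn_logistic M Ys' Xs' \<nu> \<pi> f\<^sub>X x k l c a_hat b_hat
  proof (intro nn_logistic.intro nn nn_logistic_axioms.intro)
    fix n :: nat assume "1 \<le> n"
    then have "AE \<omega> in M.
          (\<exists>ab. is_arg_max (penalized_loglik n (k n) (l n) (\<lambda>i. Ys i \<omega>) (\<lambda>i. Xs i \<omega>) x) (\<lambda>_. True) ab) \<longrightarrow>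
          is_arg_max (penalized_loglik n (k n) (l n) (\<lambda>i. Ys i \<omega>) (\<lambda>i. Xs i \<omega>) x) (\<lambda>_. True) (a_hat n \<omega>, b_hat n \<omega>)"
      using est_max by blast
    with loglik_eq[of n] show "AE \<omega> in M.
          (\<exists>ab. is_arg_max (penalized_loglik n (k n) (l n) (\<lambda>i. Ys' i \<omega>) (\<lambda>i. Xs' i \<omega>) x) (\<lambda>_. True) ab) \<longrightarrow>
          is_arg_max (penalized_loglik n (k n) (l n) (\<lambda>i. Ys' i \<omega>) (\<lambda>i. Xs' i \<omega>) x) (\<lambda>_. True) (a_hat n \<omega>, b_hat n \<omega>)"
      by eventually_elim (simp only:)
  qed (use A2 l_nonneg k_lower k_upper l_lim in auto)
  \<comment> \<open>The value at \<open>n = 0\<close> is set to 0 because the estimators are known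
    to be measurable only from \<open>n = 1\<close> on.\<close>
  define R where "R n \<omega> = (if n = 0 then 0 else L.Z n \<omega> - L.A n \<omega>)" for n \<omega>
  have R_meas: "R n \<in> borel_measurable M" for n
  proof (cases "n = 0")
    case False
    then have [measurable]: "a_hat n \<in> borel_measurable M" "b_hat n \<in> borel_measurable M"
      using est_meas by auto
    show ?thesis unfolding R_def[abs_def] L.Z_def using False by simp
  qed (simp add: R_def[abs_def])
  have R_small: "small_o_P M R"
  proof (rule whp_small_o_P)
    fix e :: real assume "e > 0"
    show "whp M (\<lambda>n \<omega>. norm (R n \<omega>) \<le> e)"
      by (rule whp_mono[OF L.Z_minus_A_small[OF \<open>e > 0\<close>]])
        (use \<open>e > 0\<close> in \<open>auto simp: R_def\<close>)
  qed
  have zero_small: "small_o_P M (\<lambda>n \<omega>. 0 :: real \<times> (real ^ 'p))"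
    by (simp add: small_o_P_def)
  obtain \<mu> where \<mu>: "is_normal_vec 0 (Gamma_op \<pi> x) \<mu>" using L.exists_normal_Gamma by blast
  \<comment> \<open>For \<open>n \<ge> 1\<close> the sum \<open>A + R\<close> is the rescaled
    estimator itself, so both sides are laws of the same function.\<close>
  have distr_eq: "distr M borel (\<lambda>\<omega>.
           (sqrt (real (k n)) * (a_hat n \<omega> - (logit \<circ> \<pi>) x),
            (tau f\<^sub>X n (k n) x * sqrt (real (k n))) *\<^sub>R (b_hat n \<omega> - gradient (logit \<circ> \<pi>) x)))
         = distr M borel (\<lambda>\<omega>. L.A n \<omega> + R n \<omega>)" if "n \<ge> 1" for n
    using that by (intro distr_cong refl)
      (simp add: R_def L.Z_def L.rate_def L.\<tau>_def L.l0_def L.g0_def)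
  show ?thesis
  proof (rule exI[of _ L.W], rule exI[of _ "\<lambda>n _. L.T n"], rule exI[of _ R], rule exI[of _ "\<lambda>_ _. 0"], rule exI[of _ L.A],
      intro conjI allI ballI impI)
    show "\<exists>\<mu>. is_normal_vec 0 (Gamma_op \<pi> x) \<mu> \<and> weak_conv_vec (\<lambda>n. distr M borel (L.W n)) \<mu>"
      using \<mu> L.W_weak_conv[OF \<mu>] by blast
    show "is_arg_max (limit_objective \<pi> f\<^sub>X c x (L.W n \<omega> + L.T n)) (\<lambda>_. True) (L.A n \<omega>)" for n \<omega>
      unfolding L.A_def by (rule is_arg_max_limit_argmax[of \<pi> x, OF A2(2)])
    show "L.T n = ((tau f\<^sub>X n (k n) x)\<^sup>2 * sqrt (real (k n))) *\<^sub>R (bias_coeff \<pi> x *\<^sub>R (1, 0) + 0)" for n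
      by (simp add: L.T_def L.\<tau>_def)
  qed (use R_meas R_small zero_small distr_eq in auto)
qed

end
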